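(* Let $S\subset\mathbb R^{2n}$ be a convex body that is centrally symmetric with respect to the origin, and let $L\subset\mathbb R^{2n}$ be an isotropic linear subspace with $\dim L<n$. Let $L^\omega$ be the $\omega$-orthogonal complement of $L$ and let $$S'=(S\cap L^\omega)/L\subset L^\omega/L$$ be the linear symplectic reduction of $S$ along $L$. Then $$c_{EHZ}(S')\ \ge\ c_{EHZ}(S).$$
   Context: $\mathbb R^{2n}$ has coordinates $q_1,\dots,q_n,p_1,\dots,p_n$ and the standard symplectic form $\omega=\sum_{i=1}^n dp_i\wedge dq_i$. A linear subspace $L$ is isotropic if $\omega|_L=0$; then $L\subset L^\omega=\{v:\omega(v,u)=0\ \forall u\in L\}$. The set $(S\cap L^\omega)/L$ is the image of $S\cap L^\omega$ under the linear quotient map $L^\omega\to L^\omega/L$. The form $\omega$ induces a (linear) symplectic form on $L^\omega/L$, so $L^\omega/L$ is linearly symplectomorphic to a standard $\mathbb R^{2m}$ with $m=n-\dim L$, and $S'$ is a centrally symmetric convex body in it. The Ekeland--Hofer--Zehnder capacity $c_{EHZ}(S)$ of a convex body $S$ with smooth boundary in a symplectic vector space is the smallest action $\left|\int_\gamma\lambda\right|$, where $d\lambda=\omega$, among closed characteristics $\gamma$ of $\partial S$ (closed curves on $\partial S$ tangent at each point to the kernel of $\omega|_{\partial S}$); it is extended to all convex bodies by continuity in the Hausdorff metric. Equivalently (Clarke duality), for a convex body $S$ with the origin in its interior, put $\|v\|=\sup\{\omega(v,z): z\in S\}$; then $c_{EHZ}(S)=\tfrac14 m^2$, where $m$ is the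 minimum of $\int_\gamma\|\dot\gamma\|$ over closed curves $\gamma$ with $\int_\gamma\lambda=1$. With this normalization the unit ball has capacity $\pi$. *)

theory Defs
  imports "HOL-Analysis.Analysis"
begin

section \<open>The standard symplectic space\<close>

text \<open>A point of \<open>\<real>\<^sup>2\<^sup>n\<close> is a pair \<open>(q, p)\<close>, with \<open>n = CARD('n)\<close>.\<close>

type_synonym 'n phase = "(real ^ 'n) \<times> (real ^ 'n)"

text \<open>\<open>\<omega> = \<Sum> dp\<^sub>i \<and> dq\<^sub>i\<close>, i.e. \<open>\<omega>(v, w) = \<Sum> (dp\<^sub>i(v) dq\<^sub>i(w) - dp\<^sub>i(w) dq\<^sub>i(v))\<close>.\<close>

definition symp_form :: "'n::finite phase \<Rightarrow> 'n phase \<Rightarrow> real" where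
  "symp_form v w = (\<Sum>i\<in>UNIV. snd v $ i * fst w $ i - snd w $ i * fst v $ i)"

definition symp_complement :: "'n::finite phase set \<Rightarrow> 'n phase set" where
  "symp_complement L = {v. \<forall>u\<in>L. symp_form v u = 0}"

definition isotropic :: "'n::finite phase set \<Rightarrow> bool" where
  "isotropic L \<longleftrightarrow> subspace L \<and> (\<forall>u\<in>L. \<forall>v\<in>L. symp_form u v = 0)"


section \<open>Convex bodies\<close>

definition convex_body :: "'a::euclidean_space set \<Rightarrow> bool" where
  "convex_body S \<longleftrightarrow> compact S \<and> convex S \<and> interior S \<noteq> {}"

definition centrally_symmetric :: "'a::real_vector set \<Rightarrow> bool" where
  "centrally_symmetric S \<longleftrightarrow> (\<forall>x\<in>S. - x \<in> S)"

text \<open>The Hausdorff distance; meaningful for nonempty bounded sets only.\<close>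

definition hausdorff_dist :: "'a::metric_space set \<Rightarrow> 'a set \<Rightarrow> real" where
  "hausdorff_dist A B = max (SUP x\<in>A. infdist x B) (SUP y\<in>B. infdist y A)"

text \<open>\<open>C\<^sup>k\<close> functions on an open set, by iterated directional derivatives. In the successor case
  continuity of the derivative is imposed by the base case of the recursion.\<close>

primrec Ck_on :: "nat \<Rightarrow> 'a::euclidean_space set \<Rightarrow> ('a \<Rightarrow> real) \<Rightarrow> bool" where
  "Ck_on 0 U f \<longleftrightarrow> continuous_on U f"
| "Ck_on (Suc k) U f \<longleftrightarrow> (\<forall>x\<in>U. f differentiable (at x)) \<and>
     (\<forall>v. Ck_on k U (\<lambda>x. frechet_derivative f (at x) v))"

definition smooth_on :: "'a::euclidean_space set \<Rightarrow> ('a \<Rightarrow> real) \<Rightarrow> bool" where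
  "smooth_on U f \<longleftrightarrow> (\<forall>k. Ck_on k U f)"

definition boundary_defining :: "'a::euclidean_space set \<Rightarrow> 'a set \<Rightarrow> ('a \<Rightarrow> real) \<Rightarrow> bool" where
  "boundary_defining S U f \<longleftrightarrow> open U \<and> smooth_on U f \<and>
     frontier S \<inter> U = {x \<in> U. f x = 0} \<and>
     (\<forall>x\<in>frontier S \<inter> U. \<exists>v. frechet_derivative f (at x) v \<noteq> 0)"

definition smooth_boundary :: "'a::euclidean_space set \<Rightarrow> bool" where
  "smooth_boundary S \<longleftrightarrow> (\<forall>x\<in>frontier S. \<exists>U f. x \<in> U \<and> boundary_defining S U f)"

definition boundary_tangent :: "'a::euclidean_space set \<Rightarrow> 'a \<Rightarrow> 'a set" where
  "boundary_tangent S x =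
     {v. \<exists>U f. x \<in> U \<and> boundary_defining S U f \<and> frechet_derivative f (at x) v = 0}"


section \<open>The Ekeland--Hofer--Zehnder capacity\<close>

text \<open>The kernel of the restriction of \<open>\<omega>\<close> to the tangent space of the boundary.\<close>

definition characteristic_line :: "'n::finite phase set \<Rightarrow> 'n phase \<Rightarrow> 'n phase set" where
  "characteristic_line S x =
     {v \<in> boundary_tangent S x. \<forall>w\<in>boundary_tangent S x. symp_form v w = 0}"

text \<open>Closed characteristics are parametrized over \<open>[0, 1]\<close> by regular \<open>C\<^sup>1\<close> curves; without
  \<open>\<gamma>' \<noteq> 0\<close> the constant curves, of action \<open>0\<close>, would qualify. As the kernel of the restricted
  form is a line, \<open>\<gamma>'(0)\<close> and \<open>\<gamma>'(1)\<close> are parallel.\<close>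

definition closed_characteristic :: "'n::finite phase set \<Rightarrow> (real \<Rightarrow> 'n phase) \<Rightarrow> bool" where
  "closed_characteristic S \<gamma> \<longleftrightarrow>
     \<gamma> 0 = \<gamma> 1 \<and> \<gamma> ` {0..1} \<subseteq> frontier S \<and>
     (\<exists>\<gamma>'. continuous_on {0..1} \<gamma>' \<and>
        (\<forall>t\<in>{0..1}. (\<gamma> has_vector_derivative \<gamma>' t) (at t within {0..1}) \<and>
           \<gamma>' t \<noteq> 0 \<and> \<gamma>' t \<in> characteristic_line S (\<gamma> t)))"

text \<open>The primitive of \<open>\<omega>\<close> used is \<open>\<lambda> = (\<Sum> p\<^sub>i dq\<^sub>i - q\<^sub>i dp\<^sub>i) / 2\<close>, i.e.
  \<open>\<lambda>\<^sub>z(v) = \<omega>(z, v) / 2\<close>; on closed curves all primitives have the same integral.\<close>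

definition action :: "(real \<Rightarrow> 'n::finite phase) \<Rightarrow> real" where
  "action \<gamma> = \<bar>integral {0..1}
     (\<lambda>t. symp_form (\<gamma> t) (vector_derivative \<gamma> (at t within {0..1})) / 2)\<bar>"

definition smooth_ehz_capacity :: "'n::finite phase set \<Rightarrow> real" where
  "smooth_ehz_capacity S = Inf {action \<gamma> | \<gamma>. closed_characteristic S \<gamma>}"

text \<open>Extension by continuity in the Hausdorff metric: the limit of the capacities of the convex
  bodies with smooth boundary that approach \<open>S\<close>. A body \<open>S\<close> with smooth boundary is itself among
  the \<open>T\<close> below, so that the limit is then \<open>smooth_ehz_capacity S\<close>.\<close>

definition ehz_capacity :: "'n::finite phase set \<Rightarrow> real" where
  "ehz_capacity S = (THE c. \<forall>\<epsilon>>0. \<exists>\<delta>>0. \<forall>T.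
     convex_body T \<and> smooth_boundary T \<and> hausdorff_dist S T < \<delta> \<longrightarrow>
       \<bar>smooth_ehz_capacity T - c\<bar> < \<epsilon>)"


section \<open>Linear symplectic reduction\<close>

text \<open>The linear quotient map \<open>v \<mapsto> v + L\<close>.\<close>

definition quotient_map :: "'a::real_vector set \<Rightarrow> 'a \<Rightarrow> 'a set" where
  "quotient_map L v = (\<lambda>u. v + u) ` L"

definition symplectic_reduction :: "'n::finite phase set \<Rightarrow> 'n phase set \<Rightarrow> 'n phase set set" where
  "symplectic_reduction S L = quotient_map L ` (S \<inter> symp_complement L)"

text \<open>Linear symplectomorphisms from the quotient of \<open>symp_complement L\<close> by \<open>L\<close>, whose operations
  and symplectic form are induced from representatives, onto the standard symplectic space
  \<open>'m phase\<close>. Existence of \<open>\<Phi>\<close> forces \<open>CARD('m) = CARD('n) - dim L\<close>.\<close>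

definition reduction_symplectomorphism ::
    "'n::finite phase set \<Rightarrow> ('n phase set \<Rightarrow> 'm::finite phase) \<Rightarrow> bool" where
  "reduction_symplectomorphism L \<Phi> \<longleftrightarrow>
     bij_betw \<Phi> (quotient_map L ` symp_complement L) UNIV \<and>
     (\<forall>u\<in>symp_complement L. \<forall>v\<in>symp_complement L.
        \<Phi> (quotient_map L (u + v)) = \<Phi> (quotient_map L u) + \<Phi> (quotient_map L v)) \<and>
     (\<forall>c. \<forall>u\<in>symp_complement L.
        \<Phi> (quotient_map L (c *\<^sub>R u)) = c *\<^sub>R \<Phi> (quotient_map L u)) \<and>
     (\<forall>u\<in>symp_complement L. \<forall>v\<in>symp_complement L.
        symp_form (\<Phi> (quotient_map L u)) (\<Phi> (quotient_map L v)) = symp_form u v)"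

end

theory Submission
  imports Defs "HOL-Complex_Analysis.Great_Picard"
begin

text \<open>Clarke duality turns the capacity into an isoperimetric problem. Measure a vector \<open>v\<close> by
\<open>sup {\<omega>(v, z) | z \<in> T}\<close>; the unit ball of this (possibly asymmetric) norm is the symplectic polar of \<open>T\<close>. Let \<open>I(T)\<close> be
the supremum of \<open>\<integral> \<omega>(\<gamma>', \<gamma>) / length(\<gamma>)\<^sup>2\<close> over closed curves \<open>\<gamma>\<close>. Then the capacity is
\<open>1 / (2 I(T))\<close> (\<open>ehz_capacity_eq\<close>), so the claim is \<open>I(S') \<le> I(S)\<close>. The curves can be taken to be
closed polygons with \<open>N\<close> edges in the polar, the length being replaced by its bound \<open>N\<close>; this
version of \<open>I\<close> is \<open>iso_const\<close>, and it makes the reduction inequality purely algebraic.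

\<^bold>\<open>Reduction.\<close> By separation, the polar of \<open>S \<inter> L\<^sup>\<omega>\<close> lies in \<open>L\<close> plus the polar of \<open>S\<close>
(\<open>symp_polar_section\<close>). So each edge of a polygon for \<open>S'\<close> lifts to an edge in \<open>L\<^sup>\<omega>\<close> that is
admissible for \<open>S\<close>, and the action does not see the choice of the lift, as \<open>\<omega>\<close> on \<open>L\<^sup>\<omega>\<close> does not
see \<open>L\<close>. The lift of a closed polygon need not be closed: its edges sum to an element of \<open>L\<close>. Central
symmetry repairs this. Cut a closed polygon into two halves of the same number of edges and complete
each half by its point reflection; the areas of the two resulting polygons add up to twice the
original area (\<open>area2_half\<close>, \<open>area2_reflect\<close>). So only halves have to be lifted, and a half followed by
its reflection is closed whatever its edges are (\<open>iso_const_reduction_le\<close>).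

\<^bold>\<open>Bodies with smooth boundary.\<close> Along a closed characteristic \<open>\<gamma>\<close> the functional \<open>\<omega>(\<gamma>', \<cdot>)\<close> is
extremal on \<open>T\<close> at \<open>\<gamma>\<close>, so the length of \<open>\<gamma>\<close> is twice its action. Inscribed polygons with
vertices at equal distances along \<open>\<gamma>\<close> then show that no closed characteristic has action below
\<open>1 / (2 I(T))\<close> (\<open>closed_characteristic_action_ge\<close>). Conversely, polygons of maximal area with \<open>N\<close> edges
exist by compactness. Their first-order condition, with a Lagrange multiplier for closedness, says
that after a translation each edge maximizes \<open>\<omega>(\<cdot>, \<zeta>)\<close> over the polar, where \<open>\<zeta>\<close> is the midpoint of
the edge. This is a discrete Hamilton equation for the gauge of \<open>T\<close>. By Arzela--Ascoli a
subsequence of the rescaled polygons converges. As the boundary is smooth, the maximizer is unique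
and depends continuously on \<open>\<zeta>\<close>, so the limit solves the Hamilton equation; the gauge is constant
along it and equals \<open>I(T)\<close> (\<open>extremal_limit\<close>), and scaling it to the boundary gives a closed
characteristic of action \<open>1 / (2 I(T))\<close>.

\<^bold>\<open>General bodies.\<close> \<open>I\<close> is antitone and homogeneous, which makes \<open>1 / (2 I)\<close> continuous for the
Hausdorff distance at bodies around the origin. Such a body is a limit of bodies with smooth boundary,
namely of sublevel sets of sums of exponentials of finitely many supporting functionals. Hence the
limit that defines the capacity exists, is unique, and is \<open>1 / (2 I)\<close>.\<close>

section \<open>The symplectic form and the symplectic polar\<close>

text \<open>The complex structure for which \<open>\<omega>(v, w) = J v \<bullet> w\<close>. It transfers separation theorems, stated with inner products, to \<open>\<omega>\<close>.\<close>

definition J :: "'n::finite phase \<Rightarrow> 'n phase" where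
  "J v = (snd v, - fst v)"

lemma symp_form_eq_inner: "symp_form v w = J v \<bullet> w"
  unfolding symp_form_def J_def
  by (simp add: inner_prod_def inner_vec_def sum_subtractf sum_negf mult.commute)

lemma J_J [simp]: "J (J v) = - v"
  by (simp add: J_def prod_eq_iff)

lemma linear_J: "linear J"
  by (rule linearI) (auto simp: J_def)

lemma J_minus [simp]: "J (- v) = - J v" and J_scaleR [simp]: "J (c *\<^sub>R v) = c *\<^sub>R J v"
  by (simp_all add: J_def)

lemma norm_J [simp]: "norm (J v) = norm v"
  by (simp add: J_def norm_Pair norm_prod_def add.commute)

lemma inner_J_J [simp]: "J v \<bullet> J w = v \<bullet> w"
  by (simp add: J_def inner_prod_def add.commute)

lemma J_eq_iff [simp]: "J v = J w \<longleftrightarrow> v = w"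
  by (auto simp: J_def prod_eq_iff)

lemma inner_eq_symp_form: "a \<bullet> w = symp_form w (J a)"
  by (simp add: symp_form_eq_inner inner_commute)

lemma bounded_bilinear_symp_form: "bounded_bilinear symp_form"
proof -
  have "bounded_linear J"
    using linear_J by (rule linear_conv_bounded_linear[THEN iffD1])
  then have "bounded_bilinear (\<lambda>v w. J v \<bullet> w)"
    by (rule bounded_bilinear.comp1[OF bounded_bilinear_inner])
  then show ?thesis
    by (simp add: symp_form_eq_inner[abs_def])
qed

interpretation symp: bounded_bilinear symp_form
  by (rule bounded_bilinear_symp_form)

lemmas symp_simps = symp.add_left symp.add_right symp.diff_left symp.diff_right
  symp.scaleR_left symp.scaleR_right

declare symp.zero_left [simp] symp.zero_right [simp] symp.minus_left [simp] symp.minus_right [simp]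

lemma symp_form_commute: "symp_form v w = - symp_form w v"
  by (simp add: symp_form_def sum_negf[symmetric])

lemma symp_form_self [simp]: "symp_form v v = 0"
  using symp_form_commute[of v v] by simp

lemma abs_symp_form_le: "\<bar>symp_form v w\<bar> \<le> norm v * norm w"
  unfolding symp_form_eq_inner using Cauchy_Schwarz_ineq2[of "J v" w] by simp

lemma symp_form_le: "symp_form v w \<le> norm v * norm w"
  using abs_symp_form_le[of v w] by simp

lemma symp_form_nondegenerate:
  assumes "\<And>w. symp_form v w = symp_form v' w"
  shows "v = v'"
proof -
  have "J v = J v'"
    using assms unfolding symp_form_eq_inner by (metis vector_eq_ldot inner_commute)
  then show ?thesis by simp
qed

text \<open>The unit ball of \<open>v \<mapsto> sup {\<omega>(v, z) | z \<in> T}\<close>: up to the rotation \<open>J\<close>, the usual polar of \<open>T\<close>.\<close>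

definition symp_polar :: "'n::finite phase set \<Rightarrow> 'n phase set" where
  "symp_polar T = {v. \<forall>z\<in>T. symp_form v z \<le> 1}"

lemma symp_polarD: "v \<in> symp_polar T \<Longrightarrow> z \<in> T \<Longrightarrow> symp_form v z \<le> 1"
  by (simp add: symp_polar_def)

lemma zero_in_symp_polar [simp]: "0 \<in> symp_polar T"
  by (simp add: symp_polar_def)

lemma convex_symp_polar: "convex (symp_polar T)"
  unfolding convex_alt symp_polar_def by (auto simp: symp_simps intro!: convex_bound_le)

lemma closed_symp_polar: "closed (symp_polar T)"
proof -
  have "symp_polar T = (\<Inter>z\<in>T. {v. symp_form v z \<le> 1})"
    by (auto simp: symp_polar_def)
  moreover have "closed {v. symp_form v z \<le> 1}" for z :: "'a phase"
    by (intro closed_Collect_le continuous_intros bounded_linear.continuous_on[OF symp.bounded_linear_left])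
  ultimately show ?thesis by auto
qed

lemma cball_subset_symp_polar:
  assumes "T \<subseteq> cball 0 R" "R > 0"
  shows "cball 0 (1 / R) \<subseteq> symp_polar T"
proof
  fix v :: "'a phase" assume v: "v \<in> cball 0 (1 / R)"
  show "v \<in> symp_polar T"
    unfolding symp_polar_def
  proof safe
    fix a b assume "(a, b) \<in> T"
    then have "norm (a, b) \<le> R" using assms by (auto simp del: norm_Pair)
    then have "norm v * norm (a, b) \<le> 1 / R * R"
      using v assms(2) by (intro mult_mono) auto
    then show "symp_form v (a, b) \<le> 1"
      using symp_form_le[of v "(a, b)"] assms(2) by simp
  qed
qed

lemma symp_polar_subset_cball:
  assumes "cball 0 r \<subseteq> T" "r > 0"
  shows "symp_polar T \<subseteq> cball 0 (1 / r)"
proof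
  fix v assume v: "v \<in> symp_polar T"
  show "v \<in> cball 0 (1 / r)"
  proof (cases "v = 0")
    case False
    let ?z = "(r / norm v) *\<^sub>R J v"
    have "?z \<in> T" using assms False by (intro subsetD[OF assms(1)]) auto
    then have "symp_form v ?z \<le> 1" using v by (rule symp_polarD[rotated])
    moreover have "symp_form v ?z = r * norm v"
      using False by (simp add: symp_form_eq_inner power2_norm_eq_inner[symmetric] power2_eq_square)
    ultimately show ?thesis using assms(2) by (simp add: field_simps)
  qed (use assms in simp)
qed

text \<open>The bipolar theorem: a point outside \<open>T\<close> is cut off by a hyperplane, and rotating its normal gives an element of the polar that exceeds \<open>1\<close> at the point.\<close>

lemma symp_bipolar:
  assumes "closed T" "convex T" "0 \<in> T"
    and y: "\<And>v. v \<in> symp_polar T \<Longrightarrow> symp_form v y \<le> 1"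
  shows "y \<in> T"
proof (rule ccontr)
  assume "y \<notin> T"
  then obtain a b where ab: "a \<bullet> y < b" "\<And>x. x \<in> T \<Longrightarrow> b < a \<bullet> x"
    using separating_hyperplane_closed_point[OF assms(2,1)] by metis
  have b: "b < 0" using ab(2)[OF assms(3)] by simp
  define v where "v = (1 / b) *\<^sub>R (- J a)"
  have v: "symp_form v x = (1 / b) * (a \<bullet> x)" for x
    unfolding v_def by (simp add: symp_simps) (simp add: symp_form_eq_inner)
  have "v \<in> symp_polar T"
    unfolding symp_polar_def using ab(2) b by (auto simp: v divide_simps intro: less_imp_le)
  then have "symp_form v y \<le> 1" by (rule y)
  then show False using ab(1) b by (simp add: v divide_simps)
qed

section \<open>The isoperimetric constant\<close>

text \<open>For a closed polygon with edges \<open>v 0, \<dots>, v (N - 1)\<close> this is \<open>\<integral> \<omega>(dx, x)\<close> along the polygon, that is,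
twice its symplectic area (up to orientation); it makes sense for open polygons as well, which are
then closed by a chord.\<close>

definition area2 :: "(nat \<Rightarrow> 'n::finite phase) \<Rightarrow> nat \<Rightarrow> real" where
  "area2 v N = (\<Sum>i<N. symp_form (v i) (\<Sum>j<i. v j))"

lemma area2_0 [simp]: "area2 v 0 = 0"
  by (simp add: area2_def)

lemma area2_Suc: "area2 v (Suc N) = area2 v N + symp_form (v N) (\<Sum>j<N. v j)"
  by (simp add: area2_def)

lemma area2_cong: "(\<And>i. i < N \<Longrightarrow> v i = w i) \<Longrightarrow> area2 v N = area2 w N"
  unfolding area2_def by (intro sum.cong refl arg_cong2[of _ _ _ _ symp_form]) auto

lemma area2_scaleR: "area2 (\<lambda>i. c *\<^sub>R v i) N = c\<^sup>2 * area2 v N"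
  by (induction N)
     (simp_all add: area2_Suc symp_simps scaleR_sum_right[symmetric] algebra_simps power2_eq_square)

lemma area2_minus: "area2 (\<lambda>i. - v i) N = area2 v N"
  using area2_scaleR[of "-1" v N] by simp

lemma sum_shift_add: "(\<Sum>i<k + l. v i) = (\<Sum>i<k. v i) + (\<Sum>i<l. v (k + i))" for v :: "nat \<Rightarrow> 'a::comm_monoid_add"
  by (induction l) (auto simp: add.assoc)

lemma area2_concat:
  "area2 v (k + l) = area2 v k + area2 (\<lambda>i. v (k + i)) l + symp_form (\<Sum>i<l. v (k + i)) (\<Sum>i<k. v i)"
proof (induction l)
  case (Suc l)
  show ?case
    by (simp add: area2_Suc Suc.IH sum_shift_add symp_simps)
qed simp

text \<open>Repeating every edge scales the polygon by \<open>2\<close>, up to a subdivision of its edges.\<close>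

lemma double_edges:
  fixes v :: "nat \<Rightarrow> 'n::finite phase"
  shows "(\<Sum>i<2 * N. v (i div 2)) = 2 *\<^sub>R (\<Sum>i<N. v i)"
    and "area2 (\<lambda>i. v (i div 2)) (2 * N) = 4 * area2 v N"
proof -
  show *: "(\<Sum>i<2 * N. v (i div 2)) = 2 *\<^sub>R (\<Sum>i<N. v i)" for N
    by (induction N) (simp_all add: algebra_simps scaleR_2)
  show "area2 (\<lambda>i. v (i div 2)) (2 * N) = 4 * area2 v N"
    by (induction N) (simp_all add: area2_Suc * symp_simps)
qed

text \<open>The chord between the first and the middle vertex cuts a closed polygon into two pieces whose areas
add up to the area of the polygon, so one of them has at least half of it.\<close>

lemma area2_half:
  assumes "(\<Sum>i<2 * k. v i) = 0"
  obtains u where "\<And>i. i < k \<Longrightarrow> u i \<in> v ` {..<2 * k}" "2 * area2 u k \<ge> area2 v (2 * k)"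
proof -
  let ?w = "\<lambda>i. v (k + i)"
  have "(\<Sum>i<k. ?w i) = - (\<Sum>i<k. v i)"
    using assms unfolding mult_2 sum_shift_add by (simp add: eq_neg_iff_add_eq_0 add.commute)
  then have "area2 v (2 * k) = area2 v k + area2 ?w k"
    by (simp add: mult_2 area2_concat)
  then consider "2 * area2 v k \<ge> area2 v (2 * k)" | "2 * area2 ?w k \<ge> area2 v (2 * k)"
    by linarith
  then show ?thesis
    by cases (rule that[of v] that[of ?w]; auto)+
qed

text \<open>A polygon followed by its point reflection closes up whatever its edges are; this is where central
symmetry will be used.\<close>

lemma area2_reflect:
  fixes u :: "nat \<Rightarrow> 'n::finite phase" and k :: nat
  defines "w \<equiv> (\<lambda>i. if i < k then u i else - u (i - k))"
  shows "(\<Sum>i<2 * k. w i) = 0" and "area2 w (2 * k) = 2 * area2 u k"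
proof -
  have 1: "(\<Sum>i<k. w i) = (\<Sum>i<k. u i)" "(\<Sum>i<k. w (k + i)) = - (\<Sum>i<k. u i)"
    by (simp_all add: w_def sum_negf)
  show "(\<Sum>i<2 * k. w i) = 0"
    unfolding mult_2 sum_shift_add 1 by simp
  have "area2 w k = area2 u k"
    by (rule area2_cong) (simp add: w_def)
  moreover have "area2 (\<lambda>i. w (k + i)) k = area2 u k"
    using area2_minus[of u k] by (simp add: w_def)
  ultimately show "area2 w (2 * k) = 2 * area2 u k"
    unfolding mult_2 area2_concat 1 by simp
qed

lemma bounded_subset_cball_0E:
  fixes S :: "'a::real_normed_vector set"
  assumes "bounded S"
  obtains R where "R > 0" "S \<subseteq> cball 0 R"
proof -
  obtain R where "R > 0" "\<forall>x\<in>S. norm x \<le> R"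
    using assms unfolding bounded_pos by blast
  then show ?thesis by (intro that[of R]) auto
qed

text \<open>A polygon with \<open>N\<close> edges in the polar has length at most \<open>N\<close>, so for positive area these are lower
bounds for twice the area over the squared length. Counting edges instead of measuring lengths leaves a compact
set of polygons for each \<open>N\<close> and makes the two halves of a polygon equally long by definition.\<close>

definition iso_ratios :: "'n::finite phase set \<Rightarrow> real set" where
  "iso_ratios T = {area2 v N / (real N)\<^sup>2 | v N. N > 0 \<and> v ` {..<N} \<subseteq> symp_polar T \<and> (\<Sum>i<N. v i) = 0}"

definition iso_const :: "'n::finite phase set \<Rightarrow> real" where
  "iso_const T = Sup (iso_ratios T)"

lemma iso_ratiosI:
  "N > 0 \<Longrightarrow> v ` {..<N} \<subseteq> symp_polar T \<Longrightarrow> (\<Sum>i<N. v i) = 0 \<Longrightarrow> area2 v N / (real N)\<^sup>2 \<in> iso_ratios T"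
  by (auto simp: iso_ratios_def)

text \<open>Crude, but it gives the finiteness of the isoperimetric constant.\<close>

lemma area2_le:
  assumes v: "v ` {..<N} \<subseteq> cball 0 R" and R: "R \<ge> 0"
  shows "area2 v N \<le> R\<^sup>2 * (real N)\<^sup>2"
proof -
  have n: "norm (v i) \<le> R" if "i < N" for i
    using v that by force
  have s: "norm (\<Sum>j<i. v j) \<le> real N * R" if "i < N" for i
  proof -
    have "norm (\<Sum>j<i. v j) \<le> of_nat (card {..<i}) * R"
      using n that by (intro sum_norm_bound) auto
    also have "\<dots> \<le> real N * R"
      using that R by (intro mult_right_mono) auto
    finally show ?thesis .
  qed
  have "area2 v N \<le> (\<Sum>i<N. R * (real N * R))"
    unfolding area2_def
  proof (intro sum_mono order_trans[OF symp_form_le] mult_mono)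
    fix i assume "i \<in> {..<N}"
    then show "norm (v i) \<le> R" "norm (\<Sum>j<i. v j) \<le> real N * R"
      using n s by auto
  qed (use R in auto)
  then show ?thesis by (simp add: power2_eq_square algebra_simps)
qed

lemma bdd_above_iso_ratios:
  assumes "bounded (symp_polar T)"
  shows "bdd_above (iso_ratios T)"
proof -
  obtain R where R: "R > 0" "symp_polar T \<subseteq> cball 0 R"
    using assms bounded_subset_cball_0E by blast
  show ?thesis
  proof (rule bdd_aboveI)
    fix x assume "x \<in> iso_ratios T"
    then obtain v N where x: "x = area2 v N / (real N)\<^sup>2" "N > 0" "v ` {..<N} \<subseteq> symp_polar T"
      unfolding iso_ratios_def by blast
    have "area2 v N \<le> R\<^sup>2 * (real N)\<^sup>2"
      using x(3) R by (intro area2_le) auto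
    then show "x \<le> R\<^sup>2" using x(1,2) by (simp add: divide_le_eq)
  qed
qed

lemma iso_const_ge:
  assumes "bounded (symp_polar T)" "N > 0" "\<And>i. i < N \<Longrightarrow> v i \<in> symp_polar T" "(\<Sum>i<N. v i) = 0"
  shows "area2 v N / (real N)\<^sup>2 \<le> iso_const T"
  unfolding iso_const_def
  using assms by (intro cSup_upper bdd_above_iso_ratios iso_ratiosI) auto

lemma iso_ratios_nonempty: "iso_ratios (T :: 'a::finite phase set) \<noteq> {}"
proof -
  have "area2 (\<lambda>_. 0 :: 'a phase) 1 / (real 1)\<^sup>2 \<in> iso_ratios T"
    by (rule iso_ratiosI[of 1 "\<lambda>_. 0"]) auto
  then show ?thesis by blast
qed

lemma iso_const_leI:
  assumes "\<And>v N. N > 0 \<Longrightarrow> v ` {..<N} \<subseteq> symp_polar T \<Longrightarrow> (\<Sum>i<N. v i) = 0 \<Longrightarrow> area2 v N / (real N)\<^sup>2 \<le> b"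
  shows "iso_const T \<le> b"
  unfolding iso_const_def
proof (rule cSup_least[OF iso_ratios_nonempty])
  fix x assume "x \<in> iso_ratios T"
  then show "x \<le> b" unfolding iso_ratios_def using assms by blast
qed

text \<open>Monotonicity and homogeneity in one: \<open>k \<cdot> S \<subseteq> T\<close> implies \<open>I(T) \<le> I(k \<cdot> S) = I(S) / k\<^sup>2\<close>.\<close>

lemma iso_const_scale_le:
  assumes k: "k > 0" and sub: "\<And>x. x \<in> S \<Longrightarrow> k *\<^sub>R x \<in> T" and "bounded (symp_polar S)"
  shows "iso_const T \<le> iso_const S / k\<^sup>2"
proof (rule iso_const_leI)
  fix v :: "nat \<Rightarrow> 'a phase" and N assume v: "N > 0" "v ` {..<N} \<subseteq> symp_polar T" "(\<Sum>i<N. v i) = 0"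
  have "area2 (\<lambda>i. k *\<^sub>R v i) N / (real N)\<^sup>2 \<le> iso_const S"
  proof (rule iso_const_ge[OF assms(3) v(1)])
    fix i assume "i < N"
    then have vi: "v i \<in> symp_polar T" using v(2) by blast
    show "k *\<^sub>R v i \<in> symp_polar S"
      unfolding symp_polar_def
    proof (rule CollectI, rule ballI)
      fix x assume "x \<in> S"
      from symp_polarD[OF vi sub[OF this]]
      show "symp_form (k *\<^sub>R v i) x \<le> 1" by (simp add: symp.scaleR_left symp.scaleR_right)
    qed
  next
    show "(\<Sum>i<N. k *\<^sub>R v i) = 0" using v(3) by (simp flip: scaleR_sum_right)
  qed
  then have "k\<^sup>2 * area2 v N / (real N)\<^sup>2 \<le> iso_const S" by (simp only: area2_scaleR)
  then show "area2 v N / (real N)\<^sup>2 \<le> iso_const S / k\<^sup>2"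
    using k by (simp add: pos_le_divide_eq mult.commute)
qed

text \<open>A small square in the plane spanned by a vector and its rotation has positive area.\<close>

lemma iso_const_pos:
  assumes T: "bounded T" and D: "bounded (symp_polar (T :: 'n::finite phase set))"
  shows "iso_const T > 0"
proof -
  obtain R where R: "R > 0" "T \<subseteq> cball 0 R"
    using T bounded_subset_cball_0E by blast
  obtain b :: "'n phase" where b: "b \<in> Basis" using nonempty_Basis by blast
  define e where "e = (1 / R) *\<^sub>R b"
  have e: "norm e = 1 / R" using b R(1) by (simp add: e_def)
  \<comment> \<open>The square \<open>e, - J e, - e, J e\<close>; this orientation makes the area positive.\<close>
  define v where "v = (\<lambda>i::nat. if i = 0 then e else if i = 1 then - J e else if i = 2 then - e else J e)"
  have "area2 v 4 = 2 * (e \<bullet> e)"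
    by (simp add: area2_def v_def numeral_eq_Suc symp_simps)
       (simp add: symp_form_eq_inner inner_commute)
  then have "area2 v 4 > 0" using e R(1) by (simp add: power2_norm_eq_inner[symmetric])
  moreover have "(\<Sum>i<4. v i) = 0"
    by (simp add: v_def numeral_eq_Suc)
  moreover have "v i \<in> symp_polar T" for i
    by (rule subsetD[OF cball_subset_symp_polar[OF R(2,1)]]) (auto simp: v_def e)
  ultimately have "0 < area2 v 4 / (real 4)\<^sup>2" "area2 v 4 / (real 4)\<^sup>2 \<le> iso_const T"
    by (simp, intro iso_const_ge[OF D]) auto
  then show ?thesis by linarith
qed

section \<open>Symplectic reduction of the isoperimetric constant\<close>

lemma subspace_symp_complement: "subspace (symp_complement L)"
  by (auto simp: subspace_def symp_complement_def symp_simps)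

text \<open>The dual of an intersection is the sum of the duals. If \<open>u\<close> were not in the closed convex set
\<open>symp_polar S + L\<close>, a hyperplane would separate it; boundedness on \<open>L\<close> puts the normal, rotated, into
the complement of \<open>L\<close>, and the bipolar theorem puts it into \<open>S\<close>, where \<open>u\<close> is at most \<open>1\<close>.\<close>

lemma symp_polar_section:
  fixes S L :: "'n::finite phase set"
  assumes S: "compact S" "convex S" and r: "r > 0" "cball 0 r \<subseteq> S"
    and L: "subspace L"
    and u: "u \<in> symp_polar (S \<inter> symp_complement L)"
  obtains l where "l \<in> L" "u + l \<in> symp_polar S"
proof -
  have "\<exists>v\<in>symp_polar S. \<exists>l\<in>L. u = v + l"
  proof (rule ccontr)
    assume neg: "\<not> ?thesis"
    let ?C = "(\<Union>v\<in>symp_polar S. \<Union>l\<in>L. {v + l})"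
    have "u \<notin> ?C" using neg by auto
    moreover have "convex ?C"
      using convex_sums[OF convex_symp_polar subspace_imp_convex[OF L]] .
    moreover have "closed ?C"
    proof -
      have "compact (symp_polar S)"
        using symp_polar_subset_cball[OF r(2,1)] closed_symp_polar
        by (meson bounded_cball bounded_subset compact_eq_bounded_closed)
      from compact_closed_sums[OF this closed_subspace[OF L]] show ?thesis
        by (simp add: UNION_eq Bex_def conj_ac)
    qed
    ultimately obtain a b where ab: "a \<bullet> u < b" "\<And>x. x \<in> ?C \<Longrightarrow> b < a \<bullet> x"
      using separating_hyperplane_closed_point by metis
    have ab': "b < a \<bullet> (v + l)" if "v \<in> symp_polar S" "l \<in> L" for v l
      using that by (intro ab(2)) auto
    have b: "b < 0" using ab'[of 0 0] L by (simp add: subspace_0)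
    \<comment> \<open>A functional that is bounded below on a subspace vanishes there.\<close>
    have aL: "a \<bullet> l = 0" if l: "l \<in> L" for l
    proof (rule ccontr)
      assume *: "a \<bullet> l \<noteq> 0"
      have "(b / (a \<bullet> l)) *\<^sub>R l \<in> L" using l L by (simp add: subspace_scale)
      from ab'[OF zero_in_symp_polar this] show False using * by simp
    qed
    define y where "y = (1 / b) *\<^sub>R J a"
    have y: "symp_form v y = (a \<bullet> v) / b" for v
      by (simp add: y_def symp_simps inner_eq_symp_form)
    have "y \<in> symp_complement L"
      using aL by (auto simp: symp_complement_def symp_form_commute[of y] y)
    moreover have "y \<in> S"
    proof (rule symp_bipolar)
      show "0 \<in> S" using r by auto
      fix v assume "v \<in> symp_polar S"
      with ab'[of v 0] L b show "symp_form v y \<le> 1"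
        by (simp add: y subspace_0 divide_simps)
    qed (use S in \<open>auto intro: compact_imp_closed\<close>)
    ultimately have "symp_form u y \<le> 1" using symp_polarD[OF u] by auto
    then show False using ab(1) b by (simp add: y divide_simps)
  qed
  then obtain v l where "v \<in> symp_polar S" "l \<in> L" "u = v + l" by blast
  then show ?thesis using L by (intro that[of "- l"]) (auto simp: subspace_neg)
qed

lemma symp_polar_uminus:
  assumes "centrally_symmetric S" "v \<in> symp_polar S"
  shows "- v \<in> symp_polar S"
  unfolding symp_polar_def
proof (rule CollectI, rule ballI)
  fix z assume "z \<in> S"
  then have "- z \<in> S" using assms(1) by (simp add: centrally_symmetric_def)
  from symp_polarD[OF assms(2) this] show "symp_form (- v) z \<le> 1" by simp
qed

lemma iso_const_ge_half:
  assumes "bounded (symp_polar S)" "centrally_symmetric S" "k > 0" "\<And>i. i < k \<Longrightarrow> u i \<in> symp_polar S"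
  shows "2 * area2 u k / (real (2 * k))\<^sup>2 \<le> iso_const S"
proof -
  let ?w = "\<lambda>i. if i < k then u i else - u (i - k)"
  have "area2 ?w (2 * k) / (real (2 * k))\<^sup>2 \<le> iso_const S"
    using assms by (intro iso_const_ge area2_reflect) (auto intro: symp_polar_uminus)
  then show ?thesis by (simp add: area2_reflect)
qed

text \<open>The isoperimetric constant is already controlled by open polygons \<open>u\<close>, each standing for the closed
polygon made of \<open>u\<close> and its reflection. The number of edges is first doubled so that a polygon can be cut
into halves.\<close>

lemma iso_const_le_halves:
  assumes "\<And>u k. k > 0 \<Longrightarrow> (\<And>i. i < k \<Longrightarrow> u i \<in> symp_polar S) \<Longrightarrow> 2 * area2 u k / (real (2 * k))\<^sup>2 \<le> b"
  shows "iso_const S \<le> b"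
proof (rule iso_const_leI)
  fix v :: "nat \<Rightarrow> 'a phase" and N
  assume v: "N > 0" "v ` {..<N} \<subseteq> symp_polar S" "(\<Sum>i<N. v i) = 0"
  let ?v = "\<lambda>i. v (i div 2)"
  obtain u where u: "\<And>i. i < N \<Longrightarrow> u i \<in> ?v ` {..<2 * N}" "2 * area2 u N \<ge> area2 ?v (2 * N)"
    using v(3) area2_half[of ?v N] unfolding double_edges by auto
  have "u i \<in> symp_polar S" if "i < N" for i
    using u(1)[OF that] v(2) by auto
  from assms[OF v(1) this] have "2 * area2 u N / (real (2 * N))\<^sup>2 \<le> b" .
  moreover have "area2 v N / (real N)\<^sup>2 = area2 ?v (2 * N) / (real (2 * N))\<^sup>2"
    unfolding double_edges by (simp add: power_mult_distrib)
  moreover have "area2 ?v (2 * N) / (real (2 * N))\<^sup>2 \<le> 2 * area2 u N / (real (2 * N))\<^sup>2"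
    using u(2) by (intro divide_right_mono) auto
  ultimately show "area2 v N / (real N)\<^sup>2 \<le> b" by linarith
qed

locale reduction =
  fixes L :: "'n::finite phase set" and \<Phi> :: "'n phase set \<Rightarrow> 'm::finite phase"
  assumes isotropic: "isotropic L" and symplecto: "reduction_symplectomorphism L \<Phi>"
begin

abbreviation F :: "'n phase \<Rightarrow> 'm phase" where
  "F v \<equiv> \<Phi> (quotient_map L v)"

lemma F_add: "u \<in> symp_complement L \<Longrightarrow> v \<in> symp_complement L \<Longrightarrow> F (u + v) = F u + F v"
  using symplecto by (simp add: reduction_symplectomorphism_def)

lemma F_scaleR: "u \<in> symp_complement L \<Longrightarrow> F (c *\<^sub>R u) = c *\<^sub>R F u"
  using symplecto by (simp add: reduction_symplectomorphism_def)

lemma F_symp: "u \<in> symp_complement L \<Longrightarrow> v \<in> symp_complement L \<Longrightarrow> symp_form (F u) (F v) = symp_form u v"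
  using symplecto by (simp add: reduction_symplectomorphism_def)

lemma F_surj: obtains u where "u \<in> symp_complement L" "F u = w"
proof -
  have "w \<in> \<Phi> ` (quotient_map L ` symp_complement L)"
    using symplecto by (simp add: reduction_symplectomorphism_def bij_betw_def)
  then show ?thesis using that by blast
qed

lemma reduction_eq: "\<Phi> ` symplectic_reduction S L = F ` (S \<inter> symp_complement L)"
  by (auto simp: symplectic_reduction_def image_image)

lemma subspace_L: "subspace L"
  using isotropic by (simp add: isotropic_def)

text \<open>The induced form is well defined on the quotient.\<close>

lemma symp_form_add_L:
  assumes "u \<in> symp_complement L" "u' \<in> symp_complement L" "l \<in> L" "l' \<in> L"
  shows "symp_form (u + l) (u' + l') = symp_form u u'"
proof -
  have "symp_form u l' = 0" "symp_form u' l = 0" "symp_form l l' = 0"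
    using assms isotropic by (auto simp: isotropic_def symp_complement_def)
  then show ?thesis using symp_form_commute[of l u'] by (simp add: symp_simps)
qed

lemma convex_body_reduction:
  assumes S: "convex_body S" and r: "r > 0" "cball 0 r \<subseteq> S"
  shows "convex_body (\<Phi> ` symplectic_reduction S L)"
    and "0 \<in> interior (\<Phi> ` symplectic_reduction S L)"
proof -
  obtain P where P: "range P \<subseteq> symp_complement L" "linear P" "\<forall>v\<in>symp_complement L. P (id v) = v"
    using linear_exists_left_inverse_on[OF linear_id subspace_symp_complement[of L]] by auto
  have PV: "P x \<in> symp_complement L" for x using P(1) by auto
  \<comment> \<open>A linear projection \<open>P\<close> onto the complement makes the quotient map the restriction of a
    linear map of the whole space, which is continuous and open.\<close>
  define G where "G = (\<lambda>v. F (P v))"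
  have lin: "linear G"
    unfolding G_def
    by (rule linearI) (simp_all add: linear_add[OF P(2)] linear_scale[OF P(2)] F_add F_scaleR PV)
  have G: "G v = F v" if "v \<in> symp_complement L" for v
    using that P(3) by (simp add: G_def)
  have "w \<in> range G" for w
    using F_surj[of w] G by (metis rangeI)
  then have surj: "surj G" by auto
  have eq: "\<Phi> ` symplectic_reduction S L = G ` (S \<inter> symp_complement L)"
    unfolding reduction_eq using G by (intro image_cong) auto
  show 0: "0 \<in> interior (\<Phi> ` symplectic_reduction S L)"
  proof -
    have "open (P -` ball 0 r)"
      using P(2) by (intro continuous_open_vimage linear_continuous_at) (auto simp: linear_conv_bounded_linear)
    then have "open (G ` (P -` ball 0 r))"
      by (rule open_surjective_linear_image[OF _ lin surj])
    moreover have "G ` (P -` ball 0 r) \<subseteq> G ` (S \<inter> symp_complement L)"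
    proof (rule image_subsetI)
      fix v assume "v \<in> P -` ball 0 r"
      then have "P v \<in> S \<inter> symp_complement L" using r(2) PV by auto
      moreover have "G v = G (P v)" using G[OF PV] by (simp add: G_def)
      ultimately show "G v \<in> G ` (S \<inter> symp_complement L)" by (metis imageI)
    qed
    moreover have "0 \<in> G ` (P -` ball 0 r)"
      using linear_0[OF P(2)] linear_0[OF lin] r(1) by (intro image_eqI[of _ _ 0]) auto
    ultimately show ?thesis unfolding eq by (meson interiorI)
  qed
  have "compact (G ` (S \<inter> symp_complement L))"
    using S lin closed_subspace[OF subspace_symp_complement[of L]]
    by (intro compact_continuous_image linear_continuous_on compact_Int_closed)
       (auto simp: convex_body_def linear_conv_bounded_linear)
  moreover have "convex (G ` (S \<inter> symp_complement L))"
    using S subspace_imp_convex[OF subspace_symp_complement[of L]]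
    by (intro convex_linear_image[OF lin] convex_Int) (auto simp: convex_body_def)
  ultimately show "convex_body (\<Phi> ` symplectic_reduction S L)"
    using 0 eq by (auto simp: convex_body_def)
qed

text \<open>As the form on the quotient is computed with representatives, any representative of \<open>w\<close> is in the polar
of the section of \<open>S\<close>, and \<open>symp_polar_section\<close> corrects it by an element of \<open>L\<close>.\<close>

lemma symp_polar_lift:
  assumes S: "convex_body S" and r: "r > 0" "cball 0 r \<subseteq> S"
    and w: "w \<in> symp_polar (\<Phi> ` symplectic_reduction S L)"
  obtains u l where "u \<in> symp_complement L" "F u = w" "l \<in> L" "u + l \<in> symp_polar S"
proof -
  obtain u where u: "u \<in> symp_complement L" "F u = w" by (rule F_surj)
  have "u \<in> symp_polar (S \<inter> symp_complement L)"
    unfolding symp_polar_def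
  proof (rule CollectI, rule ballI)
    fix z assume z: "z \<in> S \<inter> symp_complement L"
    then have "F z \<in> \<Phi> ` symplectic_reduction S L" unfolding reduction_eq by blast
    from symp_polarD[OF w this] show "symp_form u z \<le> 1"
      using z u(1) by (simp add: F_symp flip: u(2))
  qed
  moreover have "compact S" "convex S" using S by (auto simp: convex_body_def)
  ultimately obtain l where "l \<in> L" "u + l \<in> symp_polar S"
    using symp_polar_section[OF _ _ r subspace_L] by blast
  with u that show ?thesis by blast
qed

text \<open>The heart of the theorem: halves of polygons are lifted edge by edge, which keeps their area, and the
lifts close up after reflection.\<close>

lemma iso_const_reduction_le:
  assumes S: "convex_body S" and r: "r > 0" "cball 0 r \<subseteq> S" and sym: "centrally_symmetric S"
  shows "iso_const (\<Phi> ` symplectic_reduction S L) \<le> iso_const S"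
proof (rule iso_const_le_halves)
  fix w and k :: nat
  assume k: "k > 0" and w: "\<And>i. i < k \<Longrightarrow> w i \<in> symp_polar (\<Phi> ` symplectic_reduction S L)"
  have "\<exists>p. fst p \<in> symp_complement L \<and> F (fst p) = w i \<and> snd p \<in> L \<and> fst p + snd p \<in> symp_polar S"
    if "i < k" for i
    using symp_polar_lift[OF S r w[OF that]] by (metis fst_conv snd_conv)
  then obtain p where p: "\<And>i. i < k \<Longrightarrow> fst (p i) \<in> symp_complement L \<and> F (fst (p i)) = w i \<and>
      snd (p i) \<in> L \<and> fst (p i) + snd (p i) \<in> symp_polar S"
    by metis
  let ?u = "\<lambda>i. fst (p i) + snd (p i)"
  have "area2 ?u k = area2 w k"
    unfolding area2_def symp.sum_right
  proof (intro sum.cong refl)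
    fix i j assume "i \<in> {..<k}" "j \<in> {..<i}"
    then have ij: "i < k" "j < k" by auto
    show "symp_form (?u i) (?u j) = symp_form (w i) (w j)"
      using p[OF ij(1)] p[OF ij(2)] symp_form_add_L F_symp by metis
  qed
  moreover have "2 * area2 ?u k / (real (2 * k))\<^sup>2 \<le> iso_const S"
    using p by (intro iso_const_ge_half sym k bounded_subset[OF bounded_cball symp_polar_subset_cball[OF r(2,1)]]) auto
  ultimately show "2 * area2 w k / (real (2 * k))\<^sup>2 \<le> iso_const S" by simp
qed

end

section \<open>The gauge and the characteristic directions\<close>

text \<open>The ball around the origin makes the polar compact and the gauge positive and finite; its radius is a
parameter so that Lipschitz constants can be named.\<close>

locale pointed_body =
  fixes T :: "'n::finite phase set" and r :: real
  assumes compact_T: "compact T" and convex_T: "convex T"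
    and r_pos: "r > 0" and cball_subset: "cball 0 r \<subseteq> T"
begin

abbreviation D :: "'n phase set" where "D \<equiv> symp_polar T"

lemma closed_T: "closed T"
  using compact_T by (rule compact_imp_closed)

lemma zero_in_T: "0 \<in> T"
  using cball_subset r_pos by auto

lemma D_subset: "D \<subseteq> cball 0 (1 / r)"
  by (rule symp_polar_subset_cball[OF cball_subset r_pos])

lemma norm_D: "w \<in> D \<Longrightarrow> norm w \<le> 1 / r"
  using D_subset by auto

lemma bounded_D: "bounded D"
  using D_subset bounded_cball bounded_subset by blast

lemma compact_D: "compact D"
  using bounded_D closed_symp_polar compact_eq_bounded_closed by blast

lemma iso_pos: "iso_const T > 0"
  by (rule iso_const_pos[OF compact_imp_bounded[OF compact_T] bounded_D])

text \<open>The Minkowski gauge of \<open>T\<close>, as the support function of the polar. In this form its maximizers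
\<open>w\<close> are the directions of the Hamiltonian flow of the gauge.\<close>

definition gauge :: "'n phase \<Rightarrow> real" where
  "gauge y = (SUP w\<in>D. symp_form w y)"

lemma gauge_attained: obtains w where "w \<in> D" "symp_form w y = gauge y"
proof -
  have "continuous_on D (\<lambda>w. symp_form w y)"
    by (intro bounded_linear.continuous_on[OF symp.bounded_linear_left] continuous_on_id)
  then obtain w where w: "w \<in> D" "\<forall>w'\<in>D. symp_form w' y \<le> symp_form w y"
    using continuous_attains_sup[OF compact_D] zero_in_symp_polar by blast
  then have "gauge y = symp_form w y"
    unfolding gauge_def by (intro cSup_eq_maximum) auto
  with w that show ?thesis by auto
qed

lemma gauge_upper: 
  assumes "w \<in> D" shows "symp_form w y \<le> gauge y"
proof -
  have "bdd_above ((\<lambda>w. symp_form w y) ` D)"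
  proof (rule bdd_aboveI2)
    fix w assume "w \<in> D"
    then show "symp_form w y \<le> 1 / r * norm y"
      using symp_form_le[of w y] mult_right_mono[OF norm_D norm_ge_zero] order_trans by blast
  qed
  then show ?thesis unfolding gauge_def using assms by (rule cSUP_upper2) auto
qed

lemma gauge_eqI: "v \<in> D \<Longrightarrow> (\<And>w. w \<in> D \<Longrightarrow> symp_form w y \<le> symp_form v y) \<Longrightarrow> gauge y = symp_form v y"
  unfolding gauge_def by (intro cSup_eq_maximum) auto

lemma gauge_nonneg: "gauge y \<ge> 0"
  using gauge_upper[OF zero_in_symp_polar, of y] by simp

lemma gauge_zero [simp]: "gauge 0 = 0"
  using gauge_eqI[OF zero_in_symp_polar, of 0] by simp

lemma gauge_scaleR:
  assumes "c \<ge> 0" shows "gauge (c *\<^sub>R y) = c * gauge y"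
proof -
  obtain w where w: "w \<in> D" "symp_form w y = gauge y" by (rule gauge_attained)
  have "gauge (c *\<^sub>R y) = symp_form w (c *\<^sub>R y)"
    using w assms by (intro gauge_eqI) (simp_all add: symp_simps mult_left_mono gauge_upper)
  then show ?thesis using w by (simp add: symp_simps)
qed

lemma gauge_pos_lower: obtains c where "c > 0" "\<And>y. c * norm y \<le> gauge y"
proof -
  obtain R where R: "R > 0" "T \<subseteq> cball 0 R"
    using bounded_subset_cball_0E[OF compact_imp_bounded[OF compact_T]] .
  have "1 / R * norm y \<le> gauge y" for y
  proof (cases "y = 0")
    case False
    let ?w = "(- 1 / (R * norm y)) *\<^sub>R J y"
    have "?w \<in> D"
      using R False by (intro subsetD[OF cball_subset_symp_polar[OF R(2,1)]]) auto
    then have "symp_form ?w y \<le> gauge y" by (rule gauge_upper)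
    moreover have "symp_form ?w y = 1 / R * norm y"
      using False R(1) by (simp add: symp_form_eq_inner[of _ y]
          power2_norm_eq_inner[symmetric] power2_eq_square)
    ultimately show ?thesis by simp
  qed simp
  with R(1) that[of "1 / R"] show ?thesis by simp
qed

lemma gauge_pos: "y \<noteq> 0 \<Longrightarrow> gauge y > 0"
proof -
  assume y: "y \<noteq> 0"
  obtain c where c: "c > 0" "\<And>y. c * norm y \<le> gauge y" using gauge_pos_lower by blast
  have "c * norm y > 0" using c(1) y by simp
  then show ?thesis using c(2)[of y] by linarith
qed

lemma gauge_lipschitz: "\<bar>gauge x - gauge y\<bar> \<le> norm (x - y) / r"
proof -
  have *: "gauge x - gauge y \<le> norm (x - y) / r" for x y
  proof -
    obtain w where w: "w \<in> D" "symp_form w x = gauge x" by (rule gauge_attained)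
    have "symp_form w (x - y) \<le> 1 / r * norm (x - y)"
      using symp_form_le[of w "x - y"] mult_right_mono[OF norm_D[OF w(1)] norm_ge_zero] order_trans by blast
    then show ?thesis using gauge_upper[OF w(1), of y] w(2) by (simp add: symp_simps)
  qed
  show ?thesis using *[of x y] *[of y x] by (simp add: norm_minus_commute abs_le_iff)
qed

lemma continuous_on_gauge: "continuous_on X gauge"
proof (rule continuous_onI)
  fix x e assume "x \<in> X" and e: "(0::real) < e"
  have "dist (gauge x') (gauge x) \<le> e" if "dist x' x < e * r" for x'
  proof -
    have "norm (x' - x) / r \<le> e" using that r_pos by (simp add: dist_norm field_simps)
    then show ?thesis using gauge_lipschitz[of x' x] by (simp add: dist_real_def)
  qed
  then show "\<exists>d>0. \<forall>x'\<in>X. dist x' x < d \<longrightarrow> dist (gauge x') (gauge x) \<le> e"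
    using e r_pos by (intro exI[of _ "e * r"]) auto
qed

lemma mem_T_iff: "y \<in> T \<longleftrightarrow> gauge y \<le> 1"
proof
  assume "y \<in> T"
  then show "gauge y \<le> 1" by (metis gauge_attained symp_polarD)
next
  assume "gauge y \<le> 1"
  then show "y \<in> T"
    using symp_bipolar[OF closed_T convex_T zero_in_T] gauge_upper order_trans by blast
qed

lemma frontier_iff: "y \<in> frontier T \<longleftrightarrow> gauge y = 1"
proof -
  have "interior T = {y. gauge y < 1}"
  proof (rule interior_unique)
    show "{y. gauge y < 1} \<subseteq> T" using mem_T_iff by auto
    show "open {y. gauge y < 1}" by (intro open_Collect_less continuous_on_gauge continuous_on_const)
    fix U assume U: "U \<subseteq> T" "open U"
    show "U \<subseteq> {y. gauge y < 1}"
    proof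
      fix y assume y: "y \<in> U"
      obtain e where e: "e > 0" "ball y e \<subseteq> U" using U(2) y openE by blast
      show "y \<in> {y. gauge y < 1}"
      proof (cases "y = 0")
        case False
        define c where "c = e / (2 * norm y)"
        have c: "c > 0" using e False by (simp add: c_def)
        have "dist y ((1 + c) *\<^sub>R y) = c * norm y"
          using c by (simp add: dist_norm algebra_simps)
        also have "\<dots> < e" using e False by (simp add: c_def)
        finally have "(1 + c) *\<^sub>R y \<in> T" using e(2) U(1) by auto
        then have "(1 + c) * gauge y \<le> 1" using c by (simp add: mem_T_iff gauge_scaleR)
        moreover have "gauge y < (1 + c) * gauge y" using c gauge_pos[OF False] by simp
        ultimately show ?thesis by simp
      qed simp
    qed
  qed
  then show ?thesis
    using closed_T mem_T_iff by (auto simp: frontier_def)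
qed

lemma frontier_supportE:
  assumes "x \<in> frontier T"
  obtains v where "v \<in> D" "symp_form v x = 1"
  using assms gauge_attained[of x] unfolding frontier_iff by metis

lemma frontier_subset: "x \<in> frontier T \<Longrightarrow> x \<in> T"
  by (simp add: frontier_iff mem_T_iff)

end

locale smooth_body = pointed_body T r for T :: "'n::finite phase set" and r +
  assumes smooth_T: "smooth_boundary T"
begin

lemma boundary_defining_facts:
  assumes "boundary_defining T U f" "x \<in> frontier T" "x \<in> U"
  shows "open U" "f x = 0" "continuous_on U f" "(f has_derivative frechet_derivative f (at x)) (at x)"
    "\<And>y. y \<in> U \<Longrightarrow> f y = 0 \<Longrightarrow> y \<in> frontier T"
    "\<exists>e. frechet_derivative f (at x) e = 1"
proof -
  have "Ck_on (Suc 0) U f" using assms by (simp add: boundary_defining_def smooth_on_def)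
  then have d: "\<And>y. y \<in> U \<Longrightarrow> f differentiable (at y)" by simp
  show "open U" "f x = 0" using assms by (auto simp: boundary_defining_def)
  show "continuous_on U f"
    using d by (intro continuous_at_imp_continuous_on ballI differentiable_imp_continuous_within) auto
  show D: "(f has_derivative frechet_derivative f (at x)) (at x)"
    using d[OF assms(3)] by (simp add: frechet_derivative_works)
  show "y \<in> frontier T" if "y \<in> U" "f y = 0" for y
    using assms(1) that by (auto simp: boundary_defining_def)
  obtain e where e: "frechet_derivative f (at x) e \<noteq> 0"
    using assms unfolding boundary_defining_def by blast
  have "linear (frechet_derivative f (at x))" using has_derivative_linear[OF D] .
  then have "frechet_derivative f (at x) ((1 / frechet_derivative f (at x) e) *\<^sub>R e) = 1"
    using e by (simp add: linear_scale)
  then show "\<exists>e. frechet_derivative f (at x) e = 1" by blast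
qed

text \<open>A supporting functional \<open>v\<close> at \<open>x\<close> cannot increase along a tangent vector \<open>w\<close>. Otherwise it
increases along \<open>w + c e\<close> for all small \<open>c\<close>, where \<open>e\<close> is transversal to the boundary; but the boundary
function changes its sign between \<open>w - \<eta> e\<close> and \<open>w + \<eta> e\<close>, so some such direction leads to a
boundary point, on which \<open>v\<close> would exceed \<open>1\<close>.\<close>

lemma tangent_le:
  assumes bd: "boundary_defining T U f" "x \<in> frontier T" "x \<in> U"
    and v: "v \<in> D" "symp_form v x = 1"
    and w: "frechet_derivative f (at x) w = 0"
  shows "symp_form v w \<le> 0"
proof (rule ccontr)
  assume "\<not> ?thesis"
  then have vw: "symp_form v w > 0" by simp
  note facts = boundary_defining_facts[OF bd]
  let ?f' = "frechet_derivative f (at x)"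
  obtain e where e: "?f' e = 1" using facts(6) by blast
  \<comment> \<open>So small that \<open>\<omega>(v, w + c e) > 0\<close> whenever \<open>\<bar>c\<bar> \<le> \<eta>\<close>.\<close>
  define \<eta> where "\<eta> = symp_form v w / (2 * (\<bar>symp_form v e\<bar> + 1))"
  have \<eta>: "\<eta> > 0" using vw by (simp add: \<eta>_def)
  have "\<eta> * \<bar>symp_form v e\<bar> \<le> \<eta> * (\<bar>symp_form v e\<bar> + 1)"
    using \<eta> by (intro mult_left_mono) auto
  also have "\<dots> = symp_form v w / 2" by (simp add: \<eta>_def divide_simps) 
  finally have \<eta>': "\<eta> * \<bar>symp_form v e\<bar> < symp_form v w" using vw by simp
  have der: "((\<lambda>s. f (x + s *\<^sub>R d)) has_real_derivative ?f' d) (at 0)" for d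
  proof -
    have "((\<lambda>s. x + s *\<^sub>R d) has_derivative (\<lambda>s. s *\<^sub>R d)) (at 0)"
      by (auto intro!: derivative_eq_intros)
    then have "((\<lambda>s. f (x + s *\<^sub>R d)) has_derivative (\<lambda>s. ?f' (s *\<^sub>R d))) (at 0)"
      by (rule has_derivative_compose) (use facts(4) in simp)
    then show ?thesis
      by (simp add: has_field_derivative_def linear_scale[OF has_derivative_linear[OF facts(4)]] mult.commute[of _ "?f' d"])
  qed
  have lin: "?f' (w + c *\<^sub>R e) = c" for c
    using w e by (simp add: linear_add[OF has_derivative_linear[OF facts(4)]] linear_scale[OF has_derivative_linear[OF facts(4)]])
  obtain d1 where d1: "d1 > 0" "\<And>h. 0 < h \<Longrightarrow> h < d1 \<Longrightarrow> 0 < f (x + h *\<^sub>R (w + \<eta> *\<^sub>R e))"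
    using DERIV_pos_inc_right[OF der[of "w + \<eta> *\<^sub>R e"]] \<eta> lin[of \<eta>] facts(2) by auto
  obtain d2 where d2: "d2 > 0" "\<And>h. 0 < h \<Longrightarrow> h < d2 \<Longrightarrow> 0 > f (x + h *\<^sub>R (w + (-\<eta>) *\<^sub>R e))"
    using DERIV_neg_dec_right[OF der[of "w + (-\<eta>) *\<^sub>R e"]] \<eta> lin[of "-\<eta>"] facts(2) by auto
  obtain \<rho> where \<rho>: "\<rho> > 0" "ball x \<rho> \<subseteq> U" using facts(1) bd(3) openE by blast
  define K where "K = norm w + \<eta> * norm e + 1"
  have K: "K > 0" using \<eta> by (simp add: K_def add_nonneg_pos)
  define h where "h = min (min d1 d2) (\<rho> / K) / 2"
  have mm: "min (min d1 d2) (\<rho> / K) > 0" using d1 d2 \<rho> K by simp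
  have "h > 0" "2 * h \<le> d1" "2 * h \<le> d2" "2 * h \<le> \<rho> / K"
    using mm unfolding h_def by simp_all
  then have "h > 0" "h < d1" "h < d2" "h < \<rho> / K" by linarith+
  then have h: "h > 0" "h < d1" "h < d2" "h * K < \<rho>"
    using K by (auto simp: field_simps)
  let ?p = "\<lambda>c. x + h *\<^sub>R (w + c *\<^sub>R e)"
  have inU: "?p c \<in> U" if "c \<in> {-\<eta>..\<eta>}" for c
  proof -
    have "norm (w + c *\<^sub>R e) \<le> norm w + \<bar>c\<bar> * norm e"
      using norm_triangle_ineq[of w "c *\<^sub>R e"] by simp
    also have "\<dots> \<le> K" unfolding K_def using that
      by (intro order_trans[OF add_left_mono[OF mult_right_mono[of "\<bar>c\<bar>" \<eta>]]]) auto
    finally have "norm (h *\<^sub>R (w + c *\<^sub>R e)) \<le> h * K"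
      using h(1) by (simp add: mult_left_mono)
    then have "?p c \<in> ball x \<rho>" using h(4) by (simp add: dist_norm)
    then show ?thesis using \<rho>(2) by blast
  qed
  have "continuous_on {-\<eta>..\<eta>} (\<lambda>c. f (?p c))"
    using inU by (intro continuous_on_compose2[OF facts(3)] continuous_intros) auto
  then obtain c where c: "c \<in> {-\<eta>..\<eta>}" "f (?p c) = 0"
    using IVT'[of "\<lambda>c. f (?p c)" "-\<eta>" 0 \<eta>] d1(2)[OF h(1,2)] d2(2)[OF h(1,3)] \<eta> by force
  then have "?p c \<in> T" using facts(5) inU frontier_subset by blast
  then have "symp_form v (?p c) \<le> 1" using v(1) by (rule symp_polarD[rotated])
  then have "h * (symp_form v w + c * symp_form v e) \<le> 0"
    using v(2) by (simp add: symp_simps)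
  then have "symp_form v w + c * symp_form v e \<le> 0"
    using h(1) by (simp add: mult_le_0_iff)
  moreover have "\<bar>c * symp_form v e\<bar> \<le> \<eta> * \<bar>symp_form v e\<bar>"
    unfolding abs_mult using c(1) by (intro mult_right_mono) auto
  ultimately show False using \<eta>' by linarith
qed

lemma tangent_eq:
  assumes "boundary_defining T U f" "x \<in> frontier T" "x \<in> U"
    and v: "v \<in> D" "symp_form v x = 1"
    and w: "frechet_derivative f (at x) w = 0"
  shows "symp_form v w = 0"
proof -
  have lin: "linear (frechet_derivative f (at x))"
    using boundary_defining_facts(4)[OF assms(1-3)] by (rule has_derivative_linear)
  have "symp_form v (- w) \<le> 0"
    using w by (intro tangent_le[OF assms(1-5)]) (simp add: linear_neg[OF lin])
  with tangent_le[OF assms] show ?thesis by simp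
qed

text \<open>The kernels of the derivative and of \<open>\<omega>(v, \<cdot>)\<close> are hyperplanes, and the former is contained in the
latter.\<close>

lemma boundary_tangent_eq:
  assumes x: "x \<in> frontier T" and v: "v \<in> D" "symp_form v x = 1"
  shows "boundary_tangent T x = {w. symp_form v w = 0}"
proof (intro subset_antisym subsetI)
  fix w assume "w \<in> boundary_tangent T x"
  then obtain U f where "boundary_defining T U f" "x \<in> U" "frechet_derivative f (at x) w = 0"
    unfolding boundary_tangent_def by blast
  then show "w \<in> {w. symp_form v w = 0}"
    using tangent_eq[OF _ x _ v] by blast
next
  fix w assume w: "w \<in> {w. symp_form v w = 0}"
  obtain U f where bd: "boundary_defining T U f" "x \<in> U"
    using smooth_T x by (auto simp: smooth_boundary_def)
  note facts = boundary_defining_facts[OF bd(1) x bd(2)]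
  let ?f' = "frechet_derivative f (at x)"
  note lin = has_derivative_linear[OF facts(4)]
  obtain e where e: "?f' e = 1" using facts(6) by blast
  have *: "symp_form v y = ?f' y * symp_form v e" for y
  proof -
    have "?f' (y - ?f' y *\<^sub>R e) = 0" using e by (simp add: linear_diff[OF lin] linear_scale[OF lin])
    from tangent_eq[OF bd(1) x bd(2) v this] show ?thesis by (simp add: symp_simps)
  qed
  have "symp_form v e \<noteq> 0" using *[of x] v(2) by auto
  then have "?f' w = 0" using w *[of w] by simp
  then show "w \<in> boundary_tangent T x" using bd by (auto simp: boundary_tangent_def)
qed

text \<open>A functional is determined by its kernel, here the tangent hyperplane, and by its value at \<open>x\<close>.\<close>

lemma support_unique:
  assumes x: "x \<in> frontier T" and v: "v \<in> D" "symp_form v x = 1" and u: "u \<in> D" "symp_form u x = 1"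
  shows "u = v"
proof (rule symp_form_nondegenerate)
  fix y
  have "{w. symp_form v w = 0} = {w. symp_form u w = 0}"
    using boundary_tangent_eq[OF x v] boundary_tangent_eq[OF x u] by simp
  moreover have "y - symp_form v y *\<^sub>R x \<in> {w. symp_form v w = 0}"
    using v by (simp add: symp_simps)
  ultimately show "symp_form u y = symp_form v y"
    using u by (auto simp: symp_simps)
qed

text \<open>The characteristic direction is spanned by the supporting functional, seen as a vector through \<open>\<omega>\<close>.\<close>

lemma characteristic_line_eq:
  assumes x: "x \<in> frontier T" and v: "v \<in> D" "symp_form v x = 1"
  shows "u \<in> characteristic_line T x \<longleftrightarrow> u = symp_form u x *\<^sub>R v"
proof
  assume u: "u \<in> characteristic_line T x"
  show "u = symp_form u x *\<^sub>R v"
  proof (rule symp_form_nondegenerate)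
    fix y
    have "y - symp_form v y *\<^sub>R x \<in> boundary_tangent T x"
      using v by (simp add: boundary_tangent_eq[OF x v] symp_simps)
    then have "symp_form u (y - symp_form v y *\<^sub>R x) = 0"
      using u by (simp add: characteristic_line_def)
    then show "symp_form u y = symp_form (symp_form u x *\<^sub>R v) y"
      by (simp add: symp_simps mult.commute)
  qed
next
  assume "u = symp_form u x *\<^sub>R v"
  then obtain c where "u = c *\<^sub>R v" by blast
  then show "u \<in> characteristic_line T x"
    by (simp add: characteristic_line_def boundary_tangent_eq[OF x v] symp_simps)
qed

end

section \<open>A lower bound for the action of closed characteristics\<close>

lemma has_integral_symp_form_left:
  assumes "(f has_integral i) S"
  shows "((\<lambda>t. symp_form (f t) z) has_integral symp_form i z) S"
  using has_integral_linear[OF assms symp.bounded_linear_left] by (simp add: o_def)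

context pointed_body
begin

text \<open>The integral is the length \<open>l\<close> of \<open>\<beta>\<close>, and also twice its area, so the ratio for \<open>\<beta>\<close> is
\<open>l / l\<^sup>2\<close>. It is approached by inscribed polygons with \<open>N\<close> vertices at equal distances along \<open>\<beta>\<close>:
their edges have norm at most \<open>l / N\<close>, and their area differs from that of \<open>\<beta>\<close> by \<open>O(1 / N)\<close>.\<close>

lemma iso_const_path_bound:
  fixes \<beta> \<beta>' :: "real \<Rightarrow> 'n phase"
  assumes cont: "continuous_on {0..1} \<beta>'"
    and der: "\<And>t. t \<in> {0..1} \<Longrightarrow> (\<beta> has_vector_derivative \<beta>' t) (at t within {0..1})"
    and closed: "\<beta> 0 = \<beta> 1"
    and max: "\<And>t z. t \<in> {0..1} \<Longrightarrow> z \<in> T \<Longrightarrow> symp_form (\<beta>' t) z \<le> symp_form (\<beta>' t) (\<beta> t)"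
    and pos: "\<And>t. t \<in> {0..1} \<Longrightarrow> symp_form (\<beta>' t) (\<beta> t) > 0"
  shows "1 \<le> iso_const T * integral {0..1} (\<lambda>t. symp_form (\<beta>' t) (\<beta> t))"
proof -
  define h where "h = (\<lambda>t. symp_form (\<beta>' t) (\<beta> t))"
  define l where "l = integral {0..1} h"
  have cont_\<beta>: "continuous_on {0..1} \<beta>"
    unfolding continuous_on_eq_continuous_within
    by (intro ballI has_vector_derivative_continuous[OF der])
  have cont_h: "continuous_on {0..1} h"
    unfolding h_def by (intro symp.continuous_on cont cont_\<beta>)
  have "\<exists>t0\<in>{0..1}. \<forall>t\<in>{0..1}. h t0 \<le> h t"
    by (intro continuous_attains_inf cont_h) auto
  then obtain m where m: "m > 0" "\<And>t. t \<in> {0..1} \<Longrightarrow> m \<le> h t"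
    using pos unfolding h_def by blast
  have "bounded (\<beta>' ` {0..1})"
    by (intro compact_imp_bounded compact_continuous_image cont) auto
  then obtain B where B: "B > 0" "\<And>t. t \<in> {0..1} \<Longrightarrow> norm (\<beta>' t) \<le> B"
    unfolding bounded_pos by auto
  have h_int: "h integrable_on {a..b}" if "0 \<le> a" "b \<le> 1" for a b
    using that by (intro integrable_continuous_interval continuous_on_subset[OF cont_h]) auto
  \<comment> \<open>The length of \<open>\<beta>\<close> up to time \<open>t\<close>; it is bi-Lipschitz because \<open>h \<ge> m > 0\<close>.\<close>
  define s where "s = (\<lambda>t. integral {0..t} h)"
  have s_diff: "s b - s a = integral {a..b} h" if "0 \<le> a" "a \<le> b" "b \<le> 1" for a b
    unfolding s_def using Henstock_Kurzweil_Integration.integral_combine[OF that(1,2) h_int[of 0 b]] that by simp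
  have s_lower: "m * (b - a) \<le> s b - s a" if "0 \<le> a" "a \<le> b" "b \<le> 1" for a b
  proof -
    have "integral {a..b} (\<lambda>_. m) \<le> integral {a..b} h"
      using that by (intro integral_le h_int) (auto intro: m)
    then show ?thesis using that by (simp add: s_diff mult.commute)
  qed
  have s01: "s 0 = 0" "s 1 = l" by (simp_all add: s_def l_def)
  have l: "l > 0" using s_lower[of 0 1] m(1) s01 by simp
  have cont_s: "continuous_on {0..1} s"
    unfolding s_def by (intro indefinite_integral_continuous_1 h_int) auto
  have int_\<beta>: "(\<beta>' has_integral \<beta> b - \<beta> a) {a..b}" if "0 \<le> a" "a \<le> b" "b \<le> 1" for a b
    using that by (intro fundamental_theorem_of_calculus has_vector_derivative_within_subset[OF der]) auto
  have lip: "norm (\<beta> b - \<beta> a) \<le> B * (b - a)" if "0 \<le> a" "a \<le> b" "b \<le> 1" for a b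
    using has_integral_bound_real[OF _ _ int_\<beta>[OF that], of B "{}"] B that by (simp add: less_imp_le)
  have key: "iso_const T * l\<^sup>2 \<ge> l - B\<^sup>2 * (l / m)\<^sup>2 / real N" if N: "N > 0" for N :: nat
  proof -
    have "\<exists>t\<in>{0..1}. s t = real i * l / real N" if "i \<le> N" for i
    proof -
      have "real i * l \<le> l * real N"
        using that l by (simp add: mult.commute mult_left_mono)
      then have "real i * l / real N \<le> l" using N by (simp add: divide_le_eq)
      then show ?thesis
        using IVT'[of s 0 "real i * l / real N" 1] cont_s s01 l by force
    qed
    then obtain \<tau> where \<tau>: "\<And>i. i \<le> N \<Longrightarrow> \<tau> i \<in> {0..1}" "\<And>i. i \<le> N \<Longrightarrow> s (\<tau> i) = real i * l / real N"
      by metis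
    have step: "s (\<tau> (Suc i)) - s (\<tau> i) = l / real N" if "i < N" for i
      using \<tau>(2)[of i] \<tau>(2)[of "Suc i"] that by (simp add: field_simps)
    have mono: "\<tau> i \<le> \<tau> (Suc i)" if "i < N" for i
    proof (rule ccontr)
      assume "\<not> ?thesis"
      then have "0 \<le> m * (\<tau> i - \<tau> (Suc i))" "m * (\<tau> i - \<tau> (Suc i)) \<le> s (\<tau> i) - s (\<tau> (Suc i))"
        using \<tau>(1)[of i] \<tau>(1)[of "Suc i"] that m(1) by (simp, intro s_lower) auto
      moreover have "l / real N > 0" using l N by simp
      ultimately show False using step[OF that] by linarith
    qed
    have ends: "\<tau> 0 = 0" "\<tau> N = 1"
    proof -
      have "m * (\<tau> 0 - 0) \<le> 0" using s_lower[of 0 "\<tau> 0"] \<tau>[of 0] s01 by simp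
      then show "\<tau> 0 = 0" using m(1) \<tau>(1)[of 0] by (simp add: mult_le_0_iff)
      have "m * (1 - \<tau> N) \<le> 0" using s_lower[of "\<tau> N" 1] \<tau>[of N] s01 N by simp
      then show "\<tau> N = 1" using m(1) \<tau>(1)[of N] by (simp add: mult_le_0_iff)
    qed
    define w where "w = (\<lambda>i. \<beta> (\<tau> (Suc i)) - \<beta> (\<tau> i))"
    have sum_w: "(\<Sum>j<i. w j) = \<beta> (\<tau> i) - \<beta> 0" for i
      by (induction i) (simp_all add: w_def ends)
    have ti: "0 \<le> \<tau> i" "\<tau> i \<le> \<tau> (Suc i)" "\<tau> (Suc i) \<le> 1" if "i < N" for i
      using that mono[of i] \<tau>(1)[of i] \<tau>(1)[of "Suc i"] by auto
    have int_h: "(h has_integral l / real N) {\<tau> i..\<tau> (Suc i)}" if "i < N" for i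
      using integrable_integral[OF h_int] s_diff[OF ti] step that ti[OF that] by metis
    have w_le: "symp_form (w i) z \<le> l / real N" if "i < N" "z \<in> T" for i z
    proof (rule has_integral_le)
      show "((\<lambda>t. symp_form (\<beta>' t) z) has_integral symp_form (w i) z) {\<tau> i..\<tau> (Suc i)}"
        unfolding w_def by (intro has_integral_symp_form_left int_\<beta> ti that)
      show "(h has_integral l / real N) {\<tau> i..\<tau> (Suc i)}" by (rule int_h[OF that(1)])
      show "symp_form (\<beta>' t) z \<le> h t" if "t \<in> {\<tau> i..\<tau> (Suc i)}" for t
        using ti[OF \<open>i < N\<close>] that \<open>z \<in> T\<close> unfolding h_def by (intro max) auto
    qed
    have w_ge: "symp_form (w i) (\<beta> (\<tau> i)) \<ge> l / real N - B\<^sup>2 * (l / m)\<^sup>2 / (real N)\<^sup>2" if i: "i < N" for i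
    proof -
      let ?a = "\<tau> i" and ?b = "\<tau> (Suc i)"
      have "l / real N - B\<^sup>2 * (?b - ?a) * (?b - ?a) \<le> symp_form (w i) (\<beta> (\<tau> i))"
      proof (rule has_integral_le)
        show "((\<lambda>t. symp_form (\<beta>' t) (\<beta> ?a)) has_integral symp_form (w i) (\<beta> ?a)) {?a..?b}"
          unfolding w_def by (intro has_integral_symp_form_left int_\<beta> ti i)
        show "((\<lambda>t. h t - B\<^sup>2 * (?b - ?a)) has_integral l / real N - B\<^sup>2 * (?b - ?a) * (?b - ?a)) {?a..?b}"
          using has_integral_diff[OF int_h[OF i] has_integral_const_real[of "B\<^sup>2 * (?b - ?a)" ?a ?b]] ti[OF i]
          by (simp add: mult.commute)
        fix t assume t: "t \<in> {?a..?b}"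
        have "symp_form (\<beta>' t) (\<beta> t - \<beta> ?a) \<le> B * (B * (?b - ?a))"
        proof (rule order_trans[OF symp_form_le mult_mono])
          show "norm (\<beta>' t) \<le> B" using t ti[OF i] by (intro B) auto
          have "norm (\<beta> t - \<beta> ?a) \<le> B * (t - ?a)" using t ti[OF i] by (intro lip) auto
          also have "\<dots> \<le> B * (?b - ?a)" using t B(1) by (intro mult_left_mono) auto
          finally show "norm (\<beta> t - \<beta> ?a) \<le> B * (?b - ?a)" .
        qed (use B in auto)
        then show "h t - B\<^sup>2 * (?b - ?a) \<le> symp_form (\<beta>' t) (\<beta> ?a)"
          by (simp add: h_def symp_simps power2_eq_square)
      qed
      moreover have "B\<^sup>2 * (?b - ?a) * (?b - ?a) \<le> B\<^sup>2 * (l / m)\<^sup>2 / (real N)\<^sup>2"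
      proof -
        have "m * (?b - ?a) \<le> l / real N" using s_lower[OF ti[OF i]] step[OF i] by simp
        then have "?b - ?a \<le> l / real N / m" unfolding pos_le_divide_eq[OF m(1)] by (simp only: mult.commute)
        then have "?b - ?a \<le> l / m / real N" by (simp add: mult.commute)
        then have "(?b - ?a)\<^sup>2 \<le> (l / m / real N)\<^sup>2" using ti[OF i] by (intro power_mono) auto
        then have "B\<^sup>2 * (?b - ?a)\<^sup>2 \<le> B\<^sup>2 * (l / m / real N)\<^sup>2" by (intro mult_left_mono) auto
        then show ?thesis by (simp add: power_divide power2_eq_square mult_ac)
      qed
      ultimately show ?thesis by linarith
    qed
    have "area2 w N = (\<Sum>i<N. symp_form (w i) (\<beta> (\<tau> i))) - symp_form (\<Sum>i<N. w i) (\<beta> 0)"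
      unfolding area2_def symp.sum_left by (simp add: sum_w symp.diff_right sum_subtractf)
    also have "(\<Sum>i<N. w i) = 0" using sum_w[of N] ends closed by simp
    finally have "area2 w N = (\<Sum>i<N. symp_form (w i) (\<beta> (\<tau> i)))" by simp
    also have "\<dots> \<ge> (\<Sum>i<N. l / real N - B\<^sup>2 * (l / m)\<^sup>2 / (real N)\<^sup>2)"
      by (intro sum_mono w_ge) auto
    finally have area: "area2 w N \<ge> l - B\<^sup>2 * (l / m)\<^sup>2 / real N"
      using N by (simp add: right_diff_distrib power2_eq_square)
    have "area2 (\<lambda>i. (real N / l) *\<^sub>R w i) N / (real N)\<^sup>2 \<le> iso_const T"
    proof (rule iso_const_ge[OF bounded_D N])
      show "(real N / l) *\<^sub>R w i \<in> D" if "i < N" for i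
        unfolding symp_polar_def
      proof (rule CollectI, rule ballI)
        fix z assume "z \<in> T"
        have "real N / l * symp_form (w i) z \<le> real N / l * (l / real N)"
          using l by (intro mult_left_mono w_le that \<open>z \<in> T\<close>) auto
        then show "symp_form ((real N / l) *\<^sub>R w i) z \<le> 1"
          using l N by (simp add: symp_simps)
      qed
      show "(\<Sum>i<N. (real N / l) *\<^sub>R w i) = 0"
        using \<open>(\<Sum>i<N. w i) = 0\<close> by (simp flip: scaleR_sum_right)
    qed
    then have "area2 w N \<le> iso_const T * l\<^sup>2"
      using l N by (simp add: area2_scaleR power_divide field_simps)
    with area show ?thesis by linarith
  qed
  have "(\<lambda>N. l - B\<^sup>2 * (l / m)\<^sup>2 / real N) \<longlonglongrightarrow> l - 0"
    by (intro tendsto_intros lim_const_over_n)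
  then have "l - 0 \<le> iso_const T * l\<^sup>2"
    by (rule LIMSEQ_le_const2) (use key in \<open>auto intro!: exI[of _ 1]\<close>)
  then show ?thesis
    using l unfolding l_def[symmetric] h_def[symmetric] by (simp add: power2_eq_square)
qed

end

lemma action_eq:
  assumes "\<And>t. t \<in> {0..1} \<Longrightarrow> (\<gamma> has_vector_derivative \<gamma>' t) (at t within {0..1})"
  shows "action \<gamma> = \<bar>integral {0..1} (\<lambda>t. symp_form (\<gamma>' t) (\<gamma> t))\<bar> / 2"
proof -
  have "integral {0..1} (\<lambda>t. symp_form (\<gamma> t) (vector_derivative \<gamma> (at t within {0..1})) / 2)
      = integral {0..1} (\<lambda>t. - (symp_form (\<gamma>' t) (\<gamma> t) / 2))"
  proof (rule integral_cong)
    fix t :: real assume t: "t \<in> {0..1}"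
    have "vector_derivative \<gamma> (at t within {0..1}) = \<gamma>' t"
      using vector_derivative_within_cbox[of 0 1 t \<gamma> "\<gamma>' t"] assms[OF t] t by simp
    then show "symp_form (\<gamma> t) (vector_derivative \<gamma> (at t within {0..1})) / 2 = - (symp_form (\<gamma>' t) (\<gamma> t) / 2)"
      using symp_form_commute[of "\<gamma> t" "\<gamma>' t"] by simp
  qed
  then show ?thesis by (simp add: action_def)
qed

context smooth_body
begin

text \<open>Along a closed characteristic \<open>\<omega>(\<gamma>', \<gamma>)\<close> never vanishes, so it has a constant sign. If the sign is
negative, the curve is traversed backwards.\<close>

lemma closed_characteristic_action_ge:
  assumes "closed_characteristic T \<gamma>"
  shows "1 / (2 * iso_const T) \<le> action \<gamma>"
proof -
  obtain \<gamma>' where \<gamma>: "\<gamma> 0 = \<gamma> 1" "\<gamma> ` {0..1} \<subseteq> frontier T" and cont: "continuous_on {0..1} \<gamma>'"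
    and der: "\<And>t. t \<in> {0..1} \<Longrightarrow> (\<gamma> has_vector_derivative \<gamma>' t) (at t within {0..1})"
    and nz: "\<And>t. t \<in> {0..1} \<Longrightarrow> \<gamma>' t \<noteq> 0"
    and char: "\<And>t. t \<in> {0..1} \<Longrightarrow> \<gamma>' t \<in> characteristic_line T (\<gamma> t)"
    using assms unfolding closed_characteristic_def by blast
  define h where "h = (\<lambda>t. symp_form (\<gamma>' t) (\<gamma> t))"
  have fr: "\<gamma> t \<in> frontier T" if "t \<in> {0..1}" for t using \<gamma>(2) that by blast
  have repr: "\<exists>v\<in>D. symp_form v (\<gamma> t) = 1 \<and> \<gamma>' t = h t *\<^sub>R v" if t: "t \<in> {0..1}" for t
    using frontier_supportE[OF fr[OF t]] characteristic_line_eq[OF fr[OF t]] char[OF t]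
    unfolding h_def by metis
  have h_nz: "h t \<noteq> 0" if "t \<in> {0..1}" for t
    using repr[OF that] nz[OF that] scaleR_zero_left by metis
  have cont_\<gamma>: "continuous_on {0..1} \<gamma>"
    unfolding continuous_on_eq_continuous_within
    by (intro ballI has_vector_derivative_continuous[OF der])
  have cont_h: "continuous_on {0..1} h"
    unfolding h_def by (intro symp.continuous_on cont cont_\<gamma>)
  have bound: "symp_form (c *\<^sub>R \<gamma>' t) z \<le> symp_form (c *\<^sub>R \<gamma>' t) (\<gamma> t)"
    if t: "t \<in> {0..1}" and z: "z \<in> T" and c: "c * h t \<ge> 0" for c t z
  proof -
    obtain v where v: "v \<in> D" "symp_form v (\<gamma> t) = 1" "\<gamma>' t = h t *\<^sub>R v"
      using repr[OF t] by blast
    have "c * h t * symp_form v z \<le> c * h t * 1"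
      using c by (intro mult_left_mono symp_polarD[OF v(1) z]) auto
    then show ?thesis by (simp add: v(2,3) symp_simps)
  qed
  have "connected (h ` {0..1})" by (intro connected_continuous_image cont_h) auto
  then have sign: "(\<forall>t\<in>{0..1}. h t > 0) \<or> (\<forall>t\<in>{0..1}. h t < 0)"
    using h_nz unfolding connected_iff_interval
    by (smt (verit) image_iff)
  have "1 \<le> iso_const T * \<bar>integral {0..1} h\<bar>"
    using sign
  proof
    assume h: "\<forall>t\<in>{0..1}. h t > 0"
    have "1 \<le> iso_const T * integral {0..1} h"
      unfolding h_def
      by (rule iso_const_path_bound[OF cont der \<gamma>(1)])
         (use bound[where c=1] h in \<open>auto simp: h_def less_imp_le\<close>)
    also have "\<dots> \<le> iso_const T * \<bar>integral {0..1} h\<bar>"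
      using iso_pos by (intro mult_left_mono) auto
    finally show ?thesis .
  next
    assume h: "\<forall>t\<in>{0..1}. h t < 0"
    let ?\<beta> = "\<lambda>t. \<gamma> (1 - t)" and ?\<beta>' = "\<lambda>t. - \<gamma>' (1 - t)"
    have "1 \<le> iso_const T * integral {0..1} (\<lambda>t. symp_form (?\<beta>' t) (?\<beta> t))"
    proof (rule iso_const_path_bound)
      show "continuous_on {0..1} ?\<beta>'"
        by (intro continuous_intros continuous_on_compose2[OF cont]) auto
      fix t :: real assume t: "t \<in> {0..1}"
      then have t': "1 - t \<in> {0..1}" by auto
      have "((\<gamma> \<circ> (\<lambda>t. 1 - t)) has_vector_derivative (-1) *\<^sub>R \<gamma>' (1 - t)) (at t within {0..1})"
      proof (rule vector_diff_chain_within)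
        show "((\<lambda>t. 1 - t) has_vector_derivative -1) (at t within {0..1})"
          by (auto intro!: derivative_eq_intros)
        show "(\<gamma> has_vector_derivative \<gamma>' (1 - t)) (at (1 - t) within (\<lambda>t. 1 - t) ` {0..1})"
          using der[OF t'] by (rule has_vector_derivative_within_subset) auto
      qed
      then show "(?\<beta> has_vector_derivative ?\<beta>' t) (at t within {0..1})" by (simp add: o_def)
      show "symp_form (?\<beta>' t) (?\<beta> t) > 0" using h t' by (simp add: h_def)
      show "symp_form (?\<beta>' t) z \<le> symp_form (?\<beta>' t) (?\<beta> t)" if "z \<in> T" for z
        using bound[OF t' that, of "-1"] h t' by (simp add: less_imp_le)
    qed (use \<gamma>(1) in simp)
    also have "integral {0..1} (\<lambda>t. symp_form (?\<beta>' t) (?\<beta> t)) = - integral {0..1} (\<lambda>t. h (1 - t))"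
      by (simp add: h_def)
    also have "integral {0..1} (\<lambda>t. h (1 - t)) = integral {0..1} h"
    proof -
      have "(h has_integral integral {0..1} h) (cbox 0 1)"
        using cont_h by (simp add: integrable_integral integrable_continuous_interval)
      from has_integral_affinity[OF this, of "-1" 1] show ?thesis
        by (intro integral_unique) (simp add: image_affinity_atLeastAtMost_diff image_affinity_atLeastAtMost)
    qed
    also have "iso_const T * - integral {0..1} h \<le> iso_const T * \<bar>integral {0..1} h\<bar>"
      using iso_pos by (intro mult_left_mono) auto
    finally show ?thesis .
  qed
  moreover have "action \<gamma> = \<bar>integral {0..1} h\<bar> / 2"
    unfolding h_def by (rule action_eq) (rule der)
  then have "\<bar>integral {0..1} h\<bar> = 2 * action \<gamma>" by simp
  ultimately have "1 \<le> iso_const T * (2 * action \<gamma>)" by simp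
  then show ?thesis
    using iso_pos by (simp add: divide_le_eq mult.commute mult.left_commute)
qed

end

section \<open>Extremal polygons\<close>

lemma area2_perturb:
  "area2 (\<lambda>i. v i + \<epsilon> *\<^sub>R d i) N = area2 v N
    + \<epsilon> * (\<Sum>i<N. symp_form (v i) (\<Sum>j<i. d j) + symp_form (d i) (\<Sum>j<i. v j)) + \<epsilon>\<^sup>2 * area2 d N"
  unfolding area2_def
  by (simp add: symp_simps sum.distrib scaleR_sum_right[symmetric] sum_distrib_left distrib_left
      power2_eq_square mult.assoc add_ac)

text \<open>Summation by parts, the discrete form of \<open>\<integral> \<omega>(dx, y) + \<integral> \<omega>(x, dy) = \<omega>(x, y)\<close>.\<close>

lemma symp_form_sum_by_parts:
  "(\<Sum>i<N. symp_form (v i) (\<Sum>j<i. d j)) + (\<Sum>j<N. symp_form (\<Sum>i<Suc j. v i) (d j))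
    = symp_form (\<Sum>i<N. v i) (\<Sum>j<N. d j)"
  by (induction N) (simp_all add: symp_simps)

definition midpoint_at :: "(nat \<Rightarrow> 'n::finite phase) \<Rightarrow> nat \<Rightarrow> 'n phase" where
  "midpoint_at v i = (\<Sum>j<i. v j) + (1 / 2) *\<^sub>R v i"

text \<open>The gradient of the area at a closed polygon is given by the midpoints of its edges.\<close>

lemma area2_derivative:
  assumes "(\<Sum>i<N. v i) = 0"
  shows "(\<Sum>i<N. symp_form (v i) (\<Sum>j<i. d j) + symp_form (d i) (\<Sum>j<i. v j))
    = 2 * (\<Sum>i<N. symp_form (d i) (midpoint_at v i))"
proof -
  have "(\<Sum>i<N. symp_form (v i) (\<Sum>j<i. d j)) = (\<Sum>j<N. symp_form (d j) (\<Sum>i<Suc j. v i))"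
    using symp_form_sum_by_parts[of v d N] assms
    by (simp add: symp_form_commute[of "d _"] sum_negf eq_neg_iff_add_eq_0)
  then show ?thesis
    by (simp add: sum.distrib midpoint_at_def symp_simps sum_distrib_left algebra_simps)
qed

lemma area2_eq_midpoints:
  assumes "(\<Sum>i<N. v i) = 0"
  shows "area2 v N = (\<Sum>i<N. symp_form (v i) (midpoint_at v i - z))"
proof -
  have "(\<Sum>i<N. symp_form (v i) z) = 0"
    using assms by (simp flip: symp.sum_left)
  then show ?thesis
    by (simp add: area2_def midpoint_at_def symp_simps sum_subtractf)
qed

context pointed_body
begin

lemma area2_maximizer:
  obtains v where "\<And>i. v i \<in> D" "(\<Sum>i<N. v i) = 0"
    "\<And>w. (\<And>i. w i \<in> D) \<Longrightarrow> (\<Sum>i<N. w i) = 0 \<Longrightarrow> area2 w N \<le> area2 v N"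
proof -
  let ?K = "(\<Pi>\<^sub>E i\<in>(UNIV :: nat set). D) \<inter> {w. (\<Sum>i<N. w i) = 0}"
  have coord: "continuous_on X (\<lambda>w::nat \<Rightarrow> 'n phase. w i)" for X i
    by (rule continuous_on_subset[OF continuous_on_product_coordinates]) simp
  have "compactin (product_topology (\<lambda>i. euclidean) (UNIV :: nat set)) (\<Pi>\<^sub>E i\<in>(UNIV :: nat set). D)"
    unfolding compactin_PiE using compact_D by simp
  then have "compact (\<Pi>\<^sub>E i\<in>(UNIV :: nat set). D)"
    by (simp add: euclidean_product_topology)
  moreover have "closed {w :: nat \<Rightarrow> 'n phase. (\<Sum>i<N. w i) = 0}"
    by (intro closed_Collect_eq continuous_on_sum coord continuous_on_const)
  ultimately have "compact ?K" by (rule compact_Int_closed)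
  moreover have "(\<lambda>_. 0) \<in> ?K" by (simp add: PiE_UNIV_domain)
  moreover have "continuous_on ?K (\<lambda>w. area2 w N)"
    unfolding area2_def by (intro continuous_on_sum symp.continuous_on coord)
  ultimately obtain v where v: "v \<in> ?K" "\<forall>w\<in>?K. area2 w N \<le> area2 v N"
    using continuous_attains_sup[of ?K "\<lambda>w. area2 w N"] by blast
  show ?thesis
  proof (rule that)
    show "v i \<in> D" for i using v(1) by (simp add: PiE_UNIV_domain Pi_iff)
    show "(\<Sum>i<N. v i) = 0" using v(1) by simp
    show "area2 w N \<le> area2 v N" if "\<And>i. w i \<in> D" "(\<Sum>i<N. w i) = 0" for w
      using v(2) that by (simp add: PiE_UNIV_domain Pi_iff)
  qed
qed

text \<open>The domain is convex, so the first-order condition at a maximizer of the quadratic area is that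
it maximizes the linearized area.\<close>

lemma area2_maximizer_linear:
  assumes v: "\<And>i. v i \<in> D" "(\<Sum>i<N. v i) = 0"
    and max: "\<And>w. (\<And>i. w i \<in> D) \<Longrightarrow> (\<Sum>i<N. w i) = 0 \<Longrightarrow> area2 w N \<le> area2 v N"
    and w: "\<And>i. w i \<in> D" "(\<Sum>i<N. w i) = 0"
  shows "(\<Sum>i<N. symp_form (w i) (midpoint_at v i)) \<le> (\<Sum>i<N. symp_form (v i) (midpoint_at v i))"
proof -
  define d where "d = (\<lambda>i. w i - v i)"
  define b where "b = (\<Sum>i<N. symp_form (d i) (midpoint_at v i))"
  have ineq: "\<epsilon> * (2 * b + \<epsilon> * area2 d N) \<le> 0" if "0 < \<epsilon>" "\<epsilon> \<le> 1" for \<epsilon>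
  proof -
    have "area2 (\<lambda>i. v i + \<epsilon> *\<^sub>R d i) N \<le> area2 v N"
    proof (rule max)
      show "v i + \<epsilon> *\<^sub>R d i \<in> D" for i
        using convexD_alt[OF convex_symp_polar v(1) w(1), of \<epsilon> i i] that
        by (simp add: d_def algebra_simps)
      show "(\<Sum>i<N. v i + \<epsilon> *\<^sub>R d i) = 0"
        using v(2) w(2) by (simp add: d_def sum.distrib sum_subtractf flip: scaleR_sum_right)
    qed
    then show ?thesis
      unfolding area2_perturb area2_derivative[OF v(2)] b_def by (simp add: algebra_simps power2_eq_square)
  qed
  have "b \<le> 0"
  proof (rule ccontr)
    assume "\<not> b \<le> 0"
    then have b: "b > 0" by simp
    define \<epsilon> where "\<epsilon> = min 1 (b / (\<bar>area2 d N\<bar> + 1))"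
    have \<epsilon>: "0 < \<epsilon>" "\<epsilon> \<le> 1" using b by (simp_all add: \<epsilon>_def)
    have "\<epsilon> * \<bar>area2 d N\<bar> \<le> b / (\<bar>area2 d N\<bar> + 1) * (\<bar>area2 d N\<bar> + 1)"
      using \<epsilon> by (intro mult_mono) (auto simp: \<epsilon>_def)
    also have "\<dots> = b" by simp
    finally have "\<bar>\<epsilon> * area2 d N\<bar> \<le> b" using \<epsilon> by (simp add: abs_mult)
    then have "2 * b + \<epsilon> * area2 d N > 0" using b by linarith
    then show False using ineq[OF \<epsilon>] \<epsilon>(1) by (simp add: mult_le_0_iff)
  qed
  then show ?thesis by (simp add: b_def d_def symp_simps sum_subtractf)
qed

text \<open>The closedness of the competitors is removed at the price of a translation \<open>z\<close>. The compact convex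
set of pairs (sum of the edges, linearized area) does not meet the ray above the maximum over closed
polygons, and a separating hyperplane is not vertical because sums of edges fill a neighbourhood of
\<open>0\<close>; its slope is \<open>z\<close>. Without the constraint the maximization splits into one problem per edge.\<close>

lemma lagrange_multiplier:
  fixes v x :: "nat \<Rightarrow> 'n phase"
  assumes N: "N > 0" and v: "\<And>i. v i \<in> D" "(\<Sum>i<N. v i) = 0"
    and max: "\<And>w. (\<And>i. w i \<in> D) \<Longrightarrow> (\<Sum>i<N. w i) = 0 \<Longrightarrow>
      (\<Sum>i<N. symp_form (w i) (x i)) \<le> (\<Sum>i<N. symp_form (v i) (x i))"
  obtains z where "\<And>i w. i < N \<Longrightarrow> w \<in> D \<Longrightarrow> symp_form w (x i - z) \<le> symp_form (v i) (x i - z)"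
proof -
  define M where "M = (\<Sum>i<N. symp_form (v i) (x i))"
  define p where "p = (\<lambda>w. (\<Sum>i<N. w i, \<Sum>i<N. symp_form (w i) (x i)))"
  let ?W = "{w. \<forall>i. w i \<in> D}"
  let ?R = "{0 :: 'n phase} \<times> {M<..}"
  have "convex (p ` ?W)"
    unfolding convex_alt
  proof (intro ballI allI impI)
    fix q q' and u :: real assume q: "q \<in> p ` ?W" "q' \<in> p ` ?W" and "0 \<le> u \<and> u \<le> 1"
    then have u: "0 \<le> u" "u \<le> 1" by auto
    obtain w w' where qw: "q = p w" "q' = p w'" and w: "\<forall>i. w i \<in> D" "\<forall>i. w' i \<in> D"
      using q by blast
    let ?c = "\<lambda>i. (1 - u) *\<^sub>R w i + u *\<^sub>R w' i"
    have cW: "?c \<in> ?W"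
      using convexD_alt[OF convex_symp_polar w(1)[rule_format] w(2)[rule_format] u] by blast
    have "(1 - u) *\<^sub>R p w + u *\<^sub>R p w' = p ?c"
      by (simp add: p_def sum.distrib scaleR_sum_right symp_simps sum_distrib_left)
    then show "(1 - u) *\<^sub>R q + u *\<^sub>R q' \<in> p ` ?W" unfolding qw using cW by (rule image_eqI)
  qed
  moreover have "convex ?R" by (intro convex_Times) auto
  moreover have "p ` ?W \<inter> ?R = {}"
  proof (rule equals0I, elim IntE imageE)
    fix q w assume q: "q \<in> ?R" "q = p w" and w: "w \<in> ?W"
    from q have "(\<Sum>i<N. w i) = 0" "M < (\<Sum>i<N. symp_form (w i) (x i))"
      by (simp_all only: p_def mem_Times_iff fst_conv snd_conv singleton_iff greaterThan_iff)
    then show False using max[of w] w by (simp add: M_def)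
  qed
  moreover have "p ` ?W \<noteq> {}"
  proof -
    have "v \<in> ?W" using v(1) by simp
    from imageI[OF this, of p] show ?thesis by (rule ex_in_conv[THEN iffD1, OF exI])
  qed
  moreover have "?R \<noteq> {}"
  proof -
    have "(0, M + 1) \<in> ?R" by simp
    then show ?thesis by (rule ex_in_conv[THEN iffD1, OF exI])
  qed
  ultimately have "\<exists>a b. a \<noteq> 0 \<and> (\<forall>q\<in>p ` ?W. a \<bullet> q \<le> b) \<and> (\<forall>q\<in>?R. b \<le> a \<bullet> q)"
    by (intro separating_hyperplane_sets)
  then obtain a b where ab: "a \<noteq> 0" "\<forall>q\<in>p ` ?W. a \<bullet> q \<le> b" "\<forall>q\<in>?R. b \<le> a \<bullet> q"
    by (elim exE conjE)
  obtain a1 a2 where a: "a = (a1, a2)" by (cases a)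
  have up: "a1 \<bullet> (\<Sum>i<N. w i) + a2 * (\<Sum>i<N. symp_form (w i) (x i)) \<le> b" if "\<forall>i. w i \<in> D" for w
  proof -
    have "a \<bullet> p w \<le> b" using that by (intro ab(2)[rule_format] imageI) simp
    then show ?thesis by (simp add: a p_def)
  qed
  have lo: "b \<le> a2 * s" if "s > M" for s
  proof -
    have "b \<le> a \<bullet> (0, s)" using that by (intro ab(3)[rule_format]) simp
    then show ?thesis by (simp add: a)
  qed
  \<comment> \<open>The hyperplane bounds the upward ray from below, so its normal does not point downwards.\<close>
  have a2: "a2 \<ge> 0"
  proof (rule ccontr)
    assume "\<not> a2 \<ge> 0"
    then have a2: "a2 < 0" by simp
    let ?s = "max (M + 1) (b / a2 + 1)"
    have "a2 * ?s \<le> a2 * (b / a2 + 1)" using a2 by (intro mult_left_mono_neg) auto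
    also have "\<dots> < b" using a2 by (simp add: distrib_left)
    finally have "a2 * ?s < b" .
    moreover have "?s > M" by (rule less_le_trans[OF _ max.cobounded1]) simp
    ultimately show False using lo[of ?s] by linarith
  qed
  have bM: "b \<le> a2 * M"
  proof (rule field_le_epsilon)
    fix e :: real assume e: "0 < e"
    have "b \<le> a2 * (M + e / (a2 + 1))" using a2 e by (intro lo) simp
    also have "\<dots> \<le> a2 * M + e"
      using a2 e by (simp add: distrib_left divide_le_eq mult.commute mult_left_mono)
    finally show "b \<le> a2 * M + e" .
  qed
  \<comment> \<open>For a vertical hyperplane, equal edges in the direction of its normal would cross it.\<close>
  have "a2 \<noteq> 0"
  proof
    assume 0: "a2 = 0"
    have le: "a1 \<bullet> (\<Sum>i<N. w i) \<le> 0" if "\<forall>i. w i \<in> D" for w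
      using up[OF that] bM 0 by simp
    obtain R where R: "R > 0" "T \<subseteq> cball 0 R"
      using bounded_subset_cball_0E[OF compact_imp_bounded[OF compact_T]] .
    have a1: "a1 \<noteq> 0" using ab(1) a 0 by (simp add: zero_prod_def)
    let ?u = "(1 / (R * norm a1)) *\<^sub>R a1"
    have "?u \<in> D"
      using R(1) a1 by (intro subsetD[OF cball_subset_symp_polar[OF R(2,1)]]) simp
    then have "a1 \<bullet> (\<Sum>i<N. ?u) \<le> 0" by (intro le allI)
    moreover have "a1 \<bullet> (\<Sum>i<N. ?u) = real N * norm a1 / R"
      using a1 by (simp add: sum_constant_scaleR power2_norm_eq_inner[symmetric] power2_eq_square)
    moreover have "real N * norm a1 / R > 0" using N a1 R(1) by simp
    ultimately show False by simp
  qed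
  with a2 have a2: "a2 > 0" by simp
  define z where "z = (- 1 / a2) *\<^sub>R J a1"
  have z: "a2 * symp_form w (x i - z) = a2 * symp_form w (x i) + a1 \<bullet> w" for w i
    using a2 by (simp add: z_def symp_simps inner_eq_symp_form algebra_simps)
  have total: "(\<Sum>i<N. symp_form (w i) (x i - z)) \<le> (\<Sum>i<N. symp_form (v i) (x i - z))"
    if "\<forall>i. w i \<in> D" for w
  proof -
    have eq: "a2 * (\<Sum>i<N. symp_form (w i) (x i - z))
        = a1 \<bullet> (\<Sum>i<N. w i) + a2 * (\<Sum>i<N. symp_form (w i) (x i))" for w
      unfolding sum_distrib_left z by (simp add: sum.distrib inner_sum_right)
    have "a2 * (\<Sum>i<N. symp_form (w i) (x i - z)) \<le> a2 * (\<Sum>i<N. symp_form (v i) (x i - z))"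
      unfolding eq using up[OF that] bM v(2) by (simp add: M_def)
    then show ?thesis using a2 by simp
  qed
  show ?thesis
  proof (rule that)
    \<comment> \<open>Only the edge \<open>i\<close> is varied.\<close>
    fix i and w :: "'n phase" assume i: "i < N" and w: "w \<in> D"
    have "(\<Sum>j<N. symp_form ((v(i := w)) j) (x j - z)) \<le> (\<Sum>j<N. symp_form (v j) (x j - z))"
      using v(1) w by (intro total) simp
    moreover have "(\<Sum>j\<in>{..<N} - {i}. symp_form ((v(i := w)) j) (x j - z))
        = (\<Sum>j\<in>{..<N} - {i}. symp_form (v j) (x j - z))"
      by (intro sum.cong) auto
    ultimately show "symp_form w (x i - z) \<le> symp_form (v i) (x i - z)"
      using i by (simp add: sum.remove[of "{..<N}" i])
  qed
qed

text \<open>Discrete solutions of Hamilton's equation: each edge maximizes \<open>\<omega>(\<cdot>, \<zeta>)\<close> over the polar at its own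
translated midpoint \<open>\<zeta>\<close>.\<close>

definition extremal :: "(nat \<Rightarrow> 'n phase) \<Rightarrow> nat \<Rightarrow> 'n phase \<Rightarrow> bool" where
  "extremal v N z \<longleftrightarrow> N > 0 \<and> (\<forall>i. v i \<in> D) \<and> (\<Sum>i<N. v i) = 0 \<and>
     (\<forall>i<N. \<forall>w\<in>D. symp_form w (midpoint_at v i - z) \<le> symp_form (v i) (midpoint_at v i - z))"

lemma extremal_exists:
  assumes N: "N > 0"
  obtains v z where "extremal v N z"
    "\<And>w. (\<And>i. w i \<in> D) \<Longrightarrow> (\<Sum>i<N. w i) = 0 \<Longrightarrow> area2 w N \<le> area2 v N"
proof -
  obtain v where v: "\<And>i. v i \<in> D" "(\<Sum>i<N. v i) = 0"
    "\<And>w. (\<And>i. w i \<in> D) \<Longrightarrow> (\<Sum>i<N. w i) = 0 \<Longrightarrow> area2 w N \<le> area2 v N"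
    by (rule area2_maximizer[of N]) blast
  obtain z where "\<And>i w. i < N \<Longrightarrow> w \<in> D \<Longrightarrow>
      symp_form w (midpoint_at v i - z) \<le> symp_form (v i) (midpoint_at v i - z)"
    using lagrange_multiplier[OF N v(1,2) area2_maximizer_linear[OF v]] by blast
  then have "extremal v N z" using N v by (simp add: extremal_def)
  then show ?thesis using v(3) that by blast
qed

lemma refined_polygon:
  assumes "\<And>i. v i \<in> D" "(\<Sum>i<N. v i) = 0"
  shows "\<exists>w. (\<forall>i. w i \<in> D) \<and> (\<Sum>i<2 ^ k * N. w i) = 0 \<and>
    area2 w (2 ^ k * N) / (real (2 ^ k * N))\<^sup>2 = area2 v N / (real N)\<^sup>2"
proof (induction k)
  case 0
  then show ?case using assms by (intro exI[of _ v]) simp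
next
  case (Suc k)
  then obtain w where w: "\<forall>i. w i \<in> D" "(\<Sum>i<2 ^ k * N. w i) = 0"
    "area2 w (2 ^ k * N) / (real (2 ^ k * N))\<^sup>2 = area2 v N / (real N)\<^sup>2" by blast
  have eq: "2 ^ Suc k * N = 2 * (2 ^ k * N)" by simp
  have "area2 (\<lambda>i. w (i div 2)) (2 * (2 ^ k * N)) / (real (2 * (2 ^ k * N)))\<^sup>2 = area2 v N / (real N)\<^sup>2"
    unfolding double_edges w(3)[symmetric] by (simp add: power_mult_distrib)
  then show ?case
    unfolding eq using w(1,2) double_edges(1)[of w "2 ^ k * N"] 
    by (intro exI[of _ "\<lambda>i. w (i div 2)"]) simp
qed

text \<open>Doubling the edges keeps the ratio, so the isoperimetric constant is approached by polygons with arbitrarily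
many edges, and these may be replaced by maximizers with as many edges.\<close>

lemma near_optimal_extremal:
  assumes \<epsilon>: "\<epsilon> > 0"
  obtains v N z where "extremal v N z" "N \<ge> k" "\<bar>area2 v N / (real N)\<^sup>2 - iso_const T\<bar> \<le> \<epsilon>"
proof -
  obtain y where "y \<in> iso_ratios T" "iso_const T - \<epsilon> < y"
    using less_cSupD[OF iso_ratios_nonempty[of T], of "iso_const T - \<epsilon>"] \<epsilon> unfolding iso_const_def by auto
  then obtain v0 N where v0: "N > 0" "v0 ` {..<N} \<subseteq> D" "(\<Sum>i<N. v0 i) = 0"
    "iso_const T - \<epsilon> < area2 v0 N / (real N)\<^sup>2"
    unfolding iso_ratios_def by blast
  define v where "v = (\<lambda>i. if i < N then v0 i else 0)"
  have v: "v i \<in> D" for i using v0(2) by (auto simp: v_def)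
  have v': "(\<Sum>i<N. v i) = 0" "area2 v N = area2 v0 N"
    using v0(3) by (auto simp: v_def intro: area2_cong)
  obtain w where w: "\<And>i. w i \<in> D" "(\<Sum>i<2 ^ k * N. w i) = 0"
    "area2 w (2 ^ k * N) / (real (2 ^ k * N))\<^sup>2 = area2 v N / (real N)\<^sup>2"
    using refined_polygon[OF v v'(1)] by blast
  let ?N = "2 ^ k * N"
  have N: "?N > 0" using v0(1) by simp
  obtain u z where u: "extremal u ?N z"
    "\<And>w. (\<And>i. w i \<in> D) \<Longrightarrow> (\<Sum>i<?N. w i) = 0 \<Longrightarrow> area2 w ?N \<le> area2 u ?N"
    using extremal_exists[OF N] by blast
  have "iso_const T - \<epsilon> < area2 w ?N / (real ?N)\<^sup>2" using w(3) v0(4) v'(2) by simp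
  also have "\<dots> \<le> area2 u ?N / (real ?N)\<^sup>2" by (intro divide_right_mono u(2) w) simp
  finally have "iso_const T - \<epsilon> < area2 u ?N / (real ?N)\<^sup>2" .
  moreover have "area2 u ?N / (real ?N)\<^sup>2 \<le> iso_const T"
    using u(1) by (intro iso_const_ge[OF bounded_D N]) (simp_all add: extremal_def)
  moreover have "k \<le> ?N"
  proof -
    have "k < 2 ^ k" by (rule less_exp)
    also have "2 ^ k * 1 \<le> 2 ^ k * N" using v0(1) by (intro mult_left_mono) auto
    finally show ?thesis by simp
  qed
  ultimately show ?thesis using u(1) \<epsilon> by (intro that[of u ?N z]) auto
qed

end

definition clamp01 :: "nat \<Rightarrow> real \<Rightarrow> real" where
  "clamp01 i \<tau> = max 0 (min 1 (\<tau> - real i))"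

text \<open>The piecewise linear curve through the vertices, which passes the edge \<open>v i\<close> during the time from \<open>i\<close>
to \<open>i + 1\<close>. Writing it as a sum with clamped coefficients makes its increments
nonnegative combinations of edges.\<close>

definition polygon_path :: "(nat \<Rightarrow> 'a::real_vector) \<Rightarrow> nat \<Rightarrow> real \<Rightarrow> 'a" where
  "polygon_path v N \<tau> = (\<Sum>i<N. clamp01 i \<tau> *\<^sub>R v i)"

lemma sum_clamp01: "(\<Sum>i<N. clamp01 i \<tau>) = max 0 (min (real N) \<tau>)"
  by (induction N) (auto simp: clamp01_def)

lemma polygon_path_of_nat:
  assumes "i \<le> N" shows "polygon_path v N (real i) = (\<Sum>j<i. v j)"
proof -
  have "polygon_path v N (real i) = (\<Sum>j<N. if j < i then v j else 0)"
    unfolding polygon_path_def by (intro sum.cong) (auto simp: clamp01_def)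
  also have "\<dots> = (\<Sum>j | j < N \<and> j < i. v j)" by (simp add: sum.If_cases Int_def)
  also have "{j. j < N \<and> j < i} = {..<i}" using assms by auto
  finally show ?thesis .
qed

text \<open>Only the edges met between the times \<open>\<sigma>\<close> and \<open>\<tau>\<close> contribute, with nonnegative weights that add up to
\<open>\<tau> - \<sigma>\<close>. For \<open>V = 0\<close> this is a Lipschitz bound.\<close>

lemma polygon_path_deviation:
  fixes v :: "nat \<Rightarrow> 'a::real_normed_vector"
  assumes \<sigma>: "0 \<le> \<sigma>" "\<sigma> \<le> \<tau>" "\<tau> \<le> real N"
    and dev: "\<And>i. i < N \<Longrightarrow> real i < \<tau> \<Longrightarrow> \<sigma> < real i + 1 \<Longrightarrow> norm (v i - V) \<le> \<eta>"
  shows "norm (polygon_path v N \<tau> - polygon_path v N \<sigma> - (\<tau> - \<sigma>) *\<^sub>R V) \<le> \<eta> * (\<tau> - \<sigma>)"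
proof -
  let ?c = "\<lambda>i. clamp01 i \<tau> - clamp01 i \<sigma>"
  have c: "(\<Sum>i<N. ?c i) = \<tau> - \<sigma>" using \<sigma> by (simp add: sum_subtractf sum_clamp01)
  have "polygon_path v N \<tau> - polygon_path v N \<sigma> - (\<tau> - \<sigma>) *\<^sub>R V = (\<Sum>i<N. ?c i *\<^sub>R (v i - V))"
    unfolding polygon_path_def
    unfolding c[symmetric] scaleR_sum_left scaleR_diff_right by (simp add: scaleR_diff_left sum_subtractf)
  also have "norm \<dots> \<le> (\<Sum>i<N. ?c i * \<eta>)"
  proof (rule sum_norm_le)
    fix i assume i: "i \<in> {..<N}"
    show "norm (?c i *\<^sub>R (v i - V)) \<le> ?c i * \<eta>"
    proof (cases "real i < \<tau> \<and> \<sigma> < real i + 1")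
      case True
      have "?c i \<ge> 0" using \<sigma>(2) by (simp add: clamp01_def)
      then show ?thesis using dev[of i] i True by (simp add: mult_left_mono)
    next
      case False
      then have "?c i = 0" using \<sigma>(2) by (auto simp: clamp01_def)
      then show ?thesis by simp
    qed
  qed
  also have "\<dots> = \<eta> * (\<tau> - \<sigma>)" unfolding sum_distrib_right[symmetric] c by (rule mult.commute)
  finally show ?thesis .
qed

section \<open>The limit of extremal polygons\<close>

context pointed_body
begin

text \<open>The factor \<open>1 / N\<close> in time and space keeps the edges as velocities, so the paths are uniformly Lipschitz.\<close>

definition extremal_path :: "(nat \<Rightarrow> 'n phase) \<Rightarrow> nat \<Rightarrow> 'n phase \<Rightarrow> real \<Rightarrow> 'n phase" where
  "extremal_path v N z t = (1 / real N) *\<^sub>R (polygon_path v N (real N * t) - z)"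

definition extremal_point :: "(nat \<Rightarrow> 'n phase) \<Rightarrow> nat \<Rightarrow> 'n phase \<Rightarrow> nat \<Rightarrow> 'n phase" where
  "extremal_point v N z i = (1 / real N) *\<^sub>R (midpoint_at v i - z)"

lemma extremal_path_deviation:
  assumes N: "N > 0" and ab: "0 \<le> a" "a \<le> b" "b \<le> 1"
    and dev: "\<And>i. i < N \<Longrightarrow> real i / real N < b \<Longrightarrow> a < (real i + 1) / real N \<Longrightarrow> norm (v i - V) \<le> \<eta>"
  shows "norm (extremal_path v N z b - extremal_path v N z a - (b - a) *\<^sub>R V) \<le> \<eta> * (b - a)"
proof -
  let ?p = "polygon_path v N"
  have "norm (?p (real N * b) - ?p (real N * a) - (real N * b - real N * a) *\<^sub>R V) \<le> \<eta> * (real N * b - real N * a)"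
  proof (rule polygon_path_deviation)
    show "norm (v i - V) \<le> \<eta>" if "i < N" "real i < real N * b" "real N * a < real i + 1" for i
      using that N by (intro dev) (auto simp: divide_less_eq less_divide_eq mult.commute)
  qed (use ab N in \<open>auto simp: mult_left_mono mult_le_cancel_left1\<close>)
  then have "norm (?p (real N * b) - ?p (real N * a) - (real N * b - real N * a) *\<^sub>R V) / real N
      \<le> \<eta> * (real N * b - real N * a) / real N"
    by (rule divide_right_mono) simp
  moreover have "extremal_path v N z b - extremal_path v N z a - (b - a) *\<^sub>R V
     = (1 / real N) *\<^sub>R (?p (real N * b) - ?p (real N * a) - (real N * b - real N * a) *\<^sub>R V)"
    using N by (simp add: extremal_path_def algebra_simps)
  ultimately show ?thesis using N by (simp add: right_diff_distrib[symmetric])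
qed

context
  fixes v N z assumes ex: "extremal v N z"
begin

lemma extremal_N: "N > 0"
  and extremal_D: "v i \<in> D"
  and extremal_sum: "(\<Sum>i<N. v i) = 0"
  using ex by (simp_all add: extremal_def)

lemma extremal_norm: "norm (v i) \<le> 1 / r"
  by (rule norm_D[OF extremal_D])

lemma extremal_path_lipschitz:
  assumes "s \<in> {0..1}" "t \<in> {0..1}"
  shows "norm (extremal_path v N z t - extremal_path v N z s) \<le> \<bar>t - s\<bar> / r"
proof -
  have *: "norm (extremal_path v N z b - extremal_path v N z a) \<le> (b - a) / r"
    if "0 \<le> a" "a \<le> b" "b \<le> 1" for a b
    using extremal_path_deviation[OF extremal_N that, of v 0 "1 / r" z] extremal_norm by simp
  show ?thesis
    using *[of s t] *[of t s] assms by (cases "s \<le> t") (auto simp: norm_minus_commute)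
qed

lemma extremal_path_closed: "extremal_path v N z 0 = extremal_path v N z 1"
  using polygon_path_of_nat[of 0 N v] polygon_path_of_nat[of N N v]
  by (simp add: extremal_path_def extremal_sum)

lemma extremal_point_near:
  assumes "i < N"
  shows "norm (extremal_point v N z i - extremal_path v N z (real i / real N)) \<le> 1 / (r * real N)"
proof -
  have "polygon_path v N (real i) = (\<Sum>j<i. v j)"
    using assms by (intro polygon_path_of_nat) simp
  then have "extremal_point v N z i - extremal_path v N z (real i / real N) = (1 / (2 * real N)) *\<^sub>R v i"
    using extremal_N by (simp add: extremal_point_def extremal_path_def midpoint_at_def algebra_simps)
  then have "norm (extremal_point v N z i - extremal_path v N z (real i / real N)) = norm (v i) / (2 * real N)"
    by simp
  also have "\<dots> \<le> (1 / r) / (2 * real N)" by (intro divide_right_mono extremal_norm) simp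
  also have "\<dots> \<le> 1 / (r * real N)" using r_pos extremal_N by (simp add: field_simps)
  finally show ?thesis .
qed

lemma extremal_point_gauge:
  assumes "i < N"
  shows "gauge (extremal_point v N z i) = symp_form (v i) (extremal_point v N z i)"
proof (rule gauge_eqI[OF extremal_D])
  fix w assume "w \<in> D"
  then have "symp_form w (midpoint_at v i - z) \<le> symp_form (v i) (midpoint_at v i - z)"
    using ex assms by (simp add: extremal_def)
  then show "symp_form w (extremal_point v N z i) \<le> symp_form (v i) (extremal_point v N z i)"
    by (simp add: extremal_point_def symp.scaleR_right divide_right_mono)
qed

text \<open>The discrete action is the mean of the gauge over the midpoints, as each edge attains the gauge at its midpoint.\<close>

lemma extremal_area: "area2 v N / (real N)\<^sup>2 = (\<Sum>i<N. gauge (extremal_point v N z i)) / real N"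
proof -
  have "(\<Sum>i<N. gauge (extremal_point v N z i)) = (\<Sum>i<N. symp_form (v i) (midpoint_at v i - z) / real N)"
    by (intro sum.cong) (simp_all add: extremal_point_gauge, simp add: extremal_point_def symp.scaleR_right)
  also have "\<dots> = area2 v N / real N"
    by (simp add: area2_eq_midpoints[OF extremal_sum, of z] sum_divide_distrib)
  finally show ?thesis by (simp add: power2_eq_square)
qed

text \<open>The translation is under control because the mean of the gauge over the midpoints is at most the
isoperimetric constant: some midpoint is bounded, and the path stays within a bounded distance from it.\<close>

lemma extremal_path_bounded:
  assumes c: "c > 0" "\<And>y. c * norm y \<le> gauge y" and t: "t \<in> {0..1}"
  shows "norm (extremal_path v N z t) \<le> iso_const T / c + 2 / r"
proof -
  have "\<exists>i<N. gauge (extremal_point v N z i) \<le> iso_const T"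
  proof (rule ccontr)
    assume "\<not> ?thesis"
    then have "(\<Sum>i<N. gauge (extremal_point v N z i)) > (\<Sum>i<N. iso_const T)"
      using extremal_N by (intro sum_strict_mono) (auto simp: lessThan_empty_iff)
    then have "iso_const T < area2 v N / (real N)\<^sup>2"
      using extremal_N unfolding extremal_area by (simp add: field_simps)
    moreover have "area2 v N / (real N)\<^sup>2 \<le> iso_const T"
      by (intro iso_const_ge bounded_D extremal_N extremal_D extremal_sum)
    ultimately show False by simp
  qed
  then obtain i where i: "i < N" "gauge (extremal_point v N z i) \<le> iso_const T" by blast
  let ?t = "real i / real N"
  have t': "?t \<in> {0..1}" using i(1) by simp
  have 1: "norm (extremal_point v N z i) \<le> iso_const T / c"
    using c(2)[of "extremal_point v N z i"] i(2) c(1) by (simp add: pos_le_divide_eq mult.commute)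
  have "1 / (r * real N) \<le> 1 / r" using r_pos extremal_N by (simp add: field_simps)
  with extremal_point_near[OF i(1)]
  have 2: "norm (extremal_point v N z i - extremal_path v N z ?t) \<le> 1 / r" by linarith
  have "\<bar>t - ?t\<bar> \<le> 1" using t t' unfolding atLeastAtMost_iff by linarith
  then have "\<bar>t - ?t\<bar> / r \<le> 1 / r" using r_pos by (intro divide_right_mono) auto
  with extremal_path_lipschitz[OF t' t]
  have 3: "norm (extremal_path v N z t - extremal_path v N z ?t) \<le> 1 / r" by linarith
  have "norm (extremal_path v N z t) \<le> norm (extremal_path v N z ?t) + 1 / r"
    using 3 norm_triangle_sub[of "extremal_path v N z t" "extremal_path v N z ?t"] by linarith
  moreover have "norm (extremal_path v N z ?t) \<le> norm (extremal_point v N z i) + 1 / r"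
    using 2 norm_triangle_sub[of "extremal_path v N z ?t" "extremal_point v N z i"]
    by (simp add: norm_minus_commute)
  ultimately show ?thesis using 1 by simp
qed

end

end

context smooth_body
begin

lemma maximizer_unique:
  assumes y: "y \<noteq> 0" and "u \<in> D" "symp_form u y = gauge y" "v \<in> D" "symp_form v y = gauge y"
  shows "u = v"
proof -
  have gy: "gauge y > 0" using gauge_pos[OF y] .
  then have "gauge ((1 / gauge y) *\<^sub>R y) = 1" by (simp add: gauge_scaleR)
  then have "(1 / gauge y) *\<^sub>R y \<in> frontier T" by (simp add: frontier_iff)
  then show ?thesis
    by (rule support_unique) (use assms gy in \<open>simp_all add: symp.scaleR_right\<close>)
qed

text \<open>The velocity field of the Hamiltonian flow of the gauge, discontinuous at the origin only.\<close>

definition char_dir :: "'n phase \<Rightarrow> 'n phase" where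
  "char_dir y = (SOME w. w \<in> D \<and> symp_form w y = gauge y)"

lemma char_dir_in_D: "char_dir y \<in> D" and char_dir_gauge: "symp_form (char_dir y) y = gauge y"
proof -
  have "\<exists>w. w \<in> D \<and> symp_form w y = gauge y" using gauge_attained[of y] by blast
  then have "char_dir y \<in> D \<and> symp_form (char_dir y) y = gauge y" unfolding char_dir_def by (rule someI_ex)
  then show "char_dir y \<in> D" "symp_form (char_dir y) y = gauge y" by auto
qed

text \<open>On the compact set of \<open>w\<close> in the polar at distance at least \<open>\<eta>\<close> from the unique maximizer at \<open>x\<close>,
\<open>\<omega>(w, x)\<close> stays below the gauge by a positive amount, which a small change of \<open>x\<close> cannot make up.\<close>

lemma maximizer_near:
  assumes x: "x \<noteq> 0" and \<eta>: "\<eta> > 0"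
  obtains \<rho> where "\<rho> > 0"
    "\<And>y u. norm (y - x) < \<rho> \<Longrightarrow> u \<in> D \<Longrightarrow> symp_form u y = gauge y \<Longrightarrow> norm (u - char_dir x) \<le> \<eta>"
proof -
  let ?K = "D \<inter> {u. norm (u - char_dir x) \<ge> \<eta>}"
  show ?thesis
  proof (cases "?K = {}")
    case True
    have "norm (u - char_dir x) \<le> \<eta>" if "u \<in> D" for u
    proof (rule ccontr)
      assume "\<not> ?thesis"
      then have "u \<in> ?K" using that by simp
      then show False unfolding True by simp
    qed
    then show ?thesis by (intro that[of 1]) simp_all
  next
    case False
    have "closed {u. norm (u - char_dir x) \<ge> \<eta>}"
      by (intro closed_Collect_le continuous_intros)
    then have "compact ?K" by (rule compact_Int_closed[OF compact_D])
    moreover have "continuous_on ?K (\<lambda>u. symp_form u x)"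
      by (intro bounded_linear.continuous_on[OF symp.bounded_linear_left] continuous_on_id)
    ultimately obtain u0 where u0: "u0 \<in> ?K" "\<forall>u\<in>?K. symp_form u x \<le> symp_form u0 x"
      using continuous_attains_sup[OF _ False] by blast
    have "symp_form u0 x \<noteq> gauge x"
    proof
      assume "symp_form u0 x = gauge x"
      then have "u0 = char_dir x" using u0(1) by (intro maximizer_unique[OF x] char_dir_in_D char_dir_gauge) auto
      then show False using u0(1) \<eta> by simp
    qed
    moreover have "symp_form u0 x \<le> gauge x" using u0(1) by (intro gauge_upper) simp
    ultimately have less: "symp_form u0 x < gauge x" by simp
    define \<rho> where "\<rho> = r * (gauge x - symp_form u0 x) / 2"
    show ?thesis
    proof (rule that[of \<rho>])
      show "\<rho> > 0" using less r_pos by (simp add: \<rho>_def)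
      fix y u assume y: "norm (y - x) < \<rho>" and u: "u \<in> D" "symp_form u y = gauge y"
      show "norm (u - char_dir x) \<le> \<eta>"
      proof (rule ccontr)
        assume "\<not> ?thesis"
        then have 1: "symp_form u x \<le> symp_form u0 x" using u0(2) u(1) by simp
        have 2: "gauge y - symp_form u x \<le> norm (y - x) / r"
          using symp_form_le[of u "y - x"] mult_right_mono[OF norm_D[OF u(1)] norm_ge_zero[of "y - x"]] u(2)
          by (simp add: symp.diff_right)
        have 3: "gauge x - gauge y \<le> norm (y - x) / r"
          using gauge_lipschitz[of x y] by (simp add: norm_minus_commute)
        have 4: "2 * (norm (y - x) / r) < gauge x - symp_form u0 x"
          using y r_pos by (simp add: \<rho>_def field_simps)
        have "gauge x - symp_form u x \<le> 2 * (norm (y - x) / r)" using 2 3 by linarith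
        also note 4
        finally show False using 1 by linarith
      qed
    qed
  qed
qed

lemma char_dir_near:
  assumes "x \<noteq> 0" "\<eta> > 0"
  obtains \<rho> where "\<rho> > 0" "\<And>y. norm (y - x) < \<rho> \<Longrightarrow> norm (char_dir y - char_dir x) \<le> \<eta>"
proof -
  obtain \<rho> where \<rho>: "\<rho> > 0"
    "\<And>y u. norm (y - x) < \<rho> \<Longrightarrow> u \<in> D \<Longrightarrow> symp_form u y = gauge y \<Longrightarrow> norm (u - char_dir x) \<le> \<eta>"
    using maximizer_near[OF assms] by blast
  show ?thesis by (rule that[OF \<rho>(1)]) (rule \<rho>(2)[OF _ char_dir_in_D char_dir_gauge])
qed

lemma continuous_on_char_dir: "0 \<notin> X \<Longrightarrow> continuous_on X char_dir"
proof (rule continuous_onI)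
  fix x e assume "0 \<notin> X" "x \<in> X" and e: "(0::real) < e"
  then have "x \<noteq> 0" by blast
  then obtain \<rho> where "\<rho> > 0" "\<And>y. norm (y - x) < \<rho> \<Longrightarrow> norm (char_dir y - char_dir x) \<le> e"
    using char_dir_near e by blast
  then show "\<exists>d>0. \<forall>x'\<in>X. dist x' x < d \<longrightarrow> dist (char_dir x') (char_dir x) \<le> e"
    unfolding dist_norm by blast
qed

lemma char_dir_characteristic:
  assumes y: "gauge y = c" "c > 0" and k: "k > 0"
  shows "k *\<^sub>R char_dir y \<noteq> 0" "k *\<^sub>R char_dir y \<in> characteristic_line T ((1 / c) *\<^sub>R y)" "(1 / c) *\<^sub>R y \<in> frontier T"
proof -
  show fr: "(1 / c) *\<^sub>R y \<in> frontier T" using y by (simp add: frontier_iff gauge_scaleR)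
  have V1: "symp_form (char_dir y) ((1 / c) *\<^sub>R y) = 1" using y char_dir_gauge[of y] by (simp add: symp.scaleR_right)
  then show "k *\<^sub>R char_dir y \<noteq> 0" using k by auto
  show "k *\<^sub>R char_dir y \<in> characteristic_line T ((1 / c) *\<^sub>R y)"
    unfolding characteristic_line_eq[OF fr char_dir_in_D V1] using V1 by (simp add: symp.scaleR_left)
qed

lemma has_vector_derivative_within_normI:
  fixes f :: "real \<Rightarrow> 'a::real_normed_vector"
  assumes "\<And>e. e > 0 \<Longrightarrow> \<exists>d>0. \<forall>s\<in>X. \<bar>s - t\<bar> < d \<longrightarrow> norm (f s - f t - (s - t) *\<^sub>R f') \<le> e * \<bar>s - t\<bar>"
  shows "(f has_vector_derivative f') (at t within X)"
  unfolding has_vector_derivative_def has_derivative_within_alt real_norm_def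
  by (intro conjI bounded_linear_scaleR_left allI impI assms)

text \<open>The limit of a subsequence of near-optimal extremal polygons. Where the limit \<open>\<gamma>\<close> is not zero, the
edges near \<open>\<gamma> t\<close> are almost maximizers at \<open>\<gamma> t\<close>, hence close to the unique one, and so \<open>\<gamma>\<close> solves the
equation \<open>\<gamma>' = char_dir \<gamma>\<close> there. Along such a solution the gauge has derivative \<open>\<omega>(\<gamma>', \<gamma>') = 0\<close>. Zeros
of \<open>\<gamma>\<close> are not excluded in advance; but the square of the gauge has derivative \<open>0\<close> at zeros too, so it
is constant. Its value comes from the mean of the gauge over the midpoints, which tends to the
isoperimetric constant.\<close>

lemma extremal_limit:
  obtains \<gamma> where "\<gamma> 0 = \<gamma> 1"
    "\<And>t. t \<in> {0..1} \<Longrightarrow> gauge (\<gamma> t) = iso_const T"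
    "\<And>t. t \<in> {0..1} \<Longrightarrow> (\<gamma> has_vector_derivative char_dir (\<gamma> t)) (at t within {0..1})"
proof -
  have "\<exists>v N z. extremal v N z \<and> N \<ge> k \<and> \<bar>area2 v N / (real N)\<^sup>2 - iso_const T\<bar> \<le> 1 / real (Suc k)" for k
    using near_optimal_extremal[of "1 / real (Suc k)" k] by (metis of_nat_0_less_iff zero_less_Suc zero_less_divide_1_iff)
  then obtain v N z where ex0: "\<And>k. extremal (v k) (N k) (z k)" and N0: "\<And>k. N k \<ge> k"
    and area0: "\<And>k. \<bar>area2 (v k) (N k) / (real (N k))\<^sup>2 - iso_const T\<bar> \<le> 1 / real (Suc k)"
    by metis
  define \<Gamma>0 where "\<Gamma>0 = (\<lambda>k. extremal_path (v k) (N k) (z k))"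
  obtain c where c: "c > 0" "\<And>y. c * norm y \<le> gauge y" using gauge_pos_lower by blast
  obtain \<gamma> and \<kappa> :: "nat \<Rightarrow> nat" where cont: "continuous_on {0..1} \<gamma>" and \<kappa>: "strict_mono \<kappa>"
    and conv0: "\<And>e. 0 < e \<Longrightarrow> \<exists>K. \<forall>n x. n \<ge> K \<and> x \<in> {0..1} \<longrightarrow> norm (\<Gamma>0 (\<kappa> n) x - \<gamma> x) < e"
  proof (rule Arzela_Ascoli[of "{0..1::real}" \<Gamma>0 "iso_const T / c + 2 / r"])
    show "norm (\<Gamma>0 n x) \<le> iso_const T / c + 2 / r" if "x \<in> {0..1}" for n x
      unfolding \<Gamma>0_def by (rule extremal_path_bounded[OF ex0 c that])
    fix x e :: real assume x: "x \<in> {0..1}" and e: "0 < e"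
    have "norm (\<Gamma>0 n x - \<Gamma>0 n y) < e" if "y \<in> {0..1}" "norm (x - y) < e * r" for n y
    proof -
      have "\<bar>x - y\<bar> / r < e" using that(2) r_pos by (simp add: divide_less_eq)
      then show ?thesis
        using extremal_path_lipschitz[OF ex0[of n] that(1) x] by (simp add: \<Gamma>0_def)
    qed
    then show "\<exists>d. 0 < d \<and> (\<forall>n y. y \<in> {0..1} \<and> norm (x - y) < d \<longrightarrow> norm (\<Gamma>0 n x - \<Gamma>0 n y) < e)"
      using e r_pos by (intro exI[of _ "e * r"]) simp
  qed (auto)
  define u where "u = (\<lambda>k. v (\<kappa> k))"
  define M where "M = (\<lambda>k. N (\<kappa> k))"
  define y where "y = (\<lambda>k. z (\<kappa> k))"
  define \<Gamma> where "\<Gamma> = (\<lambda>k. extremal_path (u k) (M k) (y k))"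
  define \<zeta> where "\<zeta> = (\<lambda>k. extremal_point (u k) (M k) (y k))"
  have ex: "extremal (u k) (M k) (y k)" for k using ex0 by (simp add: u_def M_def y_def)
  have M: "M k \<ge> k" for k
    using N0[of "\<kappa> k"] strict_mono_imp_increasing[OF \<kappa>, of k] by (simp add: M_def)
  have M_pos: "M k > 0" for k using extremal_N[OF ex] .
  have area: "\<bar>area2 (u k) (M k) / (real (M k))\<^sup>2 - iso_const T\<bar> \<le> 1 / real (Suc k)" for k
  proof -
    have "1 / real (Suc (\<kappa> k)) \<le> 1 / real (Suc k)"
      using strict_mono_imp_increasing[OF \<kappa>, of k] by (simp add: frac_le)
    then show ?thesis using area0[of "\<kappa> k"] unfolding u_def M_def by linarith
  qed
  have M_inv: "\<forall>\<^sub>F k in sequentially. b / real (M k) < e" if "e > 0" "b \<ge> 0" for b e :: real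
  proof -
    have "(\<lambda>k. b / real k) \<longlonglongrightarrow> 0" by (rule lim_const_over_n)
    then have "\<forall>\<^sub>F k in sequentially. b / real k < e" using that(1) by (rule order_tendstoD)
    then show ?thesis using eventually_gt_at_top[of 0]
    proof eventually_elim
      case (elim k)
      have "b / real (M k) \<le> b / real k" using M[of k] that(2) elim(2) by (intro divide_left_mono) auto
      then show ?case using elim(1) by linarith
    qed
  qed
  have conv: "\<forall>\<^sub>F k in sequentially. \<forall>t\<in>{0..1}. norm (\<Gamma> k t - \<gamma> t) < e" if "e > 0" for e
    using conv0[OF that] unfolding eventually_sequentially \<Gamma>_def \<Gamma>0_def u_def M_def y_def by blast
  have lim: "(\<lambda>k. \<Gamma> k t) \<longlonglongrightarrow> \<gamma> t" if "t \<in> {0..1}" for t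
    unfolding tendsto_iff dist_norm
  proof (intro allI impI)
    fix e :: real assume "e > 0"
    then show "\<forall>\<^sub>F k in sequentially. norm (\<Gamma> k t - \<gamma> t) < e"
      by (rule eventually_mono[OF conv]) (use that in blast)
  qed
  have \<gamma>_closed: "\<gamma> 0 = \<gamma> 1"
    using LIMSEQ_unique[OF lim[of 0]] lim[of 1] extremal_path_closed[OF ex] by (simp add: \<Gamma>_def)
  have \<gamma>_lip: "norm (\<gamma> t - \<gamma> s) \<le> \<bar>t - s\<bar> / r" if "s \<in> {0..1}" "t \<in> {0..1}" for s t
  proof (rule LIMSEQ_le_const2)
    show "(\<lambda>k. norm (\<Gamma> k t - \<Gamma> k s)) \<longlonglongrightarrow> norm (\<gamma> t - \<gamma> s)"
      by (intro tendsto_intros lim that)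
    show "\<exists>K. \<forall>k\<ge>K. norm (\<Gamma> k t - \<Gamma> k s) \<le> \<bar>t - s\<bar> / r"
      using extremal_path_lipschitz[OF ex that] by (auto simp: \<Gamma>_def)
  qed
  have \<zeta>_near: "\<forall>\<^sub>F k in sequentially. \<forall>i<M k. norm (\<zeta> k i - \<gamma> (real i / real (M k))) < e" if e: "e > 0" for e
  proof -
    have "\<forall>\<^sub>F k in sequentially. (1 / r) / real (M k) < e / 2"
      using e r_pos by (intro M_inv) auto
    moreover have "\<forall>\<^sub>F k in sequentially. \<forall>t\<in>{0..1}. norm (\<Gamma> k t - \<gamma> t) < e / 2"
      using e by (intro conv) simp
    ultimately show ?thesis
    proof eventually_elim
      case (elim k)
      show ?case
      proof (intro allI impI)
        fix i assume i: "i < M k"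
        let ?t = "real i / real (M k)"
        have "?t \<in> {0..1}" using i by simp
        then have "norm (\<Gamma> k ?t - \<gamma> ?t) < e / 2" using elim(2) by blast
        moreover have "norm (\<zeta> k i - \<Gamma> k ?t) < e / 2"
          using extremal_point_near[OF ex i] elim(1) by (simp add: \<zeta>_def \<Gamma>_def)
        ultimately show "norm (\<zeta> k i - \<gamma> ?t) < e"
          using norm_diff_triangle_less[of "\<zeta> k i" "\<Gamma> k ?t" "e / 2" "\<gamma> ?t" "e / 2"] by simp
      qed
    qed
  qed
  have deriv: "(\<gamma> has_vector_derivative char_dir (\<gamma> t)) (at t within {0..1})"
    if t: "t \<in> {0..1}" and nz: "\<gamma> t \<noteq> 0" for t
  proof (rule has_vector_derivative_within_normI)
    fix \<eta> :: real assume \<eta>: "\<eta> > 0"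
    obtain \<rho> where \<rho>: "\<rho> > 0"
      "\<And>y u. norm (y - \<gamma> t) < \<rho> \<Longrightarrow> u \<in> D \<Longrightarrow> symp_form u y = gauge y \<Longrightarrow> norm (u - char_dir (\<gamma> t)) \<le> \<eta>"
      using maximizer_near[OF nz \<eta>] by blast
    \<comment> \<open>An edge that is met within time \<open>\<delta>\<close> from \<open>t\<close> starts within time \<open>2 \<delta>\<close> once \<open>1 / M k < \<delta>\<close>. With
      Lipschitz constant \<open>1 / r\<close> this leaves \<open>\<rho> / 2\<close> for the distance of midpoints to \<open>\<gamma>\<close>.\<close>
    define \<delta> where "\<delta> = r * \<rho> / 4"
    have \<delta>: "\<delta> > 0" using r_pos \<rho> by (simp add: \<delta>_def)
    have "norm (\<gamma> s - \<gamma> t - (s - t) *\<^sub>R char_dir (\<gamma> t)) \<le> \<eta> * \<bar>s - t\<bar>"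
      if s: "s \<in> {0..1}" "\<bar>s - t\<bar> < \<delta>" for s
    proof -
      define a b where "a = min s t" and "b = max s t"
      have ab: "0 \<le> a" "a \<le> b" "b \<le> 1" "t - \<delta> < a" "b < t + \<delta>" "a \<in> {0..1}" "b \<in> {0..1}"
        using s t \<delta> by (auto simp: a_def b_def)
      have ev: "\<forall>\<^sub>F k in sequentially. norm (\<Gamma> k b - \<Gamma> k a - (b - a) *\<^sub>R char_dir (\<gamma> t)) \<le> \<eta> * (b - a)"
        using M_inv[OF \<delta> zero_le_one] \<zeta>_near[of "\<rho> / 2", OF half_gt_zero[OF \<rho>(1)]]
      proof eventually_elim
        case (elim k)
        show ?case
          unfolding \<Gamma>_def
        proof (rule extremal_path_deviation[OF M_pos ab(1-3)])
          fix i assume i: "i < M k" "real i / real (M k) < b" "a < (real i + 1) / real (M k)"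
          let ?t = "real i / real (M k)"
          have t': "?t \<in> {0..1}" using i(1) by simp
          have "\<bar>?t - t\<bar> \<le> 2 * \<delta>" 
            using i(2,3) elim(1) ab(4,5) \<delta> by (auto simp: add_divide_distrib)
          then have "\<bar>?t - t\<bar> / r \<le> \<rho> / 2" using r_pos by (simp add: \<delta>_def divide_le_eq mult.commute)
          then have "norm (\<gamma> ?t - \<gamma> t) \<le> \<rho> / 2" using \<gamma>_lip[OF t t'] by linarith
          moreover have "norm (\<zeta> k i - \<gamma> ?t) < \<rho> / 2" using elim(2) i(1) by blast
          moreover have "norm (\<zeta> k i - \<gamma> t) \<le> norm (\<zeta> k i - \<gamma> ?t) + norm (\<gamma> ?t - \<gamma> t)"
            using norm_triangle_ineq[of "\<zeta> k i - \<gamma> ?t" "\<gamma> ?t - \<gamma> t"] by simp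
          ultimately have "norm (\<zeta> k i - \<gamma> t) < \<rho>" by linarith
          then show "norm (u k i - char_dir (\<gamma> t)) \<le> \<eta>"
            using extremal_D[OF ex] extremal_point_gauge[OF ex i(1), symmetric] by (intro \<rho>(2)) (simp_all add: \<zeta>_def)
        qed
      qed
      have "(\<lambda>k. norm (\<Gamma> k b - \<Gamma> k a - (b - a) *\<^sub>R char_dir (\<gamma> t))) \<longlonglongrightarrow> norm (\<gamma> b - \<gamma> a - (b - a) *\<^sub>R char_dir (\<gamma> t))"
        by (intro tendsto_intros lim ab)
      from tendsto_upperbound[OF this ev]
      have nb: "norm (\<gamma> b - \<gamma> a - (b - a) *\<^sub>R char_dir (\<gamma> t)) \<le> \<eta> * (b - a)" by simp
      show ?thesis
      proof (cases "s \<le> t")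
        case True
        have "norm (\<gamma> s - \<gamma> t - (s - t) *\<^sub>R char_dir (\<gamma> t)) = norm (\<gamma> t - \<gamma> s - (t - s) *\<^sub>R char_dir (\<gamma> t))"
          using norm_minus_cancel[of "\<gamma> s - \<gamma> t - (s - t) *\<^sub>R char_dir (\<gamma> t)"] by (simp add: algebra_simps)
        then show ?thesis using True nb by (simp add: a_def b_def)
      qed (use nb in \<open>simp add: a_def b_def\<close>)
    qed
    then show "\<exists>d>0. \<forall>s\<in>{0..1}. \<bar>s - t\<bar> < d \<longrightarrow> norm (\<gamma> s - \<gamma> t - (s - t) *\<^sub>R char_dir (\<gamma> t)) \<le> \<eta> * \<bar>s - t\<bar>"
      using \<delta> by blast
  qed
  define \<phi> where "\<phi> = (\<lambda>t. gauge (\<gamma> t))"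
  have \<phi>_deriv: "(\<phi> has_vector_derivative 0) (at t within {0..1})"
    if t: "t \<in> {0..1}" and nz: "\<gamma> t \<noteq> 0" for t
  proof (rule has_vector_derivative_within_normI)
    fix e :: real assume e: "e > 0"
    define \<eta> where "\<eta> = e * r / 2"
    have \<eta>: "\<eta> > 0" using e r_pos by (simp add: \<eta>_def)
    obtain \<rho> where \<rho>: "\<rho> > 0" "\<And>y. norm (y - \<gamma> t) < \<rho> \<Longrightarrow> norm (char_dir y - char_dir (\<gamma> t)) \<le> \<eta>"
      using char_dir_near[OF nz \<eta>] by blast
    have "\<exists>d>0. \<forall>s\<in>{0..1}. \<bar>s - t\<bar> < d \<longrightarrow> norm (\<gamma> s - \<gamma> t - (s - t) *\<^sub>R char_dir (\<gamma> t)) \<le> \<eta> * \<bar>s - t\<bar>"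
      using deriv[OF t nz] \<eta> unfolding has_vector_derivative_def has_derivative_within_alt real_norm_def by blast
    then obtain d where d: "d > 0"
      "\<And>s. s \<in> {0..1} \<Longrightarrow> \<bar>s - t\<bar> < d \<Longrightarrow> norm (\<gamma> s - \<gamma> t - (s - t) *\<^sub>R char_dir (\<gamma> t)) \<le> \<eta> * \<bar>s - t\<bar>"
      by blast
    have "\<bar>\<phi> s - \<phi> t\<bar> \<le> e * \<bar>s - t\<bar>" if s: "s \<in> {0..1}" "\<bar>s - t\<bar> < min d (r * \<rho>)" for s
    proof -
      define \<Delta> where "\<Delta> = \<gamma> s - \<gamma> t"
      have \<Delta>: "norm \<Delta> \<le> \<bar>s - t\<bar> / r" unfolding \<Delta>_def by (rule \<gamma>_lip[OF t s(1)])
      have 1: "\<bar>symp_form (char_dir (\<gamma> t)) \<Delta>\<bar> \<le> \<eta> * \<bar>s - t\<bar> / r"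
      proof -
        have "symp_form (char_dir (\<gamma> t)) \<Delta> = symp_form (char_dir (\<gamma> t)) (\<Delta> - (s - t) *\<^sub>R char_dir (\<gamma> t))"
          by (simp add: symp_simps)
        also have "\<bar>\<dots>\<bar> \<le> norm (char_dir (\<gamma> t)) * norm (\<Delta> - (s - t) *\<^sub>R char_dir (\<gamma> t))" by (rule abs_symp_form_le)
        also have "\<dots> \<le> (1 / r) * (\<eta> * \<bar>s - t\<bar>)"
          using s d(2) r_pos by (intro mult_mono norm_D char_dir_in_D) (auto simp: \<Delta>_def)
        finally show ?thesis by simp
      qed
      have 2: "\<bar>symp_form (char_dir (\<gamma> s) - char_dir (\<gamma> t)) \<Delta>\<bar> \<le> \<eta> * \<bar>s - t\<bar> / r"
      proof -
        have "\<bar>s - t\<bar> / r < \<rho>" using s(2) r_pos by (simp add: divide_less_eq mult.commute)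
        then have "norm (\<gamma> s - \<gamma> t) < \<rho>" using \<Delta> unfolding \<Delta>_def by linarith
        then have "norm (char_dir (\<gamma> s) - char_dir (\<gamma> t)) * norm \<Delta> \<le> \<eta> * (\<bar>s - t\<bar> / r)"
          using \<eta> by (intro mult_mono \<rho>(2) \<Delta>) auto
        then show ?thesis using abs_symp_form_le[of "char_dir (\<gamma> s) - char_dir (\<gamma> t)" \<Delta>] by simp
      qed
      have "\<phi> s - \<phi> t \<ge> symp_form (char_dir (\<gamma> t)) \<Delta>"
        using gauge_upper[OF char_dir_in_D, of "\<gamma> t" "\<gamma> s"] char_dir_gauge[of "\<gamma> t"] by (simp add: \<phi>_def \<Delta>_def symp_simps)
      moreover have "\<phi> s - \<phi> t \<le> symp_form (char_dir (\<gamma> s)) \<Delta>"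
        using gauge_upper[OF char_dir_in_D, of "\<gamma> s" "\<gamma> t"] char_dir_gauge[of "\<gamma> s"] by (simp add: \<phi>_def \<Delta>_def symp_simps)
      ultimately have "\<bar>\<phi> s - \<phi> t\<bar> \<le> 2 * (\<eta> * \<bar>s - t\<bar> / r)"
        using 1 2 by (simp add: symp.diff_left)
      also have "\<dots> = e * \<bar>s - t\<bar>" using r_pos by (simp add: \<eta>_def)
      finally show ?thesis .
    qed
    then show "\<exists>d>0. \<forall>s\<in>{0..1}. \<bar>s - t\<bar> < d \<longrightarrow> norm (\<phi> s - \<phi> t - (s - t) *\<^sub>R 0) \<le> e * \<bar>s - t\<bar>"
      using d(1) \<rho>(1) r_pos by (intro exI[of _ "min d (r * \<rho>)"]) auto
  qed
  have "((\<lambda>t. \<phi> t * \<phi> t) has_vector_derivative 0) (at t within {0..1})" if t: "t \<in> {0..1}" for t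
  proof (cases "\<gamma> t = 0")
    case False
    then show ?thesis
      using has_vector_derivative_mult[OF \<phi>_deriv[OF t False] \<phi>_deriv[OF t False]] by simp
  next
    case True
    show ?thesis
    proof (rule has_vector_derivative_within_normI)
      fix e :: real assume e: "e > 0"
      \<comment> \<open>At a zero \<open>t\<close> the Lipschitz bounds of gauge and curve give \<open>\<phi> s \<le> \<bar>s - t\<bar> / r\<^sup>2\<close>.\<close>
      have "\<bar>\<phi> s * \<phi> s\<bar> \<le> e * \<bar>s - t\<bar>" if s: "s \<in> {0..1}" "\<bar>s - t\<bar> < e * (r * r * r * r)" for s
      proof -
        have "\<phi> s \<le> norm (\<gamma> s - \<gamma> t) / r" using gauge_lipschitz[of "\<gamma> s" "\<gamma> t"] True by (simp add: \<phi>_def)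
        also have "\<dots> \<le> \<bar>s - t\<bar> / r / r" using r_pos by (intro divide_right_mono \<gamma>_lip t s) auto
        finally have *: "\<phi> s \<le> \<bar>s - t\<bar> / r / r" .
        have "\<phi> s * \<phi> s \<le> (\<bar>s - t\<bar> / r / r) * (\<bar>s - t\<bar> / r / r)"
          using r_pos by (intro mult_mono * gauge_nonneg) (auto simp: \<phi>_def gauge_nonneg)
        also have "\<dots> = \<bar>s - t\<bar> / (r * r * r * r) * \<bar>s - t\<bar>" by simp
        also have "\<dots> \<le> e * \<bar>s - t\<bar>"
          using s(2) r_pos by (intro mult_right_mono) (simp_all add: divide_le_eq)
        finally show ?thesis by (simp add: \<phi>_def gauge_nonneg)
      qed
      then show "\<exists>d>0. \<forall>s\<in>{0..1}. \<bar>s - t\<bar> < d \<longrightarrow>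
          norm (\<phi> s * \<phi> s - \<phi> t * \<phi> t - (s - t) *\<^sub>R 0) \<le> e * \<bar>s - t\<bar>"
        using e r_pos True by (intro exI[of _ "e * (r * r * r * r)"]) (auto simp: \<phi>_def)
    qed
  qed
  then obtain C where C: "\<And>t. t \<in> {0..1} \<Longrightarrow> \<phi> t * \<phi> t = C"
    using has_vector_derivative_zero_constant[of "{0..1}" "\<lambda>t. \<phi> t * \<phi> t"] by auto
  have \<phi>_const: "\<phi> t = sqrt C" if "t \<in> {0..1}" for t
    using C[OF that] by (metis \<phi>_def abs_of_nonneg gauge_nonneg real_sqrt_mult_self real_sqrt_abs2)
  have "sqrt C = iso_const T"
  proof (rule ccontr)
    assume ne: "sqrt C \<noteq> iso_const T"
    define e where "e = \<bar>sqrt C - iso_const T\<bar> / 2"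
    have e: "e > 0" using ne by (simp add: e_def)
    have "\<forall>\<^sub>F k in sequentially. 1 / real (Suc k) < e"
      using order_tendstoD(2)[OF LIMSEQ_inverse_real_of_nat e] by (simp add: inverse_eq_divide)
    moreover have "\<forall>\<^sub>F k in sequentially. \<forall>i<M k. norm (\<zeta> k i - \<gamma> (real i / real (M k))) < e * r"
      using e r_pos by (intro \<zeta>_near) simp
    ultimately have "\<forall>\<^sub>F k in sequentially. False"
    proof eventually_elim
      case (elim k)
      have *: "\<bar>gauge (\<zeta> k i) - sqrt C\<bar> \<le> e" if i: "i < M k" for i
      proof -
        let ?t = "real i / real (M k)"
        have "?t \<in> {0..1}" using i by simp
        then have "\<bar>gauge (\<zeta> k i) - sqrt C\<bar> = \<bar>gauge (\<zeta> k i) - gauge (\<gamma> ?t)\<bar>" using \<phi>_const by (simp add: \<phi>_def)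
        also have "\<dots> \<le> norm (\<zeta> k i - \<gamma> ?t) / r" by (rule gauge_lipschitz)
        also have "\<dots> \<le> e" using elim(2) i r_pos by (simp add: divide_le_eq less_imp_le)
        finally show ?thesis .
      qed
      have "\<bar>(\<Sum>i<M k. gauge (\<zeta> k i) - sqrt C)\<bar> \<le> (\<Sum>i<M k. e)"
        by (rule order_trans[OF sum_abs sum_mono]) (use * in auto)
      then have "\<bar>(\<Sum>i<M k. gauge (\<zeta> k i)) - real (M k) * sqrt C\<bar> / real (M k) \<le> real (M k) * e / real (M k)"
        by (intro divide_right_mono) (simp_all add: sum_subtractf)
      moreover have "\<bar>(\<Sum>i<M k. gauge (\<zeta> k i)) - real (M k) * sqrt C\<bar> / real (M k)
          = \<bar>(\<Sum>i<M k. gauge (\<zeta> k i)) / real (M k) - sqrt C\<bar>"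
      proof -
        have "(\<Sum>i<M k. gauge (\<zeta> k i)) / real (M k) - sqrt C
            = ((\<Sum>i<M k. gauge (\<zeta> k i)) - real (M k) * sqrt C) / real (M k)"
          using M_pos[of k] by (simp add: diff_divide_distrib)
        then show ?thesis by simp
      qed
      ultimately have "\<bar>area2 (u k) (M k) / (real (M k))\<^sup>2 - sqrt C\<bar> \<le> e"
        using M_pos[of k] extremal_area[OF ex[of k]] by (simp add: \<zeta>_def)
      moreover have "\<bar>area2 (u k) (M k) / (real (M k))\<^sup>2 - iso_const T\<bar> < e"
        using area[of k] elim(1) by (rule le_less_trans)
      ultimately have "\<bar>sqrt C - iso_const T\<bar> < e + e"
        using abs_triangle_ineq4[of "area2 (u k) (M k) / (real (M k))\<^sup>2 - iso_const T" "area2 (u k) (M k) / (real (M k))\<^sup>2 - sqrt C"]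
        by simp
      then show False by (simp add: e_def)
    qed
    then show False by simp
  qed
  then have const: "gauge (\<gamma> t) = iso_const T" if "t \<in> {0..1}" for t
    using \<phi>_const[OF that] by (simp add: \<phi>_def)
  have "\<gamma> t \<noteq> 0" if "t \<in> {0..1}" for t
    using const[OF that] iso_pos by auto
  with \<gamma>_closed const deriv show ?thesis by (intro that[of \<gamma>]) auto
qed

text \<open>Scaling the limit curve to gauge \<open>1\<close> puts it onto the boundary; a constant factor does not affect the direction of the velocity.\<close>

lemma minimal_closed_characteristic:
  obtains \<beta> where "closed_characteristic T \<beta>" "action \<beta> = 1 / (2 * iso_const T)"
proof -
  obtain \<gamma> where \<gamma>: "\<gamma> 0 = \<gamma> 1" "\<And>t. t \<in> {0..1} \<Longrightarrow> gauge (\<gamma> t) = iso_const T"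
    and der: "\<And>t. t \<in> {0..1} \<Longrightarrow> (\<gamma> has_vector_derivative char_dir (\<gamma> t)) (at t within {0..1})"
    using extremal_limit by blast
  define k where "k = 1 / iso_const T"
  have k: "k > 0" using iso_pos by (simp add: k_def)
  let ?\<beta> = "\<lambda>t. k *\<^sub>R \<gamma> t" and ?\<beta>' = "\<lambda>t. k *\<^sub>R char_dir (\<gamma> t)"
  have der': "(?\<beta> has_vector_derivative ?\<beta>' t) (at t within {0..1})" if "t \<in> {0..1}" for t
    using has_vector_derivative_scaleR[OF DERIV_const der[OF that], of k] by simp
  have nz: "\<gamma> t \<noteq> 0" if "t \<in> {0..1}" for t
    using \<gamma>(2)[OF that] iso_pos by auto
  have cont_\<gamma>: "continuous_on {0..1} \<gamma>"
    unfolding continuous_on_eq_continuous_within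
    by (intro ballI has_vector_derivative_continuous[OF der])
  have "continuous_on {0..1} (\<lambda>t. char_dir (\<gamma> t))"
    using nz by (intro continuous_on_compose2[OF continuous_on_char_dir cont_\<gamma>, of "\<gamma> ` {0..1}"]) force+
  then have "continuous_on {0..1} ?\<beta>'" by (intro continuous_intros)
  moreover have "?\<beta> 0 = ?\<beta> 1" using \<gamma>(1) by simp
  moreover have "?\<beta> ` {0..1} \<subseteq> frontier T"
    using char_dir_characteristic(3)[OF \<gamma>(2) iso_pos k] by (auto simp: k_def)
  moreover have "?\<beta>' t \<noteq> 0" "?\<beta>' t \<in> characteristic_line T (?\<beta> t)" if "t \<in> {0..1}" for t
    using char_dir_characteristic(1,2)[OF \<gamma>(2)[OF that] iso_pos k] by (simp_all add: k_def)
  ultimately have "closed_characteristic T ?\<beta>"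
    unfolding closed_characteristic_def using der' by blast
  moreover have "action ?\<beta> = 1 / (2 * iso_const T)"
  proof -
    have "action ?\<beta> = \<bar>integral {0..1} (\<lambda>t. symp_form (?\<beta>' t) (?\<beta> t))\<bar> / 2"
      by (rule action_eq) (rule der')
    also have "integral {0..1} (\<lambda>t. symp_form (?\<beta>' t) (?\<beta> t)) = integral {0..1::real} (\<lambda>t. k)"
    proof (rule integral_cong)
      fix t :: real assume t: "t \<in> {0..1}"
      show "symp_form (?\<beta>' t) (?\<beta> t) = k"
        using char_dir_gauge[of "\<gamma> t"] \<gamma>(2)[OF t] iso_pos by (simp add: symp.scaleR_left symp.scaleR_right k_def)
    qed
    finally show ?thesis using k by (simp add: k_def)
  qed
  ultimately show ?thesis using that by blast
qed

theorem smooth_ehz_capacity_eq: "smooth_ehz_capacity T = 1 / (2 * iso_const T)"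
  unfolding smooth_ehz_capacity_def
proof (rule cInf_eq_minimum)
  show "1 / (2 * iso_const T) \<in> {action \<gamma> |\<gamma>. closed_characteristic T \<gamma>}"
    using minimal_closed_characteristic by (metis (mono_tags, lifting) mem_Collect_eq)
  show "1 / (2 * iso_const T) \<le> x" if "x \<in> {action \<gamma> |\<gamma>. closed_characteristic T \<gamma>}" for x
    using that closed_characteristic_action_ge by blast
qed

end

section \<open>The capacity of general convex bodies\<close>

lemma pointed_bodyI:
  assumes "convex_body T" "r > 0" "cball 0 r \<subseteq> T"
  shows "pointed_body T r"
  using assms by (simp add: pointed_body_def convex_body_def)

lemma infdist_le_hausdorff:
  assumes "compact A" "compact B" "B \<noteq> {}" "x \<in> A"
  shows "infdist x B \<le> hausdorff_dist A B"
proof -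
  have "bdd_above ((\<lambda>x. infdist x B) ` A)"
    using assms(1) by (intro bounded_imp_bdd_above compact_imp_bounded compact_continuous_image continuous_on_infdist continuous_on_id)
  then have "infdist x B \<le> (SUP x\<in>A. infdist x B)" using assms(4) by (rule cSUP_upper[rotated])
  then show ?thesis by (simp add: hausdorff_dist_def le_max_iff_disj)
qed

lemma hausdorff_dist_commute: "hausdorff_dist A B = hausdorff_dist B A"
  by (simp add: hausdorff_dist_def max.commute)

lemma hausdorff_close_point:
  fixes A B :: "'a::heine_borel set"
  assumes "compact A" "compact B" "B \<noteq> {}" "x \<in> A" "hausdorff_dist A B < \<delta>"
  obtains y where "y \<in> B" "dist x y < \<delta>"
proof -
  obtain y where "y \<in> B" "infdist x B = dist x y"
    using infdist_attains_inf[OF compact_imp_closed[OF assms(2)] assms(3)] by blast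
  then show ?thesis using infdist_le_hausdorff[OF assms(1-4)] assms(5) that by force
qed

context pointed_body
begin

lemma scale_into_T: "k \<ge> 0 \<Longrightarrow> k * gauge y \<le> 1 \<Longrightarrow> k *\<^sub>R y \<in> T"
  by (simp add: mem_T_iff gauge_scaleR)

text \<open>In terms of sets: \<open>(1 - \<delta> / r) T \<subseteq> S \<subseteq> (1 + \<delta> / r) T\<close>. For the first inclusion, a point \<open>p\<close> outside
\<open>S\<close> is pushed by \<open>\<delta>\<close> away from \<open>S\<close> along the normal of a separating hyperplane; it stays in \<open>T\<close>, but has
no point of \<open>S\<close> within distance \<open>\<delta>\<close>.\<close>

lemma hausdorff_sandwich:
  assumes S: "convex_body S" and close: "hausdorff_dist T S < \<delta>" and \<delta>: "\<delta> < r"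
  shows "y \<in> S \<Longrightarrow> gauge y \<le> 1 + \<delta> / r" and "gauge p \<le> 1 - \<delta> / r \<Longrightarrow> p \<in> S"
proof -
  have cS: "compact S" "S \<noteq> {}" "T \<noteq> {}" "convex S"
    using S zero_in_T by (auto simp: convex_body_def)
  show "gauge y \<le> 1 + \<delta> / r" if y: "y \<in> S"
  proof -
    obtain x where x: "x \<in> T" "dist y x < \<delta>"
      using hausdorff_close_point[OF cS(1) compact_T cS(3) y] close hausdorff_dist_commute by metis
    have "gauge y \<le> gauge x + norm (y - x) / r" using gauge_lipschitz[of y x] by simp
    also have "\<dots> \<le> 1 + \<delta> / r"
      using x r_pos by (intro add_mono divide_right_mono) (simp_all add: mem_T_iff dist_norm)
    finally show ?thesis .
  qed
  show "p \<in> S" if p: "gauge p \<le> 1 - \<delta> / r"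
  proof (rule ccontr)
    assume "p \<notin> S"
    then obtain a b where ab: "a \<bullet> p < b" "\<And>x. x \<in> S \<Longrightarrow> b < a \<bullet> x"
      using separating_hyperplane_closed_point[OF cS(4) compact_imp_closed[OF cS(1)]] by metis
    have a: "a \<noteq> 0" using ab(1) ab(2) cS(2) by fastforce
    have \<delta>0: "\<delta> > 0"
      using close infdist_le_hausdorff[OF compact_T cS(1,2) zero_in_T] infdist_nonneg[of 0 S] by linarith
    define x where "x = p - (\<delta> / norm a) *\<^sub>R a"
    have "norm (x - p) = \<delta>" using a \<delta>0 by (simp add: x_def)
    then have "gauge x \<le> 1" using gauge_lipschitz[of x p] p by simp
    then have "x \<in> T" by (simp add: mem_T_iff)
    then obtain y where y: "y \<in> S" "dist x y < \<delta>"
      using hausdorff_close_point[OF compact_T cS(1,2) _ close] by blast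
    have "a \<bullet> (y - x) \<le> norm a * norm (y - x)" by (rule norm_cauchy_schwarz)
    also have "\<dots> \<le> norm a * \<delta>" using y(2) by (intro mult_left_mono) (simp_all add: dist_norm norm_minus_commute)
    finally have "a \<bullet> y \<le> a \<bullet> x + norm a * \<delta>" by (simp add: inner_diff_right)
    also have "a \<bullet> x = a \<bullet> p - norm a * \<delta>"
      using a by (simp add: x_def inner_diff_right power2_norm_eq_inner[symmetric] power2_eq_square)
    finally show False using ab(1) ab(2)[OF y(1)] by simp
  qed
qed

lemma smooth_capacity_near:
  assumes S: "convex_body S" "smooth_boundary S" and close: "hausdorff_dist T S < r * \<eta>" and \<eta>: "0 < \<eta>" "\<eta> < 1"
  shows "\<bar>smooth_ehz_capacity S - 1 / (2 * iso_const T)\<bar> \<le> 3 * \<eta> * (1 / (2 * iso_const T))"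
proof -
  have lt: "r * \<eta> < r" using r_pos \<eta> by simp
  have 1: "gauge y \<le> 1 + \<eta>" if "y \<in> S" for y
    using hausdorff_sandwich(1)[OF S(1) close lt that] r_pos by simp
  have 2: "p \<in> S" if "gauge p \<le> 1 - \<eta>" for p
    using hausdorff_sandwich(2)[OF S(1) close lt, of p] that r_pos by simp
  have "cball 0 ((1 - \<eta>) * r) \<subseteq> S"
  proof
    fix x :: "'n phase" assume "x \<in> cball 0 ((1 - \<eta>) * r)"
    then have "norm x / r \<le> 1 - \<eta>" using r_pos by (simp add: divide_le_eq)
    then show "x \<in> S" using gauge_lipschitz[of x 0] by (intro 2) simp
  qed
  then have "pointed_body S ((1 - \<eta>) * r)"
    using S(1) r_pos \<eta> by (intro pointed_bodyI) simp_all
  then interpret S: smooth_body S "(1 - \<eta>) * r"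
    using S(2) by (intro smooth_body.intro smooth_body_axioms.intro)
  have "iso_const S \<le> iso_const T / (1 - \<eta>)\<^sup>2"
    using \<eta> bounded_D by (intro iso_const_scale_le 2) (auto simp: gauge_scaleR mem_T_iff mult_left_le)
  then have up: "(1 - \<eta>)\<^sup>2 * iso_const S \<le> iso_const T"
    using \<eta> by (simp add: pos_le_divide_eq mult.commute)
  have "iso_const T \<le> iso_const S / (1 / (1 + \<eta>))\<^sup>2"
    using \<eta> S.bounded_D 1 by (intro iso_const_scale_le scale_into_T) (auto simp: divide_le_eq)
  then have lo: "iso_const T \<le> (1 + \<eta>)\<^sup>2 * iso_const S"
    using \<eta> by (simp add: power_divide mult.commute)
  let ?c = "1 / (2 * iso_const T)" and ?s = "1 / (2 * iso_const S)"
  have c: "?c > 0" using iso_pos by simp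
  have "(1 - \<eta>)\<^sup>2 * ?c \<le> ?s" using up iso_pos S.iso_pos by (simp add: field_simps)
  moreover have "?s \<le> (1 + \<eta>)\<^sup>2 * ?c" using lo iso_pos S.iso_pos by (simp add: field_simps)
  moreover have "(1 - 3 * \<eta>) * ?c \<le> (1 - \<eta>)\<^sup>2 * ?c"
    using c \<eta> by (intro mult_right_mono) (simp_all add: power2_eq_square algebra_simps)
  moreover have "(1 + \<eta>)\<^sup>2 * ?c \<le> (1 + 3 * \<eta>) * ?c"
  proof (intro mult_right_mono)
    have "\<eta> * \<eta> \<le> \<eta> * 1" using \<eta> by (intro mult_left_mono) auto
    then show "(1 + \<eta>)\<^sup>2 \<le> 1 + 3 * \<eta>" by (simp add: power2_eq_square algebra_simps)
  qed (use c in simp)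
  ultimately have "(1 - 3 * \<eta>) * ?c \<le> ?s" "?s \<le> (1 + 3 * \<eta>) * ?c" by (meson order_trans)+
  then have "?c - 3 * \<eta> * ?c \<le> ?s" "?s \<le> ?c + 3 * \<eta> * ?c"
    by (simp_all only: left_diff_distrib distrib_right mult_1_left)
  then show ?thesis unfolding S.smooth_ehz_capacity_eq abs_le_iff by linarith
qed

end

text \<open>The coefficients \<open>c\<close> and the constant \<open>k\<close> make the family closed under directional derivatives.\<close>

definition exp_sum :: "('n::finite phase \<Rightarrow> real) \<Rightarrow> 'n phase set \<Rightarrow> real \<Rightarrow> real \<Rightarrow> 'n phase \<Rightarrow> real" where
  "exp_sum c A N k x = (\<Sum>a\<in>A. c a * exp (N * (symp_form a x - 1))) + k"

lemma has_derivative_symp_form: "((\<lambda>x. symp_form a x) has_derivative (\<lambda>v. symp_form a v)) (at x)"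
  by (rule bounded_linear_imp_has_derivative[OF symp.bounded_linear_right])

lemma exp_sum_derivative:
  "(exp_sum c A N k has_derivative (\<lambda>v. exp_sum (\<lambda>a. c a * (N * symp_form a v)) A N 0 x)) (at x)"
proof -
  have "((\<lambda>x. c a * exp (N * (symp_form a x - 1))) has_derivative
      (\<lambda>v. c a * (N * symp_form a v) * exp (N * (symp_form a x - 1)))) (at x)" for a
    by (rule derivative_eq_intros has_derivative_symp_form refl)+ (simp add: mult_ac)
  from has_derivative_sum[of A, OF this]
  have "((\<lambda>x. (\<Sum>a\<in>A. c a * exp (N * (symp_form a x - 1))) + k) has_derivative
      (\<lambda>v. (\<Sum>a\<in>A. c a * (N * symp_form a v) * exp (N * (symp_form a x - 1))) + 0)) (at x)"
    by (intro has_derivative_add has_derivative_const)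
  then show ?thesis unfolding exp_sum_def .
qed

lemma frechet_derivative_exp_sum:
  "frechet_derivative (exp_sum c A N k) (at x) v = exp_sum (\<lambda>a. c a * (N * symp_form a v)) A N 0 x"
  unfolding frechet_derivative_at[OF exp_sum_derivative, symmetric] ..

lemma Ck_on_exp_sum: "Ck_on m U (exp_sum c A N k)"
proof (induction m arbitrary: c k)
  case 0
  have "continuous_on U (exp_sum c A N k)"
    by (intro continuous_at_imp_continuous_on ballI has_derivative_continuous[OF exp_sum_derivative])
  then show ?case by simp
next
  case (Suc m)
  have "(\<lambda>x. frechet_derivative (exp_sum c A N k) (at x) v) = exp_sum (\<lambda>a. c a * (N * symp_form a v)) A N 0" for v
    by (rule ext) (rule frechet_derivative_exp_sum)
  moreover have "exp_sum c A N k differentiable (at x)" for x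
    unfolding differentiable_def by (rule exI, rule exp_sum_derivative)
  ultimately show ?case using Suc.IH by simp
qed

text \<open>The function is convex, which is used in the form that its graph lies above its tangents. It is
negative at \<open>0\<close> by assumption, so at a zero \<open>x\<close> the derivative in the direction \<open>x\<close> is positive.\<close>

lemma smooth_convex_sublevel:
  fixes A :: "'n::finite phase set"
  assumes A: "finite A" and N: "N > 0" and less: "real (card A) * exp (- N) < 1"
  defines "f \<equiv> exp_sum (\<lambda>_. 1) A N (-1)"
  shows "closed {x. f x \<le> 0}" "convex {x. f x \<le> 0}" "smooth_boundary {x. f x \<le> 0}"
proof -
  let ?f' = "\<lambda>x v. exp_sum (\<lambda>a. N * symp_form a v) A N 0 x"
  have f': "frechet_derivative f (at x) v = ?f' x v" for x v
    unfolding f_def frechet_derivative_exp_sum by simp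
  have cont: "continuous_on X f" for X
    unfolding f_def
    by (intro continuous_at_imp_continuous_on ballI has_derivative_continuous[OF exp_sum_derivative])
  show closed: "closed {x. f x \<le> 0}"
    by (intro closed_Collect_le cont continuous_on_const)
  have tangent: "f (x + v) \<ge> f x + ?f' x v" for x v
  proof -
    have "exp (N * (symp_form a x - 1)) * (1 + N * symp_form a v) \<le> exp (N * (symp_form a (x + v) - 1))" for a
    proof -
      have "exp (N * (symp_form a x - 1)) * (1 + N * symp_form a v) \<le> exp (N * (symp_form a x - 1)) * exp (N * symp_form a v)"
        by (intro mult_left_mono exp_ge_add_one_self) simp
      also have "\<dots> = exp (N * (symp_form a (x + v) - 1))"
        by (simp add: exp_add[symmetric] symp.add_right algebra_simps)
      finally show ?thesis .
    qed
    then have "(\<Sum>a\<in>A. exp (N * (symp_form a x - 1)) * (1 + N * symp_form a v)) \<le> (\<Sum>a\<in>A. exp (N * (symp_form a (x + v) - 1)))"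
      by (rule sum_mono)
    then show ?thesis by (simp add: f_def exp_sum_def algebra_simps sum.distrib)
  qed
  have lin: "?f' x (c *\<^sub>R v) = c * ?f' x v" "?f' x (v + w) = ?f' x v + ?f' x w" for x c v w
    by (simp_all add: exp_sum_def symp.scaleR_right symp.add_right sum_distrib_left sum.distrib algebra_simps)
  show "convex {x. f x \<le> 0}"
    unfolding convex_alt
  proof (intro ballI allI impI CollectI)
    fix x y and u :: real assume x: "x \<in> {x. f x \<le> 0}" and y: "y \<in> {x. f x \<le> 0}" and u: "0 \<le> u \<and> u \<le> 1"
    let ?z = "(1 - u) *\<^sub>R x + u *\<^sub>R y"
    have "f x \<ge> f ?z + ?f' ?z (u *\<^sub>R (x - y))" "f y \<ge> f ?z + ?f' ?z ((1 - u) *\<^sub>R (y - x))"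
      using tangent[of ?z "u *\<^sub>R (x - y)"] tangent[of ?z "(1 - u) *\<^sub>R (y - x)"] by (simp_all add: algebra_simps)
    moreover have "?f' ?z (y - x) = - ?f' ?z (x - y)"
      using lin(1)[where x = ?z and c = "-1" and v = "x - y"] by simp
    ultimately have "f x \<ge> f ?z + u * ?f' ?z (x - y)" "f y \<ge> f ?z - (1 - u) * ?f' ?z (x - y)"
      by (simp_all add: lin(1))
    then have *: "(1 - u) * f x + u * f y \<ge> (1 - u) * (f ?z + u * ?f' ?z (x - y)) + u * (f ?z - (1 - u) * ?f' ?z (x - y))"
      using u by (intro add_mono mult_left_mono) auto
    have "(1 - u) * (f ?z + u * ?f' ?z (x - y)) + u * (f ?z - (1 - u) * ?f' ?z (x - y)) = f ?z"
      by (simp add: algebra_simps)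
    moreover have "(1 - u) * f x \<le> 0" "u * f y \<le> 0"
      using x y u by (simp_all add: mult_nonneg_nonpos)
    ultimately show "f ?z \<le> 0" using * by linarith
  qed
  have f0: "f 0 < 0" using less by (simp add: f_def exp_sum_def)
  have radial: "?f' x x > 0" if "f x = 0" for x
  proof -
    have "?f' x (- x) = - ?f' x x" using lin(1)[where x = x and c = "-1" and v = x] by simp
    then show ?thesis using tangent[of x "- x"] that f0 by simp
  qed
  have frontier: "frontier {x. f x \<le> 0} = {x. f x = 0}"
  proof -
    have "interior {x. f x \<le> 0} = {x. f x < 0}"
    proof (rule interior_unique)
      show "{x. f x < 0} \<subseteq> {x. f x \<le> 0}" by auto
      show "open {x. f x < 0}" by (intro open_Collect_less cont continuous_on_const)
      fix U assume U: "U \<subseteq> {x. f x \<le> 0}" "open U"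
      show "U \<subseteq> {x. f x < 0}"
      proof
        fix x assume x: "x \<in> U"
        have "f x \<noteq> 0"
        proof
          assume fx: "f x = 0"
          obtain e where e: "e > 0" "ball x e \<subseteq> U" using U(2) x openE by blast
          define s where "s = e / (2 * (norm x + 1))"
          have nx: "norm x + 1 > 0" by (rule add_nonneg_pos) simp_all
          have s: "s > 0" using e nx by (simp add: s_def)
          have "s * norm x \<le> s * (norm x + 1)" using s by simp
          also have "\<dots> = e / 2" using nx by (simp add: s_def field_simps)
          finally have "x + s *\<^sub>R x \<in> ball x e" using s e by (simp add: dist_norm)
          then have "f (x + s *\<^sub>R x) \<le> 0" using e U by blast
          moreover have "f (x + s *\<^sub>R x) \<ge> s * ?f' x x" using tangent[of x "s *\<^sub>R x"] fx by (simp add: lin(1))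
          moreover have "s * ?f' x x > 0" using s radial[OF fx] by simp
          ultimately show False by linarith
        qed
        then show "x \<in> {x. f x < 0}" using x U(1) by force
      qed
    qed
    then show ?thesis using closed by (auto simp: frontier_def)
  qed
  show "smooth_boundary {x. f x \<le> 0}"
    unfolding smooth_boundary_def
  proof (intro ballI exI conjI)
    show "x \<in> UNIV" for x :: "'n phase" by simp
    show "boundary_defining {x. f x \<le> 0} UNIV f"
      unfolding boundary_defining_def frontier
    proof (intro conjI ballI)
      show "smooth_on UNIV f" unfolding smooth_on_def f_def using Ck_on_exp_sum by blast
      fix x assume "x \<in> {x. f x = 0} \<inter> UNIV"
      then have "frechet_derivative f (at x) x \<noteq> 0" using radial[of x] by (simp add: f')
      then show "\<exists>v. frechet_derivative f (at x) v \<noteq> 0" by blast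
    qed auto
  qed
qed

context pointed_body
begin

text \<open>Each point of gauge \<open>1 + \<eta>\<close> is strictly cut off by an element of the polar; finitely many suffice by
compactness, and rays from the origin carry this to all points of larger gauge.\<close>

lemma finite_halfspaces:
  assumes \<eta>: "\<eta> > 0"
  obtains A where "finite A" "A \<noteq> {}" "A \<subseteq> D" "\<And>y. (\<And>a. a \<in> A \<Longrightarrow> symp_form a y \<le> 1) \<Longrightarrow> gauge y \<le> 1 + \<eta>"
proof -
  let ?K = "{x. gauge x = 1 + \<eta>}"
  have "closed ?K" by (intro closed_Collect_eq continuous_on_gauge continuous_on_const)
  moreover have "bounded ?K"
  proof -
    obtain c where c: "c > 0" "\<And>y. c * norm y \<le> gauge y" using gauge_pos_lower by blast
    have "norm x \<le> (1 + \<eta>) / c" if "x \<in> ?K" for x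
      using c(2)[of x] that c(1) by (simp add: pos_le_divide_eq mult.commute)
    then show ?thesis by (rule boundedI)
  qed
  ultimately have "compact ?K" by (simp add: compact_eq_bounded_closed)
  moreover have "open {x. symp_form a x > 1}" for a :: "'n phase"
    by (intro open_Collect_less continuous_on_const bounded_linear.continuous_on[OF symp.bounded_linear_right] continuous_on_id)
  moreover have "?K \<subseteq> (\<Union>a\<in>D. {x. symp_form a x > 1})"
  proof
    fix x assume x: "x \<in> ?K"
    obtain a where "a \<in> D" "symp_form a x = gauge x" by (rule gauge_attained)
    then show "x \<in> (\<Union>a\<in>D. {x. symp_form a x > 1})" using x \<eta> by (intro UN_I[of a]) simp_all
  qed
  ultimately obtain A where A: "A \<subseteq> D" "finite A" "?K \<subseteq> (\<Union>a\<in>A. {x. symp_form a x > 1})"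
    using compactE_image[of ?K D "\<lambda>a. {x. symp_form a x > 1}"] by metis
  have in_K: "((1 + \<eta>) / gauge y) *\<^sub>R y \<in> ?K" if "gauge y > 0" for y
    using that \<eta> by (simp add: gauge_scaleR)
  show ?thesis
  proof (rule that[OF A(2) _ A(1)])
    obtain b :: "'n phase" where "b \<in> Basis" using nonempty_Basis by blast
    then have "gauge b > 0" by (intro gauge_pos nonzero_Basis)
    from in_K[OF this] show "A \<noteq> {}" using A(3) by blast
    fix y assume y: "\<And>a. a \<in> A \<Longrightarrow> symp_form a y \<le> 1"
    show "gauge y \<le> 1 + \<eta>"
    proof (rule ccontr)
      assume "\<not> ?thesis"
      then have gy: "gauge y > 1 + \<eta>" by simp
      then have pos: "gauge y > 0" using \<eta> by linarith
      then obtain a where a: "a \<in> A" "symp_form a (((1 + \<eta>) / gauge y) *\<^sub>R y) > 1"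
        using in_K[OF pos] A(3) by blast
      have "(1 + \<eta>) / gauge y * symp_form a y \<le> (1 + \<eta>) / gauge y * 1"
        using y[OF a(1)] \<eta> pos by (intro mult_left_mono) auto
      also have "\<dots> < 1" using gy pos by simp
      finally show False using a(2) by (simp add: symp.scaleR_right)
    qed
  qed
qed

text \<open>For large \<open>N\<close> the sum of the \<open>exp (N (\<omega>(a, x) - 1))\<close> passes the value \<open>1\<close> close to where the largest
\<open>\<omega>(a, x)\<close> passes \<open>1\<close>.\<close>

lemma smooth_approximation:
  assumes \<delta>: "\<delta> > 0"
  obtains S where "convex_body S" "smooth_boundary S" "hausdorff_dist T S < \<delta>"
proof -
  obtain R where R: "R > 0" "T \<subseteq> cball 0 R"
    using bounded_subset_cball_0E[OF compact_imp_bounded[OF compact_T]] .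
  define \<eta> where "\<eta> = min (1 / 2) (\<delta> / (2 * R))"
  have \<eta>: "\<eta> > 0" "\<eta> < 1" using \<delta> R by (auto simp: \<eta>_def min_less_iff_disj)
  have "\<eta> * R \<le> \<delta> / (2 * R) * R" using R(1) by (intro mult_right_mono) (simp_all add: \<eta>_def)
  also have "\<dots> < \<delta>" using R(1) \<delta> by simp
  finally have \<eta>R: "\<eta> * R < \<delta>" .
  obtain A where A: "finite A" "A \<noteq> {}" "A \<subseteq> D"
    "\<And>y. (\<And>a. a \<in> A \<Longrightarrow> symp_form a y \<le> 1) \<Longrightarrow> gauge y \<le> 1 + \<eta>"
    using finite_halfspaces[OF \<eta>(1)] by blast
  define m where "m = real (card A)"
  have m: "m \<ge> 1" using A(1,2) by (simp add: m_def Suc_leI card_gt_0_iff)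
  \<comment> \<open>Then \<open>m exp (- \<eta> N) = exp (- 1) < 1\<close>, so gauge at most \<open>1 - \<eta>\<close> forces membership.\<close>
  define N where "N = (ln m + 1) / \<eta>"
  have N: "N > 0" using m \<eta> by (simp add: N_def ln_ge_zero add_nonneg_pos)
  have \<eta>N: "\<eta> * N = ln m + 1" using \<eta> by (simp add: N_def)
  have small: "m * exp (- (\<eta> * N)) < 1"
  proof -
    have "exp (- (\<eta> * N)) = exp (- 1) / m" unfolding \<eta>N using m by (simp add: exp_diff exp_minus field_simps)
    then show ?thesis using m by simp
  qed
  have "exp (- N) \<le> exp (- (\<eta> * N))" using \<eta> N by simp
  then have "m * exp (- N) < 1" using small m mult_left_mono[of "exp (- N)" "exp (- (\<eta> * N))" m] by linarith
  note smooth = smooth_convex_sublevel[OF A(1) N this[unfolded m_def]]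
  define S where "S = {x. exp_sum (\<lambda>_. 1) A N (-1) x \<le> 0}"
  have outer: "gauge y \<le> 1 + \<eta>" if y: "y \<in> S" for y
  proof (rule A(4), rule ccontr)
    fix a assume a: "a \<in> A" "\<not> symp_form a y \<le> 1"
    have "1 < exp (N * (symp_form a y - 1))" using a(2) N by simp
    also have "\<dots> \<le> (\<Sum>a\<in>A. exp (N * (symp_form a y - 1)))"
      using a(1) A(1) by (intro member_le_sum) auto
    finally show False using y by (simp add: S_def exp_sum_def)
  qed
  have inner: "y \<in> S" if y: "gauge y \<le> 1 - \<eta>" for y
  proof -
    have "(\<Sum>a\<in>A. exp (N * (symp_form a y - 1))) \<le> (\<Sum>a\<in>A. exp (- (\<eta> * N)))"
    proof (rule sum_mono)
      fix a assume "a \<in> A"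
      then have "symp_form a y \<le> 1 - \<eta>" using A(3) gauge_upper[of a y] y by force
      then have "N * (symp_form a y - 1) \<le> N * (- \<eta>)" using N by (intro mult_left_mono) auto
      then show "exp (N * (symp_form a y - 1)) \<le> exp (- (\<eta> * N))" by (simp add: mult.commute)
    qed
    also have "\<dots> < 1" using small by (simp add: m_def)
    finally show ?thesis by (simp add: S_def exp_sum_def)
  qed
  have "bounded S"
  proof -
    obtain c where c: "c > 0" "\<And>y. c * norm y \<le> gauge y" using gauge_pos_lower by blast
    have "norm x \<le> (1 + \<eta>) / c" if "x \<in> S" for x
      using c(2)[of x] outer[OF that] c(1) by (simp add: pos_le_divide_eq mult.commute)
    then show ?thesis by (rule boundedI)
  qed
  moreover have "ball 0 ((1 - \<eta>) * r) \<subseteq> S"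
  proof
    fix x :: "'n phase" assume "x \<in> ball 0 ((1 - \<eta>) * r)"
    then have "norm x / r \<le> 1 - \<eta>" using r_pos by (simp add: divide_le_eq)
    then show "x \<in> S" using gauge_lipschitz[of x 0] by (intro inner) simp
  qed
  then have "0 \<in> interior S" using \<eta> r_pos by (intro interiorI[OF open_ball]) auto
  ultimately have body: "convex_body S"
    using smooth(1,2) unfolding S_def convex_body_def compact_eq_bounded_closed by blast
  have 1: "infdist x S \<le> \<eta> * R" if x: "x \<in> T" for x
  proof -
    have "(1 - \<eta>) *\<^sub>R x \<in> S" using x \<eta> by (intro inner) (simp add: gauge_scaleR mem_T_iff mult_left_le)
    then have "infdist x S \<le> dist x ((1 - \<eta>) *\<^sub>R x)" by (rule infdist_le)
    also have "\<dots> = \<eta> * norm x" using \<eta> by (simp add: dist_norm algebra_simps)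
    also have "\<dots> \<le> \<eta> * R" using x R(2) \<eta> by (intro mult_left_mono) auto
    finally show ?thesis .
  qed
  have 2: "infdist y T \<le> \<eta> * R" if y: "y \<in> S" for y
  proof -
    define x where "x = (1 / (1 + \<eta>)) *\<^sub>R y"
    have x: "x \<in> T" unfolding x_def using outer[OF y] \<eta> by (intro scale_into_T) (simp_all add: divide_le_eq)
    have yx: "y = x + \<eta> *\<^sub>R x" using \<eta> by (simp add: x_def scaleR_left_distrib[symmetric] add_divide_distrib[symmetric])
    have "infdist y T \<le> dist y x" using x by (rule infdist_le)
    also have "\<dots> = \<eta> * norm x" using \<eta> by (simp add: dist_norm yx)
    also have "\<dots> \<le> \<eta> * R" using x R(2) \<eta> by (intro mult_left_mono) auto
    finally show ?thesis .
  qed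
  have "hausdorff_dist T S \<le> \<eta> * R"
    unfolding hausdorff_dist_def using 1 2 zero_in_T \<open>0 \<in> interior S\<close> interior_subset
    by (intro max.boundedI cSUP_least) auto
  then show ?thesis using that[of S] body smooth(3) \<eta>R by (simp add: S_def)
qed

text \<open>Continuity shows that \<open>1 / (2 I)\<close> has the defining property of the limit. The density of bodies with
smooth boundary is needed for uniqueness.\<close>

theorem ehz_capacity_eq: "ehz_capacity T = 1 / (2 * iso_const T)"
  unfolding ehz_capacity_def
proof (rule the_equality)
  let ?c = "1 / (2 * iso_const T)"
  have c: "?c > 0" using iso_pos by simp
  show near: "\<forall>\<epsilon>>0. \<exists>\<delta>>0. \<forall>S. convex_body S \<and> smooth_boundary S \<and> hausdorff_dist T S < \<delta> \<longrightarrow>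
      \<bar>smooth_ehz_capacity S - ?c\<bar> < \<epsilon>"
  proof (intro allI impI)
    fix \<epsilon> :: real assume \<epsilon>: "\<epsilon> > 0"
    define \<eta> where "\<eta> = min (1 / 2) (\<epsilon> / (6 * ?c))"
    have \<eta>: "\<eta> > 0" "\<eta> < 1" using \<epsilon> c by (auto simp: \<eta>_def min_less_iff_disj)
    have "3 * \<eta> * ?c \<le> 3 * (\<epsilon> / (6 * ?c)) * ?c"
      using c by (intro mult_right_mono mult_left_mono) (simp_all add: \<eta>_def)
    also have "\<dots> < \<epsilon>" using c \<epsilon> by simp
    finally have "3 * \<eta> * ?c < \<epsilon>" .
    then show "\<exists>\<delta>>0. \<forall>S. convex_body S \<and> smooth_boundary S \<and> hausdorff_dist T S < \<delta> \<longrightarrow>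
      \<bar>smooth_ehz_capacity S - ?c\<bar> < \<epsilon>"
      using smooth_capacity_near[OF _ _ _ \<eta>] \<eta> r_pos
      by (intro exI[of _ "r * \<eta>"]) (auto intro: le_less_trans)
  qed
  fix c' assume c': "\<forall>\<epsilon>>0. \<exists>\<delta>>0. \<forall>S. convex_body S \<and> smooth_boundary S \<and> hausdorff_dist T S < \<delta> \<longrightarrow>
      \<bar>smooth_ehz_capacity S - c'\<bar> < \<epsilon>"
  show "c' = ?c"
  proof (rule ccontr)
    assume ne: "c' \<noteq> ?c"
    define \<epsilon> where "\<epsilon> = \<bar>c' - ?c\<bar> / 2"
    have \<epsilon>: "\<epsilon> > 0" using ne by (simp add: \<epsilon>_def)
    obtain \<delta>1 where \<delta>1: "\<delta>1 > 0" "\<And>S. convex_body S \<Longrightarrow> smooth_boundary S \<Longrightarrow> hausdorff_dist T S < \<delta>1 \<Longrightarrow>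
      \<bar>smooth_ehz_capacity S - ?c\<bar> < \<epsilon>" using near \<epsilon> by blast
    obtain \<delta>2 where \<delta>2: "\<delta>2 > 0" "\<And>S. convex_body S \<Longrightarrow> smooth_boundary S \<Longrightarrow> hausdorff_dist T S < \<delta>2 \<Longrightarrow>
      \<bar>smooth_ehz_capacity S - c'\<bar> < \<epsilon>" using c' \<epsilon> by blast
    obtain S where S: "convex_body S" "smooth_boundary S" "hausdorff_dist T S < min \<delta>1 \<delta>2"
      using smooth_approximation[of "min \<delta>1 \<delta>2"] \<delta>1(1) \<delta>2(1) by auto
    have "\<bar>smooth_ehz_capacity S - ?c\<bar> < \<epsilon>" "\<bar>smooth_ehz_capacity S - c'\<bar> < \<epsilon>"
      using \<delta>1(2)[OF S(1,2)] \<delta>2(2)[OF S(1,2)] S(3) by simp_all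
    then have "\<bar>c' - ?c\<bar> < \<epsilon> + \<epsilon>"
      using abs_triangle_ineq4[of "smooth_ehz_capacity S - ?c" "smooth_ehz_capacity S - c'"] by simp
    then show False by (simp add: \<epsilon>_def)
  qed
qed

end

text \<open>The midpoints of a ball in \<open>S\<close> and its reflection fill a ball around the origin.\<close>

lemma symmetric_body_contains_ball:
  fixes S :: "'a::euclidean_space set"
  assumes S: "convex_body S" "centrally_symmetric S"
  obtains r where "r > 0" "cball 0 r \<subseteq> S"
proof -
  obtain x where "x \<in> interior S" using S(1) by (auto simp: convex_body_def)
  then obtain e where e: "e > 0" "cball x e \<subseteq> S" by (meson mem_interior_cball)
  have "cball 0 e \<subseteq> S"
  proof
    fix z :: 'a assume "z \<in> cball 0 e"
    then have "norm z \<le> e" by simp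
    then have "x + z \<in> S" "x - z \<in> S"
      using e(2) by (auto simp: dist_norm)
    then have "x + z \<in> S" "- (x - z) \<in> S" using S(2) by (auto simp: centrally_symmetric_def)
    then have "(1 / 2) *\<^sub>R (x + z) + (1 / 2) *\<^sub>R (- (x - z)) \<in> S"
      using S(1) by (intro convexD) (auto simp: convex_body_def)
    moreover have "(1 / 2) *\<^sub>R (x + z) + (1 / 2) *\<^sub>R (- (x - z)) = z"
      by (simp add: algebra_simps flip: scaleR_2 scaleR_left_distrib)
    ultimately show "z \<in> S" by simp
  qed
  with e(1) show ?thesis by (rule that)
qed

theorem theorem5p2:
  fixes S L :: "'n::finite phase set"
    and \<Phi> :: "'n phase set \<Rightarrow> 'm::finite phase"
  assumes "convex_body S" and "centrally_symmetric S"
    and "isotropic L" and "dim L < CARD('n)"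
    and "reduction_symplectomorphism L \<Phi>"
  shows "ehz_capacity (\<Phi> ` symplectic_reduction S L) \<ge> ehz_capacity S"
proof -
  obtain r where r: "r > 0" "cball 0 r \<subseteq> S"
    using symmetric_body_contains_ball assms(1,2) by blast
  interpret S: pointed_body S r using pointed_bodyI[OF assms(1) r] .
  interpret reduction L \<Phi> using assms(3,5) by unfold_locales
  let ?S' = "\<Phi> ` symplectic_reduction S L"
  note S' = convex_body_reduction[OF assms(1) r]
  obtain r' where r': "r' > 0" "cball 0 r' \<subseteq> ?S'"
    using S'(2) by (meson mem_interior_cball)
  interpret S': pointed_body ?S' r' using pointed_bodyI[OF S'(1) r'] .
  have "1 / (2 * iso_const S) \<le> 1 / (2 * iso_const ?S')"
    using iso_const_reduction_le[OF assms(1) r assms(2)] S'.iso_pos by (intro divide_left_mono) auto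
  then show ?thesis
    unfolding S.ehz_capacity_eq S'.ehz_capacity_eq .
qed

end
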